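(* Fix $y_1<\dots<y_N$. For $\beta>0$ let $\{x_i^k(\beta)\}_{1\le i\le k\le N}$ be the $\beta$-corners process with top row $y_1<\dots<y_N$, and let $\{\tilde x_i^k,\xi_i^k\}_{1\le i\le k\le N}$ be the $\infty$-corners process with the same top row. Then, as $\beta\to\infty$, we have the convergence in distribution (of arrays indexed by $1\le i\le k\le N$) $$\tilde x_i^k=\lim_{\beta\to\infty}x_i^k(\beta),\qquad \xi_i^k=\lim_{\beta\to\infty}\sqrt\beta\,\bigl(x_i^k(\beta)-\tilde x_i^k\bigr),\qquad 1\le i\le k\le N.$$
   Context: Let $\mathcal G_N$ be the set of arrays $\{x_i^k\}_{1\le i\le k\le N}$ of reals with $x_i^{k+1}\le x_i^k\le x_{i+1}^{k+1}$ (Gelfand–Tsetlin patterns of rank $N$). **$\beta$-corners process.** With top row $y_1<\dots<y_N$, it is the probability distribution on arrays in $\mathcal G_N$ such that $x_i^N=y_i$, $i=1,\dots,N$, and the remaining $N(N-1)/2$ coordinates have density $$\frac1{Z_N}\prod_{k=1}^{N-1}\Bigl[\prod_{1\le i<j\le k}(x_j^k-x_i^k)^{2-\beta}\Bigr]\Bigl[\prod_{a=1}^k\prod_{b=1}^{k+1}|x_a^k-x_b^{k+1}|^{\beta/2-1}\Bigr],\qquad Z_N=\prod_{k=1}^N\frac{\Gamma(\beta/2)^k}{\Gamma(k\beta/2)}\prod_{1\le i<j\le N}(y_j-y_i)^{\beta-1}.$$ **$\infty$-corners process.** With top row $y_1<\dots<y_N$, it consists of (i) the deterministic array $\{\tilde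 x_i^k\}_{1\le i\le k\le N}\in\mathcal G_N$ such that for each $k=1,\dots,N$, $\tilde x_1^k<\dots<\tilde x_k^k$ and $$\prod_{i=1}^k(z-\tilde x_i^k)=\frac1{N(N-1)\cdots(k+1)}\left(\frac{\partial}{\partial z}\right)^{N-k}\Bigl[\prod_{i=1}^N(z-y_i)\Bigr],$$ and (ii) a Gaussian field $\{\xi_i^k\}_{1\le i\le k\le N}$ such that $\xi_1^N=\dots=\xi_N^N=0$ and the remaining coordinates have density (with respect to Lebesgue measure on $\mathbb R^{N(N-1)/2}$) proportional to $$\exp\left(\sum_{k=1}^{N-1}\left[\sum_{1\le i<j\le k}\frac{(\xi_i^k-\xi_j^k)^2}{2(\tilde x_i^k-\tilde x_j^k)^2}-\sum_{a=1}^k\sum_{b=1}^{k+1}\frac{(\xi_a^k-\xi_b^{k+1})^2}{4(\tilde x_a^k-\tilde x_b^{k+1})^2}\right]\right).$$ (This function is integrable, so the density is well-defined.) *)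

theory Defs
  imports "HOL-Probability.Probability" "HOL-Computational_Algebra.Polynomial"
begin

text \<open>The entry \<open>x\<^sub>i\<^sup>k\<close> of an array is \<open>x (k, i)\<close>: the row index comes first. Arrays are
  extensional functions on the index set, i.e. points of the finite product
  \<open>gt_index N \<rightarrow>\<^sub>E UNIV\<close>.\<close>

definition gt_index :: "nat \<Rightarrow> (nat \<times> nat) set" where
  "gt_index N = {(k, i). 1 \<le> i \<and> i \<le> k \<and> k \<le> N}"

definition gt_patterns :: "nat \<Rightarrow> (nat \<times> nat \<Rightarrow> real) set" where
  "gt_patterns N = {x \<in> gt_index N \<rightarrow>\<^sub>E UNIV.
     \<forall>k i. 1 \<le> i \<and> i \<le> k \<and> k < N \<longrightarrow> x (k + 1, i) \<le> x (k, i) \<and> x (k, i) \<le> x (k + 1, i + 1)}"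

text \<open>For \<open>N \<ge> 1\<close> the coordinates below the top row are indexed by \<open>gt_index (N - 1)\<close>. Both
  processes are given by a density in these coordinates and are then pushed forward to full
  arrays by adding the deterministic top row.\<close>

definition with_top :: "nat \<Rightarrow> (nat \<Rightarrow> real) \<Rightarrow> (nat \<times> nat \<Rightarrow> real) \<Rightarrow> nat \<times> nat \<Rightarrow> real" where
  "with_top N y z = restrict (\<lambda>(k, i). if k = N then y i else z (k, i)) (gt_index N)"

abbreviation array_borel :: "nat \<Rightarrow> (nat \<times> nat \<Rightarrow> real) measure" where
  "array_borel N \<equiv> Pi\<^sub>M (gt_index N) (\<lambda>_. borel)"

abbreviation array_lborel :: "nat \<Rightarrow> (nat \<times> nat \<Rightarrow> real) measure" where
  "array_lborel N \<equiv> Pi\<^sub>M (gt_index N) (\<lambda>_. lborel)"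

abbreviation array_topology :: "nat \<Rightarrow> (nat \<times> nat \<Rightarrow> real) topology" where
  "array_topology N \<equiv> product_topology (\<lambda>_. euclideanreal) (gt_index N)"

definition beta_corners_Z :: "nat \<Rightarrow> (nat \<Rightarrow> real) \<Rightarrow> real \<Rightarrow> real" where
  "beta_corners_Z N y \<beta> =
     (\<Prod>k=1..N. Gamma (\<beta> / 2) ^ k / Gamma (real k * \<beta> / 2)) *
     (\<Prod>j=1..N. \<Prod>i=1..<j. (y j - y i) powr (\<beta> - 1))"

definition beta_corners_density ::
    "nat \<Rightarrow> (nat \<Rightarrow> real) \<Rightarrow> real \<Rightarrow> (nat \<times> nat \<Rightarrow> real) \<Rightarrow> real" where
  "beta_corners_density N y \<beta> x =
     indicator (gt_patterns N) x / beta_corners_Z N y \<beta> *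
     (\<Prod>k=1..<N.
        (\<Prod>j=1..k. \<Prod>i=1..<j. (x (k, j) - x (k, i)) powr (2 - \<beta>)) *
        (\<Prod>a=1..k. \<Prod>b=1..k+1. \<bar>x (k, a) - x (k + 1, b)\<bar> powr (\<beta> / 2 - 1)))"

definition beta_corners ::
    "nat \<Rightarrow> (nat \<Rightarrow> real) \<Rightarrow> real \<Rightarrow> (nat \<times> nat \<Rightarrow> real) measure" where
  "beta_corners N y \<beta> =
     distr (density (array_lborel (N - 1))
                    (\<lambda>z. ennreal (beta_corners_density N y \<beta> (with_top N y z))))
           (array_borel N) (with_top N y)"

definition infty_corners_array ::
    "nat \<Rightarrow> (nat \<Rightarrow> real) \<Rightarrow> (nat \<times> nat \<Rightarrow> real) \<Rightarrow> bool" where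
  "infty_corners_array N y xt \<longleftrightarrow>
     xt \<in> gt_patterns N \<and>
     (\<forall>k\<in>{1..N}.
        strict_mono_on {1..k} (\<lambda>i. xt (k, i)) \<and>
        (\<Prod>i=1..k. [:- xt (k, i), 1:]) =
          smult (1 / (\<Prod>j=k+1..N. real j)) ((pderiv ^^ (N - k)) (\<Prod>i=1..N. [:- y i, 1:])))"

definition infty_corners_weight ::
    "nat \<Rightarrow> (nat \<times> nat \<Rightarrow> real) \<Rightarrow> (nat \<times> nat \<Rightarrow> real) \<Rightarrow> real" where
  "infty_corners_weight N xt \<xi> = exp (\<Sum>k=1..<N.
     (\<Sum>j=1..k. \<Sum>i=1..<j. (\<xi> (k, i) - \<xi> (k, j))\<^sup>2 / (2 * (xt (k, i) - xt (k, j))\<^sup>2)) -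
     (\<Sum>a=1..k. \<Sum>b=1..k+1.
        (\<xi> (k, a) - \<xi> (k + 1, b))\<^sup>2 / (4 * (xt (k, a) - xt (k + 1, b))\<^sup>2)))"

definition infty_corners_field ::
    "nat \<Rightarrow> (nat \<times> nat \<Rightarrow> real) \<Rightarrow> (nat \<times> nat \<Rightarrow> real) measure" where
  "infty_corners_field N xt =
     (let w = (\<lambda>z. ennreal (infty_corners_weight N xt (with_top N (\<lambda>_. 0) z)));
          L = array_lborel (N - 1)
      in distr (density L (\<lambda>z. w z / (\<integral>\<^sup>+ u. w u \<partial>L))) (array_borel N) (with_top N (\<lambda>_. 0)))"

text \<open>Convergence in distribution, stated for laws, by testing against bounded continuous
  functions; the library's \<open>weak_conv_m\<close> only covers laws on the real line.\<close>

definition conv_in_distribution ::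
    "'a topology \<Rightarrow> ('b \<Rightarrow> 'a measure) \<Rightarrow> 'a measure \<Rightarrow> 'b filter \<Rightarrow> bool" where
  "conv_in_distribution T M M' F \<longleftrightarrow>
     (\<forall>f. continuous_map T euclideanreal f \<and> bounded (f ` topspace T) \<longrightarrow>
          ((\<lambda>b. integral\<^sup>L (M b) f) \<longlongrightarrow> integral\<^sup>L M' f) F)"

end

theory Submission
  imports Defs "HOL-Real_Asymp.Real_Asymp"
begin

text \<open>
  Put \<open>\<theta> = \<beta> / 2\<close>. Shifting the Vandermonde factors by one row, the density of the
  \<open>\<beta>\<close>-corners process is, on strict patterns, exactly a constant times \<open>exp ((\<theta> - 1) \<Phi>(x))\<close>, where
  \<open>\<Phi>\<close> is a sum over \<open>k\<close> of
  \<open>\<Sum>\<^sub>a\<^sub>b ln \<bar>x\<^sub>a\<^sup>k - x\<^sub>b\<^sup>k\<^sup>+\<^sup>1\<bar> - 2 \<Sum>\<^sub>i\<^sub><\<^sub>j ln (x\<^sub>j\<^sup>k\<^sup>+\<^sup>1 - x\<^sub>i\<^sup>k\<^sup>+\<^sup>1) + (k + 1) ln (k + 1)\<close>.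
  Given row \<open>k + 1\<close>, the coordinates of row \<open>k\<close> decouple in this expression; it is at most \<open>0\<close>, with
  equality exactly when row \<open>k\<close> consists of the critical points of the polynomial whose roots are
  row \<open>k + 1\<close>. Hence \<open>\<Phi>\<close> is maximal at the array of iterated derivatives, with a quadratic upper
  bound, and Laplace's method with dominated convergence applies. The second-order expansion
  of \<open>\<Phi>\<close> is the exponent of the \<open>\<infinity>\<close>-corners weight. That no mass is lost follows by comparing
  Stirling's formula for the normalization with the Gaussian integral of the weight, which is
  computed row by row after completing squares.
\<close>

section \<open>Stirling's formula\<close>

text \<open>Dominated convergence yields a limit of the form \<kappa> times an integral against the
  Gaussian weight. This is integration against the normalized limit law only if \<kappa> times the
  total Gaussian mass is exactly 1. Hence Stirling's formula enters with its constant, and the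
  Gaussian mass is found in closed form.

  The shift by one row pays off at both orders. For the polynomial P of row k + 1, the resultant of
  P and P' is the discriminant up to the factor (k + 1)^(k + 1); this gives the maximal value 0 and
  is the origin of the term (k + 1) ln (k + 1). At second order, completing squares in row k leaves
  a variance of row k + 1, and a residue computation shows that it cancels the Vandermonde part of
  row k + 1. So the weight is triangular Gaussian, although its exponent contains squares with a
  positive sign and integrability is not visible term by term. The Hessian determinant of each row
  involves a ratio of squared Vandermonde products, so the row integrals telescope to the
  Vandermonde product of the top row.\<close>

definition ln_Gamma_err :: "real \<Rightarrow> real" where
  "ln_Gamma_err x = ln (Gamma x) - (x - 1 / 2) * ln x + x"

lemma ln_1_plus_taylor_bounds:
  fixes u :: real
  assumes "0 \<le> u"
  shows "u - u\<^sup>2 / 2 \<le> ln (1 + u)" "ln (1 + u) \<le> u - u\<^sup>2 / 2 + u ^ 3 / 3"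
proof -
  have "(\<lambda>u::real. ln (1 + u) - (u - u\<^sup>2 / 2)) 0 \<le> (\<lambda>u::real. ln (1 + u) - (u - u\<^sup>2 / 2)) u"
  proof (rule DERIV_nonneg_imp_nondecreasing[OF assms])
    fix x :: real assume "0 \<le> x" "x \<le> u"
    have "((\<lambda>u::real. ln (1 + u) - (u - u\<^sup>2 / 2)) has_real_derivative x\<^sup>2 / (1 + x)) (at x)"
      using \<open>0 \<le> x\<close> by (auto intro!: derivative_eq_intros simp: field_simps power2_eq_square)
    then show "\<exists>y. ((\<lambda>u::real. ln (1 + u) - (u - u\<^sup>2 / 2)) has_real_derivative y) (at x) \<and> 0 \<le> y"
      using \<open>0 \<le> x\<close> by (intro exI[of _ "x\<^sup>2 / (1 + x)"]) auto
  qed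
  then show "u - u\<^sup>2 / 2 \<le> ln (1 + u)" by simp
  have "(\<lambda>u::real. u - u\<^sup>2 / 2 + u ^ 3 / 3 - ln (1 + u)) 0 \<le> (\<lambda>u::real. u - u\<^sup>2 / 2 + u ^ 3 / 3 - ln (1 + u)) u"
  proof (rule DERIV_nonneg_imp_nondecreasing[OF assms])
    fix x :: real assume "0 \<le> x" "x \<le> u"
    have "((\<lambda>u::real. u - u\<^sup>2 / 2 + u ^ 3 / 3 - ln (1 + u)) has_real_derivative x ^ 3 / (1 + x)) (at x)"
      using \<open>0 \<le> x\<close>
      by (auto intro!: derivative_eq_intros simp: field_simps power2_eq_square power3_eq_cube)
    then show "\<exists>y. ((\<lambda>u::real. u - u\<^sup>2 / 2 + u ^ 3 / 3 - ln (1 + u)) has_real_derivative y) (at x) \<and> 0 \<le> y"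
      using \<open>0 \<le> x\<close> by (intro exI[of _ "x ^ 3 / (1 + x)"]) auto
  qed
  then show "ln (1 + u) \<le> u - u\<^sup>2 / 2 + u ^ 3 / 3" by simp
qed

text \<open>By \<open>Gamma (x + 1) = x * Gamma x\<close> the difference is (x + 1/2) ln (1 + 1/x) -
  1. The shift 1/2 cancels the terms of order 1/x and leaves order 1/x^2. The bound is written as a
  difference of values of 1/(2x) so that unit steps telescope.\<close>

lemma ln_Gamma_err_step:
  assumes "1 \<le> x"
  shows "\<bar>ln_Gamma_err x - ln_Gamma_err (x + 1)\<bar> \<le> 1 / (2 * x) - 1 / (2 * (x + 1))"
proof -
  have G: "Gamma (x + 1) = x * Gamma x" and "Gamma x > 0"
    using assms by (auto intro!: Gamma_plus1 Gamma_real_pos dest: nonpos_Ints_nonpos)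
  define l where "l = ln (1 + 1 / x)"
  have lx: "ln (x + 1) = ln x + l"
  proof -
    have "x + 1 = x * (1 + 1 / x)" using assms by (simp add: field_simps)
    moreover have "0 < 1 + 1 / x" using assms by (simp add: add_pos_pos)
    ultimately show ?thesis using assms unfolding l_def by (simp add: ln_mult_pos)
  qed
  have "ln_Gamma_err x - ln_Gamma_err (x + 1) = (x + 1 / 2) * l - 1"
    using assms \<open>Gamma x > 0\<close> unfolding ln_Gamma_err_def G lx
    by (simp add: ln_mult_pos algebra_simps add_divide_distrib)
  moreover have "l \<le> 1 / x - (1 / x)\<^sup>2 / 2 + (1 / x) ^ 3 / 3" "1 / x - (1 / x)\<^sup>2 / 2 \<le> l"
    using ln_1_plus_taylor_bounds[of "1 / x"] assms unfolding l_def by auto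
  then have "(x + 1 / 2) * l \<le> (x + 1 / 2) * (1 / x - (1 / x)\<^sup>2 / 2 + (1 / x) ^ 3 / 3)"
    "(x + 1 / 2) * (1 / x - (1 / x)\<^sup>2 / 2) \<le> (x + 1 / 2) * l"
    using assms by (auto intro!: mult_left_mono)
  moreover have "(x + 1 / 2) * (1 / x - (1 / x)\<^sup>2 / 2) = 1 - 1 / (4 * x\<^sup>2)"
    using assms by (simp add: field_simps power2_eq_square)
  moreover have "(x + 1 / 2) * (1 / x - (1 / x)\<^sup>2 / 2 + (1 / x) ^ 3 / 3) = 1 + 1 / (12 * x\<^sup>2) + 1 / (6 * x ^ 3)"
    using assms by (simp add: field_simps power2_eq_square power3_eq_cube)
  moreover have "1 / (6 * x ^ 3) \<le> 1 / (6 * x\<^sup>2)"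
    using assms by (intro divide_left_mono mult_left_mono power_increasing) auto
  moreover have "1 / (12 * x\<^sup>2) + 1 / (6 * x\<^sup>2) = 1 / (4 * x\<^sup>2)"
    using assms by (simp add: field_simps)
  moreover have "1 / (4 * x\<^sup>2) \<le> 1 / (2 * x) - 1 / (2 * (x + 1))"
  proof -
    have "1 / (4 * x\<^sup>2) \<le> 1 / (2 * (x * (x + 1)))"
      using assms by (intro divide_left_mono) (auto simp: power2_eq_square algebra_simps intro!: add_pos_pos mult_pos_pos)
    also have "\<dots> = 1 / (2 * x) - 1 / (2 * (x + 1))"
      using assms by (simp add: field_simps)
    finally show ?thesis .
  qed
  ultimately show ?thesis by linarith
qed

lemma ln_Gamma_err_shift:
  assumes "1 \<le> x"
  shows "\<bar>ln_Gamma_err x - ln_Gamma_err (x + real n)\<bar> \<le> 1 / (2 * x) - 1 / (2 * (x + real n))"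
proof (induction n)
  case (Suc n)
  have "\<bar>ln_Gamma_err (x + real n) - ln_Gamma_err (x + real n + 1)\<bar>
        \<le> 1 / (2 * (x + real n)) - 1 / (2 * (x + real n + 1))"
    using ln_Gamma_err_step[of "x + real n"] assms by simp
  then show ?case using Suc.IH by (simp add: add_ac) 
qed auto

lemma ln_Gamma_err_shift':
  assumes "1 \<le> x"
  shows "\<bar>ln_Gamma_err x - ln_Gamma_err (x + real n)\<bar> \<le> 1 / (2 * x)"
proof -
  have "0 \<le> 1 / (2 * (x + real n))" using assms by simp
  then show ?thesis using ln_Gamma_err_shift[OF assms, of n] by linarith
qed

text \<open>\<open>Gamma z\<close> divided by its approximant \<open>Gamma_series z n\<close> equals
  \<open>Gamma (z + n + 1)\<close> divided by n! n^z, and this ratio tends to 1. The lemma ties the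
  remainder at a fixed real offset \<open>z\<close> to the remainder at integers.\<close>

lemma ln_Gamma_err_diff_tendsto:
  fixes z :: real
  assumes "0 < z"
  shows "(\<lambda>n. ln_Gamma_err (z + (real n + 1)) - ln_Gamma_err (real n + 1)) \<longlonglongrightarrow> 0"
proof -
  have pos: "Gamma z > 0" using assms by (rule Gamma_real_pos)
  have nz: "z \<notin> \<int>\<^sub>\<le>\<^sub>0" using assms by (auto dest: nonpos_Ints_nonpos)
  have "(\<lambda>n. ln (Gamma_series z n)) \<longlonglongrightarrow> ln (Gamma z)"
    by (rule tendsto_ln[OF Gamma_series_LIMSEQ]) (use pos in simp)
  then have "(\<lambda>n. ln (Gamma z) - ln (Gamma_series z n)) \<longlonglongrightarrow> ln (Gamma z) - ln (Gamma z)"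
    by (rule tendsto_diff[OF tendsto_const])
  moreover have "(\<lambda>n. z * ln (real n) - (z + real n + 1 / 2) * ln (z + real n + 1)
     + (real n + 1 / 2) * ln (real n + 1) + z) \<longlonglongrightarrow> 0"
    using assms by real_asymp
  ultimately have lim: "(\<lambda>n. (ln (Gamma z) - ln (Gamma_series z n)) +
     (z * ln (real n) - (z + real n + 1 / 2) * ln (z + real n + 1)
     + (real n + 1 / 2) * ln (real n + 1) + z)) \<longlonglongrightarrow> 0 + 0"
    by (intro tendsto_add) auto
  have ev: "\<forall>\<^sub>F n in sequentially. (ln (Gamma z) - ln (Gamma_series z n)) +
     (z * ln (real n) - (z + real n + 1 / 2) * ln (z + real n + 1)
     + (real n + 1 / 2) * ln (real n + 1) + z) =
     ln_Gamma_err (z + (real n + 1)) - ln_Gamma_err (real n + 1)"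
    using eventually_gt_at_top[of 0]
  proof eventually_elim
    case (elim n)
    have "pochhammer z (n + 1) = Gamma (z + real (n + 1)) / Gamma z"
      using pochhammer_Gamma[OF nz, of "n + 1"] by simp
    moreover have "Gamma (real n + 1) = fact n" using Gamma_fact[of n, where 'a=real] by (simp add: add.commute)
    moreover have "Gamma (z + real (n + 1)) > 0" using assms by (intro Gamma_real_pos) auto
    ultimately show ?case using pos elim
      unfolding Gamma_series_def ln_Gamma_err_def
      by (simp add: ln_div ln_mult algebra_simps)
  qed
  show ?thesis using Lim_transform_eventually[OF lim ev] by simp
qed

text \<open>The telescoping bound makes the values at integers a Cauchy sequence with limit L.
  Letting n grow in the shift bound from x to x + n gives distance at most 1/(2x) from L, uniformly
  for real x >= 1, so the limit exists along the reals and not only along unit steps.\<close>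

lemma ln_Gamma_err_convergent: "\<exists>L. (ln_Gamma_err \<longlongrightarrow> L) at_top"
proof -
  define e where "e n = ln_Gamma_err (real n + 1)" for n
  have step: "\<bar>e m - e (m + n)\<bar> \<le> 1 / (2 * (real m + 1))" for m n
    using ln_Gamma_err_shift'[of "real m + 1" n] unfolding e_def by (simp add: add_ac)
  have "Cauchy e"
  proof (rule CauchyI)
    fix r :: real assume "0 < r"
    obtain M :: nat where M: "1 / r < real M" using reals_Archimedean2 by blast
    have b: "1 / (2 * (real M + 1)) < r / 2"
    proof -
      have "1 < real M * r" using M \<open>0 < r\<close> by (simp add: field_simps)
      then show ?thesis using \<open>0 < r\<close> by (simp add: field_simps)
    qed
    have "\<bar>e M - e m\<bar> < r / 2" if "m \<ge> M" for m
      using step[of M "m - M"] that b by simp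
    then have "norm (e m - e n) < r" if "m \<ge> M" "n \<ge> M" for m n
      using that by (smt (verit) real_norm_def field_sum_of_halves)
    then show "\<exists>M. \<forall>m\<ge>M. \<forall>n\<ge>M. norm (e m - e n) < r" by blast
  qed
  then obtain L where L: "e \<longlonglongrightarrow> L"
    using Cauchy_convergent convergent_def by blast
  have bound: "\<bar>ln_Gamma_err x - L\<bar> \<le> 1 / (2 * x)" if "1 \<le> x" for x
  proof -
    have "(\<lambda>n. (ln_Gamma_err (x + (real n + 1)) - ln_Gamma_err (real n + 1)) + e n) \<longlonglongrightarrow> 0 + L"
      using ln_Gamma_err_diff_tendsto[of x] that L by (intro tendsto_add) auto
    then have "(\<lambda>n. \<bar>ln_Gamma_err x - ln_Gamma_err (x + real (Suc n))\<bar>) \<longlonglongrightarrow> \<bar>ln_Gamma_err x - L\<bar>"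
      by (intro tendsto_intros) (simp add: e_def add_ac)
    then show ?thesis
      by (rule LIMSEQ_le_const2) (use ln_Gamma_err_shift'[OF that] in blast)
  qed
  have "((\<lambda>x. ln_Gamma_err x - L) \<longlongrightarrow> 0) at_top"
  proof (rule Lim_null_comparison)
    show "\<forall>\<^sub>F x in at_top. norm (ln_Gamma_err x - L) \<le> 1 / (2 * x)"
      using eventually_ge_at_top[of 1] by eventually_elim (use bound in auto)
    show "((\<lambda>x. 1 / (2 * x)) \<longlongrightarrow> (0::real)) at_top" by real_asymp
  qed
  then show ?thesis using LIM_zero_iff by blast
qed

text \<open>The constant is identified by the duplication formula.\<close>

lemma ln_Gamma_err_tendsto: "(ln_Gamma_err \<longlongrightarrow> ln (2 * pi) / 2) at_top"
proof -
  obtain L where L: "(ln_Gamma_err \<longlongrightarrow> L) at_top" using ln_Gamma_err_convergent by blast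
  \<comment> \<open>The combination tends to L + L - L, the unknown constant itself, while its
    explicit value is known from the three Gamma factors of the duplication formula.\<close>
  have "((\<lambda>z. ln_Gamma_err z + ln_Gamma_err (z + 1 / 2) - ln_Gamma_err (2 * z)) \<longlongrightarrow> L + L - L) at_top"
    by (intro tendsto_intros filterlim_compose[OF L] filterlim_ident; real_asymp)
  moreover have "((\<lambda>z. ln_Gamma_err z + ln_Gamma_err (z + 1 / 2) - ln_Gamma_err (2 * z)) \<longlongrightarrow> ln (2 * pi) / 2) at_top"
  proof (rule Lim_transform_eventually)
    show "((\<lambda>z. ln 2 / 2 + ln pi / 2 + z * ln z - z * ln (z + 1 / 2) + 1 / 2) \<longlongrightarrow> ln (2 * pi) / 2) at_top"
    proof -
      have "((\<lambda>z::real. z * ln z - z * ln (z + 1 / 2) + 1 / 2) \<longlongrightarrow> 0) at_top" by real_asymp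
      then have "((\<lambda>z. (ln 2 / 2 + ln pi / 2) + (z * ln z - z * ln (z + 1 / 2) + 1 / 2)) \<longlongrightarrow> (ln 2 / 2 + ln pi / 2) + 0) at_top"
        by (intro tendsto_intros)
      then show ?thesis by (simp add: ln_mult algebra_simps add_divide_distrib)
    qed
    show "\<forall>\<^sub>F z in at_top. ln 2 / 2 + ln pi / 2 + z * ln z - z * ln (z + 1 / 2) + 1 / 2 =
       ln_Gamma_err z + ln_Gamma_err (z + 1 / 2) - ln_Gamma_err (2 * z)"
      using eventually_gt_at_top[of 0]
    proof eventually_elim
      case (elim z)
      have "complex_of_real z \<notin> \<int>\<^sub>\<le>\<^sub>0" "complex_of_real z + 1 / 2 \<notin> \<int>\<^sub>\<le>\<^sub>0"
        using elim by (auto elim!: nonpos_Ints_cases simp: complex_eq_iff)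
      then have "complex_of_real (Gamma z * Gamma (z + 1 / 2)) =
          complex_of_real (exp ((1 - 2 * z) * ln 2) * sqrt pi * Gamma (2 * z))"
        using Gamma_legendre_duplication[of "complex_of_real z"]
        by (simp flip: Gamma_complex_of_real exp_of_real)
      then have dup: "Gamma z * Gamma (z + 1 / 2) = exp ((1 - 2 * z) * ln 2) * sqrt pi * Gamma (2 * z)"
        using of_real_eq_iff by blast
      have pos: "Gamma z > 0" "Gamma (z + 1 / 2) > 0" "Gamma (2 * z) > 0"
        using elim by (auto intro!: Gamma_real_pos)
      have "ln (Gamma z) + ln (Gamma (z + 1 / 2)) = ln (Gamma z * Gamma (z + 1 / 2))"
        using pos by (simp add: ln_mult)
      also have "\<dots> = (1 - 2 * z) * ln 2 + ln pi / 2 + ln (Gamma (2 * z))"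
        unfolding dup using pos by (simp add: ln_mult ln_sqrt)
      finally show ?case
        unfolding ln_Gamma_err_def using elim by (simp add: ln_mult field_simps)
    qed
  qed
  ultimately have "L + L - L = ln (2 * pi) / 2"
    by (rule tendsto_unique[rotated]) simp
  then have "L = ln (2 * pi) / 2" by simp
  then show ?thesis using L by blast
qed

text \<open>This is one row's share of the prefactor of the density, with n = k + 1 and t = \<beta>
  / 2: the Gamma quotient comes from 1 / Z, the power of n from the constants in the energy, and the
  power of 2t = \<beta> is the Jacobian of the k entries of row k. In Stirling's formula all growth
  in t cancels.\<close>

lemma multinomial_Gamma_tendsto:
  fixes n :: nat
  assumes "1 \<le> n"
  shows "((\<lambda>t. Gamma (real n * t) / Gamma t ^ n * real n powr (- real n * (t - 1)) *
            (2 * t) powr (- (real n - 1) / 2))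
          \<longlongrightarrow> (4 * pi) powr (- (real n - 1) / 2) * real n powr (real n - 1 / 2)) at_top"
proof (rule Lim_transform_eventually)
  have "filterlim (\<lambda>t::real. real n * t) at_top at_top" using assms by real_asymp
  then have "((\<lambda>t. exp (ln_Gamma_err (real n * t) - real n * ln_Gamma_err t
      + (real n - 1 / 2) * ln n - (real n - 1) / 2 * ln 2)) \<longlongrightarrow>
     exp (ln (2 * pi) / 2 - real n * (ln (2 * pi) / 2) + (real n - 1 / 2) * ln n - (real n - 1) / 2 * ln 2)) at_top"
    by (intro tendsto_intros ln_Gamma_err_tendsto filterlim_compose[OF ln_Gamma_err_tendsto])
  moreover have "exp (ln (2 * pi) / 2 - real n * (ln (2 * pi) / 2) + (real n - 1 / 2) * ln n - (real n - 1) / 2 * ln 2)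
     = (4 * pi) powr (- (real n - 1) / 2) * real n powr (real n - 1 / 2)"
  proof -
    have "ln (4 * pi) = ln (2 * pi) + ln 2" using ln_mult_pos[of "2 * pi" 2] by simp
    then have "exp (ln (2 * pi) / 2 - real n * (ln (2 * pi) / 2) + (real n - 1 / 2) * ln n - (real n - 1) / 2 * ln 2)
      = exp (- (real n - 1) / 2 * ln (4 * pi) + (real n - 1 / 2) * ln n)"
      by (simp add: field_simps)
    then show ?thesis using assms unfolding exp_add by (simp add: powr_def)
  qed
  ultimately show "((\<lambda>t. exp (ln_Gamma_err (real n * t) - real n * ln_Gamma_err t
      + (real n - 1 / 2) * ln n - (real n - 1) / 2 * ln 2)) \<longlongrightarrow>
      (4 * pi) powr (- (real n - 1) / 2) * real n powr (real n - 1 / 2)) at_top" by simp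
  show "\<forall>\<^sub>F t in at_top. exp (ln_Gamma_err (real n * t) - real n * ln_Gamma_err t
      + (real n - 1 / 2) * ln n - (real n - 1) / 2 * ln 2) =
     Gamma (real n * t) / Gamma t ^ n * real n powr (- real n * (t - 1)) * (2 * t) powr (- (real n - 1) / 2)"
    using eventually_gt_at_top[of 0]
  proof eventually_elim
    case (elim t)
    have pos: "Gamma t > 0" "Gamma (real n * t) > 0"
      using elim assms by (auto intro!: Gamma_real_pos)
    have "ln (Gamma (real n * t) / Gamma t ^ n * real n powr (- real n * (t - 1)) * (2 * t) powr (- (real n - 1) / 2))
      = ln (Gamma (real n * t)) - real n * ln (Gamma t) - real n * (t - 1) * ln n - (real n - 1) / 2 * (ln 2 + ln t)"
    proof -
      have q: "0 < Gamma (real n * t) / Gamma t ^ n" using pos by simp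
      have "ln (Gamma (real n * t) / Gamma t ^ n) = ln (Gamma (real n * t)) - real n * ln (Gamma t)"
        using pos by (simp add: ln_div ln_realpow)
      then show ?thesis
        using q elim assms
        by (subst ln_mult_pos, simp, simp)+ (simp add: ln_powr ln_mult_pos field_simps)
    qed
    also have "\<dots> = ln_Gamma_err (real n * t) - real n * ln_Gamma_err t
      + (real n - 1 / 2) * ln n - (real n - 1) / 2 * ln 2"
      using pos elim assms unfolding ln_Gamma_err_def by (simp add: ln_mult field_simps)
    finally have "exp (ln_Gamma_err (real n * t) - real n * ln_Gamma_err t
      + (real n - 1 / 2) * ln n - (real n - 1) / 2 * ln 2) = exp (ln (Gamma (real n * t) / Gamma t ^ n * real n powr (- real n * (t - 1)) * (2 * t) powr (- (real n - 1) / 2)))" by simp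
    also have "\<dots> = Gamma (real n * t) / Gamma t ^ n * real n powr (- real n * (t - 1)) * (2 * t) powr (- (real n - 1) / 2)"
      using pos elim assms by (intro exp_ln) auto
    finally show ?case .
  qed
qed

section \<open>Critical points of a polynomial with real roots\<close>

definition row_poly :: "nat \<Rightarrow> (nat \<Rightarrow> real) \<Rightarrow> real poly" where
  "row_poly n v = (\<Prod>i=1..n. [:- v i, 1:])"

definition vdm :: "nat \<Rightarrow> (nat \<Rightarrow> real) \<Rightarrow> real" where
  "vdm n v = (\<Prod>j=1..n. \<Prod>i=1..<j. v j - v i)"

definition strict_interlace :: "nat \<Rightarrow> (nat \<Rightarrow> real) \<Rightarrow> (nat \<Rightarrow> real) \<Rightarrow> bool" where
  "strict_interlace k r v \<longleftrightarrow> (\<forall>a\<in>{1..k}. v a < r a \<and> r a < v (a + 1))"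

text \<open>The factor \<open>k + 1\<close> matches leading coefficients; interlacing fixes the
  labelling of the roots of the derivative.\<close>

definition crit :: "nat \<Rightarrow> (nat \<Rightarrow> real) \<Rightarrow> (nat \<Rightarrow> real) \<Rightarrow> bool" where
  "crit k r v \<longleftrightarrow> strict_interlace k r v \<and>
     pderiv (row_poly (k + 1) v) = smult (real (k + 1)) (row_poly k r)"

lemma poly_row_poly: "poly (row_poly n v) z = (\<Prod>i=1..n. z - v i)"
  by (simp add: row_poly_def poly_prod)

lemma degree_row_poly [simp]: "degree (row_poly n v) = n"
  by (simp add: row_poly_def degree_prod_sum_eq)

lemma lead_coeff_row_poly [simp]: "coeff (row_poly n v) n = 1"
proof -
  have "lead_coeff (row_poly n v) = 1"
    unfolding row_poly_def by (simp add: lead_coeff_prod)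
  then show ?thesis by simp
qed

lemma poly_row_poly_eq_0_iff: "poly (row_poly n v) z = 0 \<longleftrightarrow> z \<in> v ` {1..n}"
  by (auto simp: poly_row_poly)

lemma poly_pderiv_row_poly:
  "poly (pderiv (row_poly n v)) z = (\<Sum>b=1..n. \<Prod>c\<in>{1..n} - {b}. z - v c)"
  by (simp add: row_poly_def pderiv_prod poly_sum poly_prod pderiv_pCons)

text \<open>Logarithmic derivative of the row polynomial. It turns "critical point" into the
  vanishing of a sum of reciprocals.\<close>

lemma poly_pderiv_row_poly':
  assumes "z \<notin> v ` {1..n}"
  shows "poly (pderiv (row_poly n v)) z = poly (row_poly n v) z * (\<Sum>b=1..n. 1 / (z - v b))"
  unfolding poly_pderiv_row_poly sum_distrib_left
proof (rule sum.cong)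
  fix b assume b: "b \<in> {1..n}"
  then have "poly (row_poly n v) z = (z - v b) * (\<Prod>c\<in>{1..n} - {b}. z - v c)"
    unfolding poly_row_poly by (subst prod.remove[of _ b]) auto
  moreover have "z - v b \<noteq> 0" using assms b by auto
  ultimately show "(\<Prod>c\<in>{1..n} - {b}. z - v c) = poly (row_poly n v) z * (1 / (z - v b))"
    by simp
qed simp

lemma poly_pderiv_row_poly_root:
  assumes "b \<in> {1..n}"
  shows "poly (pderiv (row_poly n v)) (v b) = (\<Prod>c\<in>{1..n} - {b}. v b - v c)"
proof -
  have "(\<Sum>b'\<in>{1..n} - {b}. \<Prod>c\<in>{1..n} - {b'}. v b - v c) = 0"
  proof (rule sum.neutral, rule ballI)
    fix b' assume "b' \<in> {1..n} - {b}"
    then show "(\<Prod>c\<in>{1..n} - {b'}. v b - v c) = 0" using assms by (intro prod_zero) auto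
  qed
  then show ?thesis
    unfolding poly_pderiv_row_poly using assms by (subst sum.remove[of _ b]) auto
qed

lemma strict_interlace_imp_strict_mono:
  assumes "strict_interlace k r v"
  shows "strict_mono_on {1..k + 1} v" "strict_mono_on {1..k} r"
proof -
  have step: "v a < v (Suc a)" if "a \<in> {1..k}" for a
    using assms that unfolding strict_interlace_def by force
  have lt: "v i < v j" if "1 \<le> i" "i < j" "j \<le> k + 1" for i j
    using that(2,3)
  proof (induction j)
    case (Suc j)
    show ?case
    proof (cases "i = j")
      case True then show ?thesis using step[of i] that Suc by auto
    next
      case False
      then have "v i < v j" using Suc by auto
      then show ?thesis using step[of j] that Suc by auto
    qed
  qed simp
  then show mv: "strict_mono_on {1..k + 1} v" by (auto intro!: strict_mono_onI)
  show "strict_mono_on {1..k} r"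
  proof (rule strict_mono_onI)
    fix i j assume ij: "i \<in> {1..k}" "j \<in> {1..k}" "i < j"
    have "r i < v (i + 1)" using assms ij unfolding strict_interlace_def by auto
    also have "\<dots> \<le> v j" using lt[of "i + 1" j] ij by (cases "i + 1 = j") auto
    also have "\<dots> < r j" using assms ij unfolding strict_interlace_def by auto
    finally show "r i < r j" .
  qed
qed

lemma strict_interlace_neq:
  assumes "strict_interlace k r v" "a \<in> {1..k}" "b \<in> {1..k + 1}"
  shows "r a \<noteq> v b" "b \<le> a \<Longrightarrow> v b < r a" "a < b \<Longrightarrow> r a < v b"
proof -
  have v: "strict_mono_on {1..k + 1} v" using strict_interlace_imp_strict_mono assms by auto
  have a: "v a < r a" "r a < v (a + 1)" using assms unfolding strict_interlace_def by auto
  show 1: "v b < r a" if "b \<le> a"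
    using strict_mono_onD[OF v, of b a] assms a that by (cases "b = a") auto
  show 2: "r a < v b" if "a < b"
    using strict_mono_onD[OF v, of "a + 1" b] assms a that by (cases "b = a + 1") auto
  show "r a \<noteq> v b" using 1 2 by (cases "b \<le> a") auto
qed

lemma vdm_pos:
  assumes "strict_mono_on {1..n} v"
  shows "0 < vdm n v"
proof -
  have "v i < v j" if "j \<in> {1..n}" "i \<in> {1..<j}" for i j
    using strict_mono_onD[OF assms, of i j] that by auto
  then show ?thesis unfolding vdm_def by (intro prod_pos) simp
qed

text \<open>Rolle's theorem gives one critical point in each of the k gaps. The derivative and the
  multiple of the polynomial with these roots have degree at most k, agree at k points and have the
  same coefficient of degree k, so they coincide.\<close>

lemma crit_exists:
  assumes v: "strict_mono_on {1..k + 1} v"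
  shows "\<exists>r. crit k r v"
proof -
  let ?P = "row_poly (k + 1) v"
  have "\<exists>x. v a < x \<and> x < v (a + 1) \<and> poly (pderiv ?P) x = 0" if a: "a \<in> {1..k}" for a
  proof -
    have lt: "v a < v (a + 1)" using strict_mono_onD[OF v, of a "a + 1"] a by auto
    then obtain x where "v a < x" "x < v (a + 1)"
      "poly ?P (v (a + 1)) - poly ?P (v a) = (v (a + 1) - v a) * poly (pderiv ?P) x"
      using poly_MVT by blast
    moreover have "poly ?P (v (a + 1)) = 0" "poly ?P (v a) = 0"
      using a by (auto simp: poly_row_poly_eq_0_iff)
    ultimately show ?thesis using lt by auto
  qed
  then obtain r where r: "\<And>a. a \<in> {1..k} \<Longrightarrow> v a < r a \<and> r a < v (a + 1) \<and> poly (pderiv ?P) (r a) = 0"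
    by metis
  then have il: "strict_interlace k r v" by (auto simp: strict_interlace_def)
  have inj: "inj_on r {1..k}"
    using strict_interlace_imp_strict_mono(2)[OF il] by (rule strict_mono_on_imp_inj_on)
  have "pderiv ?P = smult (real (k + 1)) (row_poly k r)"
  proof (rule poly_eqI_degree_lead_coeff[where n=k and A="r ` {1..k}"])
    show "coeff (pderiv ?P) k = coeff (smult (real (k + 1)) (row_poly k r)) k"
      using lead_coeff_row_poly[of "k + 1" v] by (simp add: coeff_pderiv)
    show "k \<le> card (r ` {1..k})" using inj by (simp add: card_image)
    show "poly (pderiv ?P) z = poly (smult (real (k + 1)) (row_poly k r)) z" if "z \<in> r ` {1..k}" for z
      using that r by (auto simp: poly_row_poly_eq_0_iff)
  qed (auto simp: degree_pderiv intro: order.trans[OF degree_smult_le])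
  with il show ?thesis unfolding crit_def by auto
qed

text \<open>First-order condition: the sum is the derivative in \<open>r a\<close> of the
  logarithmic terms of the energy, so the linear term of the energy bound will vanish.\<close>

lemma crit_sum_zero:
  assumes "crit k r v" "a \<in> {1..k}"
  shows "(\<Sum>b=1..k + 1. 1 / (r a - v b)) = 0"
proof -
  have il: "strict_interlace k r v" using assms by (simp add: crit_def)
  have notin: "r a \<notin> v ` {1..k + 1}" using strict_interlace_neq(1)[OF il assms(2)] by force
  have "poly (pderiv (row_poly (k + 1) v)) (r a) = 0"
    using assms by (auto simp: crit_def poly_row_poly_eq_0_iff)
  then show ?thesis
    using poly_pderiv_row_poly'[OF notin] notin poly_row_poly_eq_0_iff by auto
qed

text \<open>Differentiate P' = P S with S(z) the sum of the 1 / (z - v b). At a zero of S this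
  leaves P'' = P S', and P'' at \<open>r a\<close> is k + 1 times the product of the differences
  \<open>r a - r c\<close>.\<close>

lemma crit_sum_squares:
  assumes "crit k r v" "a \<in> {1..k}"
  shows "(\<Prod>b=1..k + 1. r a - v b) * (\<Sum>b=1..k + 1. 1 / (r a - v b)\<^sup>2) =
         - real (k + 1) * (\<Prod>c\<in>{1..k} - {a}. r a - r c)"
proof -
  have il: "strict_interlace k r v" using assms by (simp add: crit_def)
  let ?P = "row_poly (k + 1) v"
  let ?S = "\<lambda>z. \<Sum>b=1..k + 1. 1 / (z - v b)"
  have notin: "r a \<notin> v ` {1..k + 1}" using strict_interlace_neq(1)[OF il assms(2)] by force
  have dS: "(?S has_real_derivative - (\<Sum>b=1..k + 1. 1 / (r a - v b)\<^sup>2)) (at (r a))"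
    unfolding sum_negf[symmetric]
    using notin by (intro DERIV_sum) (auto intro!: derivative_eq_intros simp: power2_eq_square)
  have "((\<lambda>z. poly ?P z * ?S z) has_real_derivative
      (poly (pderiv ?P) (r a) * ?S (r a) + - (\<Sum>b=1..k + 1. 1 / (r a - v b)\<^sup>2) * poly ?P (r a))) (at (r a))"
    by (rule DERIV_mult'[OF poly_DERIV dS, THEN DERIV_cong]) simp
  then have d1: "((\<lambda>z. poly ?P z * ?S z) has_real_derivative
      - (\<Sum>b=1..k + 1. 1 / (r a - v b)\<^sup>2) * poly ?P (r a)) (at (r a))"
    using crit_sum_zero[OF assms] by simp
  have "open (- (v ` {1..k + 1}))" by (intro open_Compl finite_imp_closed) auto
  then have "((\<lambda>z. poly (pderiv ?P) z) has_real_derivative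
      - (\<Sum>b=1..k + 1. 1 / (r a - v b)\<^sup>2) * poly ?P (r a)) (at (r a))"
    using poly_pderiv_row_poly' notin
    by (intro has_field_derivative_transform_within_open[OF d1, of "- (v ` {1..k + 1})"]) auto
  then have "poly (pderiv (pderiv ?P)) (r a) = - (\<Sum>b=1..k + 1. 1 / (r a - v b)\<^sup>2) * poly ?P (r a)"
    using poly_DERIV DERIV_unique by blast
  moreover have "poly (pderiv (pderiv ?P)) (r a) = real (k + 1) * (\<Prod>c\<in>{1..k} - {a}. r a - r c)"
    using assms poly_pderiv_row_poly_root[of a k r] by (simp add: crit_def pderiv_smult)
  ultimately show ?thesis by (simp add: poly_row_poly algebra_simps)
qed

lemma crit_prod_roots:
  assumes "crit k r v" "b \<in> {1..k + 1}"
  shows "(\<Prod>c\<in>{1..k + 1} - {b}. v b - v c) = real (k + 1) * (\<Prod>a=1..k. v b - r a)"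
  using assms poly_pderiv_row_poly_root[of b "k + 1" v]
  by (simp add: crit_def poly_row_poly)

text \<open>The discriminant up to sign: each unordered pair occurs once from either end. The
  induction splits off the largest entry.\<close>

lemma prod_prod_diff_sq:
  assumes "strict_mono_on {1..n} v"
  shows "(\<Prod>b=1..n. \<bar>\<Prod>c\<in>{1..n} - {b}. v b - v c\<bar>) = (vdm n v)\<^sup>2"
  using assms
proof (induction n)
  case 0 then show ?case by (simp add: vdm_def)
next
  case (Suc n)
  have m: "strict_mono_on {1..n} v" using Suc.prems by (rule monotone_on_subset) auto
  have top: "\<bar>\<Prod>c\<in>{1..Suc n} - {Suc n}. v (Suc n) - v c\<bar> = (\<Prod>c=1..<Suc n. v (Suc n) - v c)"
  proof -
    have "{1..Suc n} - {Suc n} = {1..<Suc n}" by auto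
    moreover have "0 \<le> (\<Prod>c=1..<Suc n. v (Suc n) - v c)"
      using Suc.prems by (intro prod_nonneg) (auto dest!: strict_mono_onD[of _ v _ "Suc n"])
    ultimately show ?thesis by simp
  qed
  have "\<bar>\<Prod>c\<in>{1..Suc n} - {b}. v b - v c\<bar> = (v (Suc n) - v b) * \<bar>\<Prod>c\<in>{1..n} - {b}. v b - v c\<bar>"
    if "b \<in> {1..n}" for b
  proof -
    have "{1..Suc n} - {b} = insert (Suc n) ({1..n} - {b})" using that by auto
    moreover have "v b < v (Suc n)" using strict_mono_onD[OF Suc.prems, of b "Suc n"] that by auto
    ultimately show ?thesis by (simp add: abs_mult)
  qed
  then have "(\<Prod>b=1..n. \<bar>\<Prod>c\<in>{1..Suc n} - {b}. v b - v c\<bar>) =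
      (\<Prod>b=1..<Suc n. v (Suc n) - v b) * (vdm n v)\<^sup>2"
    using Suc.IH[OF m] by (simp add: prod.distrib atLeastLessThanSuc_atLeastAtMost)
  then show ?case
    using top by (simp add: vdm_def power2_eq_square algebra_simps)
qed

text \<open>The resultant of P and P' computed in two ways: multiplying |P'(v b)| over all b gives
  the discriminant, and factoring P' over its roots \<open>r a\<close> gives the left-hand
  side.\<close>

lemma crit_resultant:
  assumes "crit k r v"
  shows "real (k + 1) ^ (k + 1) * (\<Prod>a=1..k. \<Prod>b=1..k + 1. \<bar>r a - v b\<bar>) = (vdm (k + 1) v)\<^sup>2"
proof -
  have v: "strict_mono_on {1..k + 1} v"
    using assms strict_interlace_imp_strict_mono by (auto simp: crit_def)
  have "(vdm (k + 1) v)\<^sup>2 = (\<Prod>b=1..k + 1. real (k + 1) * (\<Prod>a=1..k. \<bar>r a - v b\<bar>))"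
    unfolding prod_prod_diff_sq[OF v, symmetric]
  proof (rule prod.cong)
    fix b assume "b \<in> {1..k + 1}"
    show "\<bar>\<Prod>c\<in>{1..k + 1} - {b}. v b - v c\<bar> = real (k + 1) * (\<Prod>a=1..k. \<bar>r a - v b\<bar>)"
      unfolding crit_prod_roots[OF assms \<open>b \<in> {1..k + 1}\<close>]
      by (simp add: abs_mult abs_prod abs_minus_commute)
  qed simp
  also have "\<dots> = real (k + 1) ^ (k + 1) * (\<Prod>b=1..k + 1. \<Prod>a=1..k. \<bar>r a - v b\<bar>)"
    by (simp add: prod.distrib)
  also have "(\<Prod>b=1..k + 1. \<Prod>a=1..k. \<bar>r a - v b\<bar>) = (\<Prod>a=1..k. \<Prod>b=1..k + 1. \<bar>r a - v b\<bar>)"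
    by (rule prod.swap)
  finally show ?thesis by simp
qed

text \<open>Multiply \<open>crit_sum_squares\<close> over all a: the resultant appears on the left
  and the discriminant of \<open>r\<close> on the right. The product of the sums of inverse squares
  is, up to powers of 2, the Hessian determinant of one row; as a ratio of Vandermonde squares it
  telescopes over the rows.\<close>

lemma crit_prod_sum_squares:
  assumes "crit k r v"
  shows "(\<Prod>a=1..k. \<Sum>b=1..k + 1. 1 / (r a - v b)\<^sup>2) * (vdm (k + 1) v)\<^sup>2 =
         real (k + 1) ^ (2 * k + 1) * (vdm k r)\<^sup>2"
proof -
  have r: "strict_mono_on {1..k} r"
    using assms strict_interlace_imp_strict_mono by (auto simp: crit_def)
  let ?S = "\<lambda>a. \<Sum>b=1..k + 1. 1 / (r a - v b)\<^sup>2"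
  have "(\<Prod>a=1..k. (\<Prod>b=1..k + 1. \<bar>r a - v b\<bar>) * ?S a) =
        (\<Prod>a=1..k. real (k + 1) * \<bar>\<Prod>c\<in>{1..k} - {a}. r a - r c\<bar>)"
  proof (rule prod.cong)
    fix a assume a: "a \<in> {1..k}"
    have "(\<Prod>b=1..k + 1. \<bar>r a - v b\<bar>) * ?S a = \<bar>(\<Prod>b=1..k + 1. r a - v b) * ?S a\<bar>"
      by (simp add: abs_mult abs_prod sum_nonneg del: sum.cl_ivl_Suc)
    also have "\<dots> = real (k + 1) * \<bar>\<Prod>c\<in>{1..k} - {a}. r a - r c\<bar>"
      unfolding crit_sum_squares[OF assms a] by (simp add: abs_mult)
    finally show "(\<Prod>b=1..k + 1. \<bar>r a - v b\<bar>) * ?S a = real (k + 1) * \<bar>\<Prod>c\<in>{1..k} - {a}. r a - r c\<bar>" .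
  qed simp
  then have "(\<Prod>a=1..k. \<Prod>b=1..k + 1. \<bar>r a - v b\<bar>) * (\<Prod>a=1..k. ?S a) = real (k + 1) ^ k * (vdm k r)\<^sup>2"
    using prod_prod_diff_sq[OF r] by (simp add: prod.distrib)
  then have "real (k + 1) ^ (k + 1) * ((\<Prod>a=1..k. \<Prod>b=1..k + 1. \<bar>r a - v b\<bar>) * (\<Prod>a=1..k. ?S a))
     = real (k + 1) ^ (k + 1) * (real (k + 1) ^ k * (vdm k r)\<^sup>2)" by simp
  moreover have "real (k + 1) ^ (2 * k + 1) = real (k + 1) ^ (k + 1) * real (k + 1) ^ k"
    by (simp only: power_add[symmetric]) (simp add: mult_2)
  ultimately show ?thesis
    unfolding crit_resultant[OF assms, symmetric] by (simp only: mult_ac)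
qed

section \<open>Residue sums and completing the square\<close>

lemma sum_lagrange_eq_0:
  fixes A :: "real poly"
  assumes "finite I" "degree A + 1 < card I"
  shows "(\<Sum>x\<in>I. poly A x / (\<Prod>z\<in>I - {x}. x - z)) = 0"
proof -
  let ?c = "\<lambda>x. poly A x / (\<Prod>z\<in>I - {x}. x - z)"
  let ?q = "\<lambda>x. \<Prod>z\<in>I - {x}. [:- z, 1:]"
  define B where "B = (\<Sum>x\<in>I. smult (?c x) (?q x))"
  have dq: "degree (?q x) = card I - 1" if "x \<in> I" for x
    using that by (simp add: degree_prod_sum_eq card_Diff_singleton)
  have cq: "coeff (?q x) (card I - 1) = 1" if "x \<in> I" for x
    using lead_coeff_prod[of "\<lambda>z. [:- z, 1:]" "I - {x}"] dq[OF that] by simp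
  have "degree B \<le> card I - 1"
    unfolding B_def using assms(1) dq
    by (intro degree_sum_le) (auto intro: order.trans[OF degree_smult_le])
  moreover have "poly B x = poly A x" if x: "x \<in> I" for x
  proof -
    have "(\<Sum>x'\<in>I - {x}. ?c x' * poly (?q x') x) = 0"
    proof (rule sum.neutral, rule ballI)
      fix x' assume "x' \<in> I - {x}"
      then have "poly (?q x') x = 0" using x assms(1) by (auto simp: poly_prod intro!: prod_zero)
      then show "?c x' * poly (?q x') x = 0" by simp
    qed
    moreover have "(\<Prod>z\<in>I - {x}. x - z) \<noteq> 0" using assms(1) by simp
    ultimately show ?thesis
      using x assms(1) unfolding B_def by (simp add: poly_sum sum.remove[of _ x] poly_prod)
  qed
  \<comment> \<open>\<open>B\<close> is the Lagrange interpolant of \<open>A\<close> at the points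
    of \<open>I\<close>. Its coefficient of degree \<open>card I - 1\<close> is the sum in question,
    and \<open>A\<close> has smaller degree.\<close>
  ultimately have "B = A" using assms by (intro poly_eqI_degree[where A=I]) auto
  moreover have "coeff A (card I - 1) = 0" using assms by (intro coeff_eq_0) auto
  moreover have "coeff B (card I - 1) = (\<Sum>x\<in>I. ?c x)"
    unfolding B_def coeff_sum coeff_smult by (intro sum.cong refl) (use cq in simp)
  ultimately show ?thesis by simp
qed


text \<open>With \<open>P\<close> the polynomial of row \<open>v\<close>, this says that the residues of
  \<open>P(z) / (P'(z) (z - v i)\<^sup>2 (z - v j)\<^sup>2)\<close> at the \<open>r a\<close>, at \<open>v i\<close> and at \<open>v j\<close> sum to zero.\<close>

lemma crit_weight_identity:
  assumes "crit k r v" "i \<in> {1..k + 1}" "j \<in> {1..k + 1}" "i \<noteq> j"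
  shows "(\<Sum>a=1..k. 1 / ((\<Sum>b=1..k + 1. 1 / (r a - v b)\<^sup>2) * (r a - v i)\<^sup>2 * (r a - v j)\<^sup>2)) =
         2 / (v i - v j)\<^sup>2"
proof -
  have il: "strict_interlace k r v" using assms by (simp add: crit_def)
  have iv: "inj_on v {1..k + 1}" and ir: "inj_on r {1..k}"
    using strict_interlace_imp_strict_mono[OF il] by (auto intro: strict_mono_on_imp_inj_on)
  have rv: "r a \<noteq> v b" if "a \<in> {1..k}" "b \<in> {1..k + 1}" for a b
    using strict_interlace_neq(1)[OF il that] .
  have vij: "v i \<noteq> v j" using iv assms by (auto dest: inj_onD)
  let ?S = "\<lambda>a. \<Sum>b=1..k + 1. 1 / (r a - v b)\<^sup>2"
  let ?K = "{1..k + 1} - {i, j}"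
  let ?R = "r ` {1..k}"
  \<comment> \<open>Since P = (z - v i) (z - v j) Q, the rational function reduces to Q(z) divided
    by k + 1 times the product of z - x over x in \<open>I\<close>. All poles are simple, and
    \<open>T x\<close> is k + 1 times the residue at x.\<close>
  define I where "I = insert (v i) (insert (v j) ?R)"
  define Q where "Q = (\<Prod>b\<in>?K. [:- v b, 1:])"
  define T where "T x = poly Q x / (\<Prod>z\<in>I - {x}. x - z)" for x
  have nR: "v i \<notin> ?R" "v j \<notin> ?R" using rv assms by force+
  have "card ?K = card {1..k + 1} - card {i, j}"
    using assms by (intro card_Diff_subset) auto
  also have "card {i, j} = 2" using assms(4) by simp
  finally have cK: "card ?K = k - 1" by simp
  have "k \<ge> 1" using assms by (cases k) auto
  have "card I = k + 2" unfolding I_def using nR vij ir by (simp add: card_image)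
  moreover have "degree Q = k - 1" unfolding Q_def using cK by (simp add: degree_prod_sum_eq)
  ultimately have "(\<Sum>x\<in>I. T x) = 0"
    unfolding T_def using \<open>k \<ge> 1\<close> by (intro sum_lagrange_eq_0) (auto simp: I_def)
  then have sum0: "T (v i) + T (v j) + (\<Sum>a=1..k. T (r a)) = 0"
    unfolding I_def using nR vij ir by (simp add: sum.reindex)
  have split: "(\<Prod>b=1..k + 1. f b) = f i * (f j * (\<Prod>b\<in>?K. f b))" for f :: "nat \<Rightarrow> real"
  proof -
    have "{1..k + 1} - {i} - {j} = ?K" by auto
    then show ?thesis
      using assms prod.remove[of "{1..k + 1}" i f] prod.remove[of "{1..k + 1} - {i}" j f] by simp
  qed
  \<comment> \<open>Stated for both orders of the pair, so that one computation serves both outer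
    residues. Evaluating P' at \<open>v i'\<close> in two ways makes \<open>poly Q (v i')\<close>
    cancel.\<close>
  have Tv: "T (v i') = real (k + 1) / (v i - v j)\<^sup>2"
    if ij: "(i' = i \<and> j' = j) \<or> (i' = j \<and> j' = i)" for i' j'
  proof -
    have "I = insert (v i') (insert (v j') ?R)" using ij unfolding I_def by auto
    moreover have "insert (v i') (insert (v j') ?R) - {v i'} = insert (v j') ?R"
      using ij nR vij by (intro Diff_insert_absorb) auto
    ultimately have "I - {v i'} = insert (v j') ?R" by simp
    then have den: "(\<Prod>z\<in>I - {v i'}. v i' - z) = (v i' - v j') * (\<Prod>a=1..k. v i' - r a)"
    proof -
      have "v j' \<notin> ?R" using ij nR by auto
      then show ?thesis using ir by (subst \<open>I - {v i'} = _\<close>) (simp add: prod.reindex)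
    qed
    have "(\<Prod>c\<in>{1..k + 1} - {i'}. v i' - v c) = (v i' - v j') * poly Q (v i')"
    proof -
      have "{1..k + 1} - {i'} = insert j' ?K" using ij assms by auto
      moreover have "j' \<notin> ?K" using ij by auto
      ultimately have "(\<Prod>c\<in>{1..k + 1} - {i'}. v i' - v c) = (v i' - v j') * (\<Prod>c\<in>?K. v i' - v c)"
        by (simp only: prod.insert finite_Diff finite_atLeastAtMost if_False not_False_eq_True)
      then show ?thesis by (simp only: Q_def poly_prod) simp
    qed
    then have "real (k + 1) * (\<Prod>a=1..k. v i' - r a) = (v i' - v j') * poly Q (v i')"
      using crit_prod_roots[OF assms(1), of i'] ij assms(2,3) by auto
    then have X: "(\<Prod>a=1..k. v i' - r a) = (v i' - v j') * poly Q (v i') / real (k + 1)"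
      by (simp add: field_simps del: of_nat_Suc)
    have Q0: "poly Q (v i') \<noteq> 0"
    proof -
      have "v i' - v b \<noteq> 0" if "b \<in> ?K" for b
        using ij that assms(2,3) inj_onD[OF iv, of i' b] by auto
      then show ?thesis unfolding Q_def poly_prod by simp
    qed
    have sq: "(v i' - v j')\<^sup>2 = (v i - v j)\<^sup>2" and ne: "v i' - v j' \<noteq> 0"
      using ij vij by (auto simp: power2_commute)
    have alg: "q / (x * (x * q / c)) = c / x\<^sup>2" if "x \<noteq> 0" "q \<noteq> 0" "c \<noteq> 0" for x q c :: real
      using that by (simp add: power2_eq_square)
    show ?thesis unfolding T_def den X sq[symmetric] using ne Q0 by (intro alg) auto
  qed
  have Tr: "T (r a) = - real (k + 1) * (1 / (?S a * (r a - v i)\<^sup>2 * (r a - v j)\<^sup>2))" if a: "a \<in> {1..k}" for a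
  proof -
    have "I - {r a} = insert (v i) (insert (v j) (r ` ({1..k} - {a})))"
    proof -
      have "r ` {1..k} - {r a} = r ` ({1..k} - {a})"
        using inj_on_image_set_diff[OF ir, of "{1..k}" "{a}"] a by simp
      moreover have "r a \<noteq> v i" "r a \<noteq> v j" using rv a assms by auto
      ultimately show ?thesis unfolding I_def by (simp add: insert_Diff_if)
    qed
    moreover have "inj_on r ({1..k} - {a})" using ir by (rule inj_on_subset) auto
    ultimately have den: "(\<Prod>z\<in>I - {r a}. r a - z) =
        (r a - v i) * (r a - v j) * (\<Prod>c\<in>{1..k} - {a}. r a - r c)"
    proof -
      have "v i \<notin> r ` ({1..k} - {a})" "v j \<notin> r ` ({1..k} - {a})" using nR by blast+
      then show ?thesis
        using vij \<open>inj_on r ({1..k} - {a})\<close>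
        by (subst \<open>I - {r a} = _\<close>) (simp add: prod.reindex)
    qed
    have P: "(\<Prod>b=1..k + 1. r a - v b) = (r a - v i) * ((r a - v j) * poly Q (r a))"
      unfolding split Q_def by (simp add: poly_prod)
    have ne: "r a - v i \<noteq> 0" "r a - v j \<noteq> 0" using rv a assms by auto
    have Q0: "poly Q (r a) \<noteq> 0" using rv a unfolding Q_def poly_prod by force
    have S0: "?S a \<noteq> 0"
    proof -
      have "0 < ?S a" using rv a by (intro sum_pos) auto
      then show ?thesis by simp
    qed
    \<comment> \<open>The second-derivative identity replaces the differences among the critical
      points by the sum of inverse squares, which is how that sum enters the residue.\<close>
    have X: "(\<Prod>c\<in>{1..k} - {a}. r a - r c) = - ((r a - v i) * ((r a - v j) * poly Q (r a)) * ?S a / real (k + 1))"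
      using crit_sum_squares[OF assms(1) a] unfolding P by (simp add: field_simps del: of_nat_Suc sum.cl_ivl_Suc)
    have alg: "q / (x * y * - (x * (y * q) * S / c)) = - c * (1 / (S * x\<^sup>2 * y\<^sup>2))"
      if "x \<noteq> 0" "y \<noteq> 0" "q \<noteq> 0" "S \<noteq> 0" "c \<noteq> 0" for x y q S c :: real
      using that by (simp add: power2_eq_square field_simps)
    show ?thesis
      unfolding T_def den X using ne Q0 S0 by (intro alg) auto
  qed
  have "real (k + 1) * (2 / (v i - v j)\<^sup>2) = 2 * (real (k + 1) / (v i - v j)\<^sup>2)" by simp
  also have "\<dots> = real (k + 1) * (\<Sum>a=1..k. 1 / (?S a * (r a - v i)\<^sup>2 * (r a - v j)\<^sup>2))"
    using sum0 Tv[of i j] Tv[of j i] unfolding sum_distrib_left by (simp add: Tr sum_negf del: of_nat_Suc sum.cl_ivl_Suc)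
  finally have eq: "real (k + 1) * (2 / (v i - v j)\<^sup>2) =
      real (k + 1) * (\<Sum>a=1..k. 1 / (?S a * (r a - v i)\<^sup>2 * (r a - v j)\<^sup>2))" .
  have cancel: "Y = X" if "c * X = c * Y" "c \<noteq> 0" for c X Y :: real using that by simp
  show ?thesis by (rule cancel[OF eq]) simp
qed

lemma sum_pairs_symmetric:
  fixes f :: "nat \<Rightarrow> nat \<Rightarrow> real"
  assumes "\<And>i j. f i j = f j i" "\<And>i. f i i = 0"
  shows "(\<Sum>i=1..n. \<Sum>j=1..n. f i j) = 2 * (\<Sum>j=1..n. \<Sum>i=1..<j. f i j)"
proof (induction n)
  case (Suc n)
  have "(\<Sum>j=1..n. f (Suc n) j) = (\<Sum>i=1..n. f i (Suc n))"
    by (intro sum.cong assms refl)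
  then show ?case using Suc
    by (simp add: sum.distrib assms(2) atLeastLessThanSuc_atLeastAtMost)
qed simp

text \<open>Completing the square in \<open>x\<close> leaves the weighted variance of \<eta>, which
  Lagrange's identity writes as a sum over pairs.\<close>

lemma weighted_square_sum:
  fixes w \<eta> :: "nat \<Rightarrow> real"
  assumes "(\<Sum>b=1..n. w b) \<noteq> 0"
  defines "S \<equiv> \<Sum>b=1..n. w b"
  shows "(\<Sum>b=1..n. w b * (x - \<eta> b)\<^sup>2) =
    S * (x - (\<Sum>b=1..n. w b * \<eta> b) / S)\<^sup>2 + (\<Sum>j=1..n. \<Sum>i=1..<j. w i * w j * (\<eta> i - \<eta> j)\<^sup>2) / S"
proof -
  define A where "A = (\<Sum>b=1..n. w b * \<eta> b)"
  define B where "B = (\<Sum>b=1..n. w b * (\<eta> b)\<^sup>2)"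
  have "2 * (\<Sum>j=1..n. \<Sum>i=1..<j. w i * w j * (\<eta> i - \<eta> j)\<^sup>2) =
      (\<Sum>i=1..n. \<Sum>j=1..n. w i * w j * (\<eta> i - \<eta> j)\<^sup>2)"
    by (rule sum_pairs_symmetric[symmetric]) (auto simp: power2_commute)
  also have "\<dots> = (\<Sum>i=1..n. \<Sum>j=1..n. (w i * (\<eta> i)\<^sup>2) * w j + w i * (w j * (\<eta> j)\<^sup>2) - 2 * ((w i * \<eta> i) * (w j * \<eta> j)))"
    by (intro sum.cong refl) (simp add: power2_eq_square algebra_simps)
  also have "\<dots> = B * S + S * B - 2 * (A * A)"
    unfolding A_def B_def S_def sum_product by (simp add: sum.distrib sum_subtractf sum_distrib_left)
  finally have pairs: "(\<Sum>j=1..n. \<Sum>i=1..<j. w i * w j * (\<eta> i - \<eta> j)\<^sup>2) = B * S - A * A" by simp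
  have total: "(\<Sum>b=1..n. w b * (x - \<eta> b)\<^sup>2) = S * x\<^sup>2 - 2 * x * A + B"
    unfolding A_def B_def S_def
    by (simp add: power2_eq_square algebra_simps sum.distrib sum_subtractf sum_distrib_left)
  have "S \<noteq> 0" using assms by simp
  then show ?thesis
    unfolding pairs total A_def[symmetric] by (simp add: power2_eq_square field_simps)
qed

text \<open>Complete the square in each \<xi> a separately. The remaining variances are sums over
  pairs (i, j); summing their coefficients over a gives 2 / (v i - v j)^2 by
  \<open>crit_weight_identity\<close>. The remainder is therefore a form in \<eta> of exactly the
  shape of the Vandermonde terms of row k + 1.\<close>

lemma crit_quadratic_identity:
  fixes \<xi> \<eta> :: "nat \<Rightarrow> real"
  assumes "crit k r v"
  defines "S \<equiv> \<lambda>a. \<Sum>b=1..k + 1. 1 / (r a - v b)\<^sup>2"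
  shows "(\<Sum>a=1..k. \<Sum>b=1..k + 1. (\<xi> a - \<eta> b)\<^sup>2 / (r a - v b)\<^sup>2) =
    (\<Sum>a=1..k. S a * (\<xi> a - (\<Sum>b=1..k + 1. \<eta> b / (r a - v b)\<^sup>2) / S a)\<^sup>2) +
    2 * (\<Sum>j=1..k + 1. \<Sum>i=1..<j. (\<eta> i - \<eta> j)\<^sup>2 / (v i - v j)\<^sup>2)"
proof -
  have il: "strict_interlace k r v" using assms by (simp add: crit_def)
  have rv: "r a \<noteq> v b" if "a \<in> {1..k}" "b \<in> {1..k + 1}" for a b
    using strict_interlace_neq(1)[OF il that] .
  have S0: "S a \<noteq> 0" if "a \<in> {1..k}" for a
  proof -
    have "0 < S a" unfolding S_def using rv that by (intro sum_pos) auto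
    then show ?thesis by simp
  qed
  let ?w = "\<lambda>a b. 1 / (r a - v b)\<^sup>2"
  have "(\<Sum>a=1..k. \<Sum>b=1..k + 1. (\<xi> a - \<eta> b)\<^sup>2 / (r a - v b)\<^sup>2) =
    (\<Sum>a=1..k. S a * (\<xi> a - (\<Sum>b=1..k + 1. \<eta> b / (r a - v b)\<^sup>2) / S a)\<^sup>2 +
      (\<Sum>j=1..k + 1. \<Sum>i=1..<j. ?w a i * ?w a j * (\<eta> i - \<eta> j)\<^sup>2) / S a)"
  proof (rule sum.cong[OF refl])
    fix a assume a: "a \<in> {1..k}"
    show "(\<Sum>b=1..k + 1. (\<xi> a - \<eta> b)\<^sup>2 / (r a - v b)\<^sup>2) =
      S a * (\<xi> a - (\<Sum>b=1..k + 1. \<eta> b / (r a - v b)\<^sup>2) / S a)\<^sup>2 +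
      (\<Sum>j=1..k + 1. \<Sum>i=1..<j. ?w a i * ?w a j * (\<eta> i - \<eta> j)\<^sup>2) / S a"
      using weighted_square_sum[of "\<lambda>b. ?w a b" "k + 1" "\<xi> a" \<eta>] S0[OF a] unfolding S_def
      by (simp del: sum.cl_ivl_Suc)
  qed
  also have "\<dots> = (\<Sum>a=1..k. S a * (\<xi> a - (\<Sum>b=1..k + 1. \<eta> b / (r a - v b)\<^sup>2) / S a)\<^sup>2) +
     (\<Sum>a=1..k. \<Sum>j=1..k + 1. \<Sum>i=1..<j. ?w a i * ?w a j * (\<eta> i - \<eta> j)\<^sup>2 / S a)"
    by (simp only: sum.distrib sum_divide_distrib)
  also have "(\<Sum>a=1..k. \<Sum>j=1..k + 1. \<Sum>i=1..<j. ?w a i * ?w a j * (\<eta> i - \<eta> j)\<^sup>2 / S a) =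
     (\<Sum>j=1..k + 1. \<Sum>i=1..<j. \<Sum>a=1..k. ?w a i * ?w a j * (\<eta> i - \<eta> j)\<^sup>2 / S a)"
    by (rule trans[OF sum.swap], rule sum.cong[OF refl], rule sum.swap)
  also have "\<dots> = (\<Sum>j=1..k + 1. \<Sum>i=1..<j. 2 * ((\<eta> i - \<eta> j)\<^sup>2 / (v i - v j)\<^sup>2))"
  proof (intro sum.cong refl)
    fix j i assume "j \<in> {1..k + 1}" "i \<in> {1..<j}"
    then have "(\<Sum>a=1..k. 1 / (S a * (r a - v i)\<^sup>2 * (r a - v j)\<^sup>2)) = 2 / (v i - v j)\<^sup>2"
      unfolding S_def by (intro crit_weight_identity assms) auto
    then have "(\<eta> i - \<eta> j)\<^sup>2 * (\<Sum>a=1..k. 1 / (S a * (r a - v i)\<^sup>2 * (r a - v j)\<^sup>2)) = (\<eta> i - \<eta> j)\<^sup>2 * (2 / (v i - v j)\<^sup>2)"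
      by simp
    then show "(\<Sum>a=1..k. ?w a i * ?w a j * (\<eta> i - \<eta> j)\<^sup>2 / S a) = 2 * ((\<eta> i - \<eta> j)\<^sup>2 / (v i - v j)\<^sup>2)"
      unfolding sum_distrib_left by (simp add: mult_ac)
  qed
  finally show ?thesis by (simp only: sum_distrib_left)
qed

section \<open>The energy of a pattern\<close>

text \<open>With s = sqrt u, ln u = 2 ln s <= 2 (s - 1) = (u - 1) - (s - 1)^2, and u - 1 = (s - 1)
  (s + 1) with s + 1 <= 2 max 1 u. The maximum keeps the bound valid for large u and later combines
  with a distance into a row width.\<close>

lemma ln_le_minus_quadratic:
  fixes u :: real
  assumes "0 < u"
  shows "ln u \<le> (u - 1) - (u - 1)\<^sup>2 / (4 * (max 1 u)\<^sup>2)"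
proof -
  define s where "s = sqrt u"
  have s: "0 < s" "u = s\<^sup>2" using assms by (auto simp: s_def)
  have "ln u = 2 * ln s" unfolding s(2) using s(1) by (simp add: ln_realpow)
  also have "\<dots> \<le> 2 * (s - 1)" using ln_le_minus_one[OF s(1)] by simp
  also have "\<dots> = (u - 1) - (s - 1)\<^sup>2" unfolding s(2) by (simp add: power2_eq_square algebra_simps)
  also have "(u - 1)\<^sup>2 / (4 * (max 1 u)\<^sup>2) \<le> (s - 1)\<^sup>2"
  proof -
    have "s \<le> max 1 u"
    proof (cases "s \<le> 1")
      case False
      then have "s * 1 \<le> s * s" by (intro mult_left_mono) auto
      then show ?thesis unfolding s(2) by (simp add: power2_eq_square)
    qed simp
    then have "(s + 1)\<^sup>2 \<le> (2 * max 1 u)\<^sup>2" using s(1) by (intro power_mono) auto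
    then have "(s - 1)\<^sup>2 * (s + 1)\<^sup>2 \<le> (s - 1)\<^sup>2 * (4 * (max 1 u)\<^sup>2)"
      by (intro mult_left_mono) (auto simp: power_mult_distrib)
    moreover have "(s - 1)\<^sup>2 * (s + 1)\<^sup>2 = (u - 1)\<^sup>2"
      unfolding s(2) by (simp add: power2_eq_square algebra_simps)
    moreover have "0 < 4 * (max 1 u)\<^sup>2" by (simp add: max_def)
    ultimately show ?thesis by (simp add: divide_le_eq)
  qed
  then have "(u - 1) - (s - 1)\<^sup>2 \<le> (u - 1) - (u - 1)\<^sup>2 / (4 * (max 1 u)\<^sup>2)" by simp
  finally show ?thesis .
qed

definition row_energy :: "nat \<Rightarrow> (nat \<Rightarrow> real) \<Rightarrow> (nat \<Rightarrow> real) \<Rightarrow> real" where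
  "row_energy k r v = (\<Sum>a=1..k. \<Sum>b=1..k + 1. ln \<bar>r a - v b\<bar>) -
     2 * (\<Sum>j=1..k + 1. \<Sum>i=1..<j. ln (v j - v i)) + real (k + 1) * ln (real (k + 1))"

lemma ln_vdm:
  assumes "strict_mono_on {1..n} v"
  shows "ln (vdm n v) = (\<Sum>j=1..n. \<Sum>i=1..<j. ln (v j - v i))"
proof -
  have lt: "v i < v j" if "j \<in> {1..n}" "i \<in> {1..<j}" for i j
    using strict_mono_onD[OF assms, of i j] that by auto
  then have pos: "0 < (\<Prod>i=1..<j. v j - v i)" if "j \<in> {1..n}" for j
    using that by (intro prod_pos) simp
  have "ln (vdm n v) = (\<Sum>j=1..n. ln (\<Prod>i=1..<j. v j - v i))"
    unfolding vdm_def by (rule ln_prod[OF finite_atLeastAtMost]) (rule pos[THEN less_imp_neq, symmetric])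
  also have "\<dots> = (\<Sum>j=1..n. \<Sum>i=1..<j. ln (v j - v i))"
  proof (intro sum.cong refl ln_prod[OF finite_atLeastLessThan])
    fix j i assume "j \<in> {1..n}" "i \<in> {1..<j}"
    then show "v j - v i \<noteq> 0" using lt[of j i] by simp
  qed
  finally show ?thesis .
qed

text \<open>The logarithm of \<open>crit_resultant\<close>; this fixes the additive constant in
  \<open>row_energy\<close>.\<close>

lemma row_energy_crit:
  assumes "crit k r v"
  shows "row_energy k r v = 0"
proof -
  have il: "strict_interlace k r v" using assms by (simp add: crit_def)
  have v: "strict_mono_on {1..k + 1} v" using strict_interlace_imp_strict_mono[OF il] by simp
  have pos: "0 < \<bar>r a - v b\<bar>" if "a \<in> {1..k}" "b \<in> {1..k + 1}" for a b
    using strict_interlace_neq(1)[OF il that] by simp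
  have pos': "0 < (\<Prod>b=1..k + 1. \<bar>r a - v b\<bar>)" if "a \<in> {1..k}" for a
    by (rule prod_pos) (rule pos[OF that])
  have "ln (\<Prod>a=1..k. \<Prod>b=1..k + 1. \<bar>r a - v b\<bar>) = (\<Sum>a=1..k. ln (\<Prod>b=1..k + 1. \<bar>r a - v b\<bar>))"
    by (rule ln_prod[OF finite_atLeastAtMost]) (rule pos'[THEN less_imp_neq, symmetric])
  also have "\<dots> = (\<Sum>a=1..k. \<Sum>b=1..k + 1. ln \<bar>r a - v b\<bar>)"
    by (intro sum.cong refl ln_prod[OF finite_atLeastAtMost] pos[THEN less_imp_neq, symmetric])
  finally have l1: "ln (\<Prod>a=1..k. \<Prod>b=1..k + 1. \<bar>r a - v b\<bar>) = (\<Sum>a=1..k. \<Sum>b=1..k + 1. ln \<bar>r a - v b\<bar>)" .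
  have "0 < (\<Prod>a=1..k. \<Prod>b=1..k + 1. \<bar>r a - v b\<bar>)" by (rule prod_pos) (rule pos')
  then have "real (k + 1) * ln (real (k + 1)) + ln (\<Prod>a=1..k. \<Prod>b=1..k + 1. \<bar>r a - v b\<bar>) =
      ln (real (k + 1) ^ (k + 1) * (\<Prod>a=1..k. \<Prod>b=1..k + 1. \<bar>r a - v b\<bar>))"
    by (subst ln_mult_pos) (simp_all add: ln_realpow del: prod.cl_ivl_Suc power_Suc of_nat_Suc)
  also have "\<dots> = 2 * ln (vdm (k + 1) v)"
    unfolding crit_resultant[OF assms] using vdm_pos[OF v] by (simp add: ln_realpow)
  finally show ?thesis unfolding row_energy_def l1[symmetric] ln_vdm[OF v, symmetric] by simp
qed

text \<open>Both \<open>s a\<close> and \<open>r a\<close> lie on the same side of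
  \<open>v b\<close>, so the quotient u of their distances to it is positive and the quadratic bound
  for ln applies. Summed over b, the linear terms vanish by \<open>crit_sum_zero\<close>. The
  Vandermonde terms depend on \<open>v\<close> alone and cancel against those of the critical
  row.\<close>

lemma row_energy_le:
  assumes crit: "crit k r v" and s: "strict_interlace k s v"
    and L: "0 < L" "v (k + 1) - v 1 \<le> L"
  shows "row_energy k s v \<le> - (\<Sum>a=1..k. (s a - r a)\<^sup>2) / (4 * L\<^sup>2)"
proof -
  have il: "strict_interlace k r v" using crit by (simp add: crit_def)
  have v: "strict_mono_on {1..k + 1} v" using strict_interlace_imp_strict_mono[OF il] by simp
  have vmono: "v i \<le> v j" if "i \<in> {1..k + 1}" "j \<in> {1..k + 1}" "i \<le> j" for i j
    using strict_mono_onD[OF v, of i j] that by (cases "i = j") auto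
  have width: "\<bar>t - v b\<bar> \<le> L" if "a \<in> {1..k}" "v a < t" "t < v (a + 1)" "b \<in> {1..k + 1}" for a t b
  proof -
    have "v 1 \<le> v a" "v (a + 1) \<le> v (k + 1)" "v 1 \<le> v b" "v b \<le> v (k + 1)"
      using that by (auto intro!: vmono)
    then show ?thesis using that L by linarith
  qed
  have pointwise: "ln \<bar>s a - v b\<bar> \<le> ln \<bar>r a - v b\<bar> + (s a - r a) * (1 / (r a - v b)) - (s a - r a)\<^sup>2 / (4 * L\<^sup>2)"
    if a: "a \<in> {1..k}" and b: "b \<in> {1..k + 1}" for a b
  proof -
    define u where "u = (s a - v b) / (r a - v b)"
    have ne: "r a - v b \<noteq> 0" using strict_interlace_neq(1)[OF il a b] by simp
    have u0: "0 < u"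
      unfolding u_def using strict_interlace_neq(2,3)[OF il a b] strict_interlace_neq(2,3)[OF s a b]
      by (cases "b \<le> a") (auto intro!: divide_pos_pos divide_neg_neg)
    have "\<bar>s a - v b\<bar> = u * \<bar>r a - v b\<bar>"
      using u0 unfolding u_def by (auto simp: abs_if field_simps zero_less_divide_iff)
    then have "ln \<bar>s a - v b\<bar> = ln u + ln \<bar>r a - v b\<bar>"
      using u0 ne by (simp add: ln_mult_pos)
    moreover have u1: "u - 1 = (s a - r a) / (r a - v b)"
      unfolding u_def using ne by (simp add: field_simps)
    moreover have "(s a - r a)\<^sup>2 / (4 * L\<^sup>2) \<le> (u - 1)\<^sup>2 / (4 * (max 1 u)\<^sup>2)"
    proof -
      have "max 1 u * \<bar>r a - v b\<bar> = max \<bar>r a - v b\<bar> \<bar>s a - v b\<bar>"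
        unfolding \<open>\<bar>s a - v b\<bar> = _\<close> by (simp add: max_mult_distrib_right)
      also have "\<dots> \<le> L"
        using width[OF a _ _ b] il s a unfolding strict_interlace_def by auto
      finally have "(max 1 u * \<bar>r a - v b\<bar>)\<^sup>2 \<le> L\<^sup>2" by (intro power_mono) auto
      then have le: "4 * ((max 1 u)\<^sup>2 * (r a - v b)\<^sup>2) \<le> 4 * L\<^sup>2" by (simp add: power_mult_distrib)
      have "0 < (max 1 u)\<^sup>2" by (simp add: max_def)
      then have "(s a - r a)\<^sup>2 / (4 * L\<^sup>2) \<le> (s a - r a)\<^sup>2 / (4 * ((max 1 u)\<^sup>2 * (r a - v b)\<^sup>2))"
        using ne L le by (intro divide_left_mono) auto
      also have "\<dots> = (u - 1)\<^sup>2 / (4 * (max 1 u)\<^sup>2)"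
        unfolding u1 by (simp add: power_divide)
      finally show ?thesis .
    qed
    ultimately show ?thesis using ln_le_minus_quadratic[OF u0] by simp
  qed
  have row: "(\<Sum>b=1..k + 1. ln \<bar>s a - v b\<bar>) \<le> (\<Sum>b=1..k + 1. ln \<bar>r a - v b\<bar>) - (s a - r a)\<^sup>2 / (4 * L\<^sup>2)"
    if a: "a \<in> {1..k}" for a
  proof -
    have "(\<Sum>b=1..k + 1. ln \<bar>s a - v b\<bar>) \<le>
      (\<Sum>b=1..k + 1. ln \<bar>r a - v b\<bar> + (s a - r a) * (1 / (r a - v b)) - (s a - r a)\<^sup>2 / (4 * L\<^sup>2))"
      using pointwise[OF a] by (rule sum_mono)
    also have "\<dots> = (\<Sum>b=1..k + 1. ln \<bar>r a - v b\<bar>) + (s a - r a) * (\<Sum>b=1..k + 1. 1 / (r a - v b))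
       - real (k + 1) * ((s a - r a)\<^sup>2 / (4 * L\<^sup>2))"
      unfolding sum_subtractf sum.distrib sum_distrib_left[symmetric] by simp
    also have "\<dots> = (\<Sum>b=1..k + 1. ln \<bar>r a - v b\<bar>) - real (k + 1) * ((s a - r a)\<^sup>2 / (4 * L\<^sup>2))"
      unfolding crit_sum_zero[OF crit a] by simp
    \<comment> \<open>Of the k + 1 equal quadratic losses a single one is kept.\<close>
    also have "\<dots> \<le> (\<Sum>b=1..k + 1. ln \<bar>r a - v b\<bar>) - 1 * ((s a - r a)\<^sup>2 / (4 * L\<^sup>2))"
      by (intro diff_left_mono mult_right_mono) auto
    finally show ?thesis by simp
  qed
  have "(\<Sum>a=1..k. \<Sum>b=1..k + 1. ln \<bar>s a - v b\<bar>) \<le>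
      (\<Sum>a=1..k. (\<Sum>b=1..k + 1. ln \<bar>r a - v b\<bar>) - (s a - r a)\<^sup>2 / (4 * L\<^sup>2))"
    using row by (rule sum_mono)
  then have "row_energy k s v \<le> row_energy k r v - (\<Sum>a=1..k. (s a - r a)\<^sup>2) / (4 * L\<^sup>2)"
    unfolding row_energy_def sum_subtractf sum_divide_distrib by linarith
  then show ?thesis using row_energy_crit[OF crit] by simp
qed

text \<open>If \<open>r a\<close> exceeded \<open>r' a + m\<close>, every \<open>r a - v b\<close>
  would exceed \<open>r' a - v' b\<close>, with equal signs by interlacing. All reciprocals would
  then be strictly smaller, although both sums of reciprocals are 0.\<close>

lemma crit_mono_shift:
  assumes r: "crit k r v" and r': "crit k r' v'"
    and le: "\<And>b. b \<in> {1..k + 1} \<Longrightarrow> v b \<le> v' b + m" and a: "a \<in> {1..k}"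
  shows "r a \<le> r' a + m"
proof (rule ccontr)
  assume "\<not> r a \<le> r' a + m"
  then have gt: "r' a + m < r a" by simp
  have il: "strict_interlace k r v" "strict_interlace k r' v'" using r r' by (auto simp: crit_def)
  have "(\<Sum>b=1..k + 1. 1 / (r a - v b)) < (\<Sum>b=1..k + 1. 1 / (r' a - v' b))"
  proof (rule sum_strict_mono)
    fix b assume b: "b \<in> {1..k + 1}"
    note I = strict_interlace_neq(2,3)[OF il(1) a b] strict_interlace_neq(2,3)[OF il(2) a b]
    have lt: "r' a - v' b < r a - v b" using gt le[OF b] by simp
    show "1 / (r a - v b) < 1 / (r' a - v' b)"
    proof (cases "b \<le> a")
      case True
      then have "0 < r' a - v' b" using I by auto
      then show ?thesis using lt by (intro divide_strict_left_mono) auto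
    next
      case False
      then have neg: "r a - v b < 0" using I by auto
      then have "0 < (r a - v b) * (r' a - v' b)" using lt by (intro mult_neg_neg) auto
      then show ?thesis using lt by (intro divide_strict_left_mono) auto
    qed
  qed auto
  then show False using crit_sum_zero[OF r a] crit_sum_zero[OF r' a] by simp
qed

lemma crit_lipschitz:
  assumes "crit k r v" "crit k r' v'"
    and "\<And>b. b \<in> {1..k + 1} \<Longrightarrow> \<bar>v b - v' b\<bar> \<le> m" and "a \<in> {1..k}"
  shows "\<bar>r a - r' a\<bar> \<le> m"
proof -
  have "r a \<le> r' a + m"
    using assms(3) by (intro crit_mono_shift[OF assms(1,2) _ assms(4)]) (force simp: abs_le_iff)
  moreover have "r' a \<le> r a + m"
    using assms(3) by (intro crit_mono_shift[OF assms(2,1) _ assms(4)]) (force simp: abs_le_iff)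
  ultimately show ?thesis by linarith
qed

section \<open>Energy of a whole pattern\<close>

abbreviation gt_row :: "(nat \<times> nat \<Rightarrow> real) \<Rightarrow> nat \<Rightarrow> nat \<Rightarrow> real" where
  "gt_row x k \<equiv> \<lambda>i. x (k, i)"

definition strict_gt :: "nat \<Rightarrow> (nat \<times> nat \<Rightarrow> real) \<Rightarrow> bool" where
  "strict_gt N x \<longleftrightarrow> (\<forall>k\<in>{1..<N}. strict_interlace k (gt_row x k) (gt_row x (k + 1)))"

definition gt_energy :: "nat \<Rightarrow> (nat \<times> nat \<Rightarrow> real) \<Rightarrow> real" where
  "gt_energy N x = (\<Sum>k=1..<N. row_energy k (gt_row x k) (gt_row x (k + 1)))"

lemma strict_gt_row_bounds:
  assumes "strict_gt N x" "1 \<le> k" "k \<le> N"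
  shows "x (N, 1) \<le> x (k, 1) \<and> x (k, k) \<le> x (N, N)"
  using assms(3,2)
proof (induction k rule: inc_induct)
  case (step k)
  have "strict_interlace k (gt_row x k) (gt_row x (k + 1))"
    using assms(1) step by (auto simp: strict_gt_def)
  then have "x (k + 1, 1) < x (k, 1)" "x (k, k) < x (k + 1, k + 1)"
    using step by (auto simp: strict_interlace_def)
  then show ?case using step by auto
qed simp

lemma finite_gt_index [simp]: "finite (gt_index N)"
  by (rule finite_subset[of _ "{..N} \<times> {..N}"]) (auto simp: gt_index_def)

lemma gt_index_eq_Sigma: "gt_index n = Sigma {1..n} (\<lambda>k. {1..k})"
  by (auto simp: gt_index_def)

lemma sum_gt_index: "(\<Sum>p\<in>gt_index n. f p) = (\<Sum>k=1..n. \<Sum>a=1..k. f (k, a))"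
  unfolding gt_index_eq_Sigma by (subst sum.Sigma) (auto simp: case_prod_unfold)

text \<open>The critical array is a global, quantitatively nondegenerate maximum of the energy: each row
  pair loses a multiple of the squared distance of row \<open>k\<close> to the critical points of row
  \<open>k + 1\<close>, and since those depend on row \<open>k + 1\<close> in a 1-Lipschitz way these distances control
  the distance to the critical array.\<close>

lemma gt_energy_le:
  assumes N: "1 \<le> N"
    and xt: "\<And>k. k \<in> {1..<N} \<Longrightarrow> crit k (gt_row xt k) (gt_row xt (k + 1))"
  obtains c where "0 < c"
    "\<And>x. strict_gt N x \<Longrightarrow> (\<And>i. i \<in> {1..N} \<Longrightarrow> x (N, i) = xt (N, i)) \<Longrightarrow>
       gt_energy N x \<le> - c * (\<Sum>p\<in>gt_index (N - 1). (x p - xt p)\<^sup>2)"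
proof -
  \<comment> \<open>All rows of a strict pattern lie between the extreme entries of the top row, so
    \<open>L\<close> bounds every row width. In \<open>d\<close>, one factor of the cardinality
    comes from Cauchy-Schwarz and one from summing over the entries. Adding 1 keeps both positive
    when N = 1.\<close>
  define L where "L = \<bar>xt (N, N) - xt (N, 1)\<bar> + 1"
  define d where "d = real (card (gt_index (N - 1))) ^ 2 + 1"
  have L: "0 < L" and d: "0 < d" by (auto simp: L_def d_def add_nonneg_pos)
  have "gt_energy N x \<le> - (1 / (4 * L\<^sup>2 * d)) * (\<Sum>p\<in>gt_index (N - 1). (x p - xt p)\<^sup>2)"
    if x: "strict_gt N x" and top: "\<And>i. i \<in> {1..N} \<Longrightarrow> x (N, i) = xt (N, i)" for x
  proof -
    have il: "strict_interlace k (gt_row x k) (gt_row x (k + 1))" if "k \<in> {1..<N}" for k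
      using x that by (auto simp: strict_gt_def)
    have "\<forall>k\<in>{1..<N}. \<exists>r. crit k r (gt_row x (k + 1))"
      using crit_exists strict_interlace_imp_strict_mono(1)[OF il] by blast
    then obtain r where r: "\<And>k. k \<in> {1..<N} \<Longrightarrow> crit k (r k) (gt_row x (k + 1))" by metis
    \<comment> \<open>Deviations are measured from the critical points of the row above in
      \<open>x\<close> itself, not from \<open>xt\<close>; these are what
      \<open>row_energy_le\<close> controls.\<close>
    define u where "u p = \<bar>x p - (case p of (k, a) \<Rightarrow> r k a)\<bar>" for p
    \<comment> \<open>Downward from the top row, where \<open>x\<close> and \<open>xt\<close> agree:
      the critical points of row k + 1 of \<open>x\<close> differ from row k of \<open>xt\<close> by
      at most the error accumulated above, to which row k adds its own deviation.\<close>
    have ind: "\<forall>a\<in>{1..k}. \<bar>x (k, a) - xt (k, a)\<bar> \<le> (\<Sum>l=k..<N. \<Sum>a=1..l. u (l, a))"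
      if "1 \<le> k" "k \<le> N" for k
      using that(2,1)
    proof (induction k rule: inc_induct)
      case base then show ?case using top by auto
    next
      case (step k)
      then have k: "k \<in> {1..<N}" by auto
      let ?m = "\<Sum>l=Suc k..<N. \<Sum>a=1..l. u (l, a)"
      show ?case
      proof
        fix a assume a: "a \<in> {1..k}"
        have "\<bar>r k a - xt (k, a)\<bar> \<le> ?m"
          using step by (intro crit_lipschitz[OF r[OF k] xt[OF k] _ a]) auto
        moreover have "u (k, a) \<le> (\<Sum>a=1..k. u (k, a))"
          using a by (intro member_le_sum) (auto simp: u_def)
        moreover have "\<bar>x (k, a) - xt (k, a)\<bar> \<le> u (k, a) + \<bar>r k a - xt (k, a)\<bar>"
          by (simp add: u_def)
        ultimately show "\<bar>x (k, a) - xt (k, a)\<bar> \<le> (\<Sum>l=k..<N. \<Sum>a=1..l. u (l, a))"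
          using k by (simp add: sum.atLeast_Suc_lessThan)
      qed
    qed
    let ?I = "gt_index (N - 1)"
    have dev: "(x p - xt p)\<^sup>2 \<le> (\<Sum>q\<in>?I. u q)\<^sup>2" if p: "p \<in> ?I" for p
    proof -
      obtain k a where ka: "p = (k, a)" "1 \<le> a" "a \<le> k" "k \<le> N - 1"
        using p by (auto simp: gt_index_def)
      have "\<bar>x p - xt p\<bar> \<le> (\<Sum>l=k..<N. \<Sum>a=1..l. u (l, a))" using ind[of k] ka N by auto
      also have "\<dots> \<le> (\<Sum>l=1..N - 1. \<Sum>a=1..l. u (l, a))"
        using ka by (intro sum_mono2) (auto intro!: sum_nonneg simp: u_def)
      also have "\<dots> = (\<Sum>q\<in>?I. u q)" by (simp add: sum_gt_index)
      finally have "\<bar>x p - xt p\<bar>\<^sup>2 \<le> (\<Sum>q\<in>?I. u q)\<^sup>2" by (rule power_mono) simp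
      then show ?thesis by simp
    qed
    have "(\<Sum>q\<in>?I. u q)\<^sup>2 \<le> real (card ?I) * (\<Sum>q\<in>?I. (u q)\<^sup>2)"
      using Cauchy_Schwarz_ineq_sum[of "\<lambda>_. 1" u ?I] by simp
    then have "(\<Sum>p\<in>?I. (x p - xt p)\<^sup>2) \<le> (\<Sum>p\<in>?I. real (card ?I) * (\<Sum>q\<in>?I. (u q)\<^sup>2))"
      using dev by (intro sum_mono) fastforce
    also have "\<dots> = real (card ?I) ^ 2 * (\<Sum>q\<in>?I. (u q)\<^sup>2)" by (simp add: power2_eq_square)
    also have "\<dots> \<le> d * (\<Sum>q\<in>?I. (u q)\<^sup>2)"
      unfolding d_def by (intro mult_right_mono sum_nonneg) auto
    finally have le: "(\<Sum>p\<in>?I. (x p - xt p)\<^sup>2) \<le> d * (\<Sum>q\<in>?I. (u q)\<^sup>2)" .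
    have "gt_energy N x \<le> (\<Sum>k=1..<N. - (\<Sum>a=1..k. (u (k, a))\<^sup>2) / (4 * L\<^sup>2))"
      unfolding gt_energy_def
    proof (rule sum_mono)
      fix k assume k: "k \<in> {1..<N}"
      have "x (k + 1, k + 1) - x (k + 1, 1) \<le> L"
        using strict_gt_row_bounds[OF x, of "k + 1"] top[of 1] top[of N] N k by (auto simp: L_def)
      then have "row_energy k (gt_row x k) (gt_row x (k + 1)) \<le> - (\<Sum>a=1..k. (x (k, a) - r k a)\<^sup>2) / (4 * L\<^sup>2)"
        by (intro row_energy_le[OF r[OF k] il[OF k] L])
      then show "row_energy k (gt_row x k) (gt_row x (k + 1)) \<le> - (\<Sum>a=1..k. (u (k, a))\<^sup>2) / (4 * L\<^sup>2)"
        by (simp add: u_def)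
    qed
    also have "\<dots> = - (\<Sum>q\<in>?I. (u q)\<^sup>2) / (4 * L\<^sup>2)"
    proof -
      have "{1..<N} = {1..N - 1}" using N by auto
      then show ?thesis unfolding sum_gt_index by (simp add: sum_negf sum_divide_distrib)
    qed
    also have "\<dots> \<le> - (1 / (4 * L\<^sup>2 * d)) * (\<Sum>p\<in>?I. (x p - xt p)\<^sup>2)"
    proof -
      have "(1 / (4 * L\<^sup>2 * d)) * (\<Sum>p\<in>?I. (x p - xt p)\<^sup>2) \<le> (1 / (4 * L\<^sup>2 * d)) * (d * (\<Sum>q\<in>?I. (u q)\<^sup>2))"
        using L d le by (intro mult_left_mono) auto
      also have "\<dots> = (\<Sum>q\<in>?I. (u q)\<^sup>2) / (4 * L\<^sup>2)" using d by simp
      finally show ?thesis by simp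
    qed
    finally show ?thesis .
  qed
  moreover have "0 < 1 / (4 * L\<^sup>2 * d)" using L d by simp
  ultimately show ?thesis using that by blast
qed

section \<open>Second-order expansion of the energy\<close>

lemma strict_mono_on_image_unique:
  fixes f g :: "nat \<Rightarrow> real"
  assumes f: "strict_mono_on {1..n} f" and g: "strict_mono_on {1..n} g"
    and "f ` {1..n} = g ` {1..n}" "i \<in> {1..n}"
  shows "f i = g i"
proof -
  have *: "sorted_wrt (<) (map h [1..<Suc n])" if "strict_mono_on {1..n} h" for h :: "nat \<Rightarrow> real"
    unfolding sorted_wrt_iff_nth_less
  proof (intro allI impI)
    fix a b assume ab: "a < b" "b < length (map h [1..<Suc n])"
    then show "map h [1..<Suc n] ! a < map h [1..<Suc n] ! b"
      using strict_mono_onD[OF that, of "a + 1" "b + 1"] by (simp del: upt_Suc)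
  qed
  have "map f [1..<Suc n] = map g [1..<Suc n]"
    using *[OF f] *[OF g] assms(3)
    by (intro sorted_distinct_set_unique)
      (auto simp: strict_sorted_iff atLeastLessThanSuc_atLeastAtMost simp del: upt_Suc)
  then show ?thesis using assms(4) by (simp del: upt_Suc)
qed

lemma row_poly_inject:
  assumes "strict_mono_on {1..n} f" "strict_mono_on {1..n} g" "row_poly n f = row_poly n g" "i \<in> {1..n}"
  shows "f i = g i"
proof -
  have "f ` {1..n} = g ` {1..n}"
    using assms(3) poly_row_poly_eq_0_iff[of n f] poly_row_poly_eq_0_iff[of n g] by auto
  then show ?thesis using strict_mono_on_image_unique assms by blast
qed

lemma infty_corners_array_top:
  assumes "1 \<le> N" "strict_mono_on {1..N} y" "infty_corners_array N y xt" "i \<in> {1..N}"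
  shows "xt (N, i) = y i"
proof -
  have "row_poly N (gt_row xt N) = row_poly N y" "strict_mono_on {1..N} (gt_row xt N)"
    using assms unfolding infty_corners_array_def row_poly_def by auto
  then show ?thesis using row_poly_inject[of N "gt_row xt N" y i] assms by auto
qed

text \<open>The normalized derivatives for k + 1 and k differ by one differentiation and the factor
  k + 1. Strict interlacing comes from \<open>crit_exists\<close>: row k and the Rolle points of row
  k + 1 are increasing lists of the roots of the same polynomial, hence equal.\<close>

lemma infty_corners_array_crit:
  assumes "infty_corners_array N y xt" "k \<in> {1..<N}"
  shows "crit k (gt_row xt k) (gt_row xt (k + 1))"
proof -
  let ?P = "\<Prod>i=1..N. [:- y i, 1:]"
  have row: "row_poly l (gt_row xt l) = smult (1 / (\<Prod>j=l+1..N. real j)) ((pderiv ^^ (N - l)) ?P)"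
    and mono: "strict_mono_on {1..l} (gt_row xt l)" if "l \<in> {1..N}" for l
    using assms(1) that unfolding infty_corners_array_def row_poly_def by auto
  have "N - k = Suc (N - (k + 1))" using assms(2) by auto
  then have "(pderiv ^^ (N - k)) ?P = pderiv ((pderiv ^^ (N - (k + 1))) ?P)" by simp
  moreover have "(\<Prod>j=k+1..N. real j) = real (k + 1) * (\<Prod>j=k+1+1..N. real j)"
    using assms(2) by (simp add: prod.atLeast_Suc_atMost)
  moreover have "(\<Prod>j=k+1+1..N. real j) \<noteq> 0" by auto
  ultimately have eq: "pderiv (row_poly (k + 1) (gt_row xt (k + 1))) = smult (real (k + 1)) (row_poly k (gt_row xt k))"
    using row[of k] row[of "k + 1"] assms(2) by (simp add: pderiv_smult del: of_nat_Suc)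
  obtain r where r: "crit k r (gt_row xt (k + 1))"
    using crit_exists mono[of "k + 1"] assms(2) by auto
  then have r_mono: "strict_mono_on {1..k} r"
    and "smult (real (k + 1)) (row_poly k r) = smult (real (k + 1)) (row_poly k (gt_row xt k))"
    using strict_interlace_imp_strict_mono(2) eq unfolding crit_def by auto
  then have "smult (1 / real (k + 1)) (smult (real (k + 1)) (row_poly k r)) =
      smult (1 / real (k + 1)) (smult (real (k + 1)) (row_poly k (gt_row xt k)))" by (simp only:)
  then have "row_poly k r = row_poly k (gt_row xt k)" by (simp del: of_nat_Suc)
  then have "gt_row xt k i = r i" if "i \<in> {1..k}" for i
    using row_poly_inject[of k "gt_row xt k" r i] mono[of k] r_mono that assms(2) by auto
  then have "strict_interlace k (gt_row xt k) (gt_row xt (k + 1))"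
    using r by (auto simp: crit_def strict_interlace_def)
  with eq show ?thesis by (simp add: crit_def)
qed

text \<open>Peano form of a second-order expansion at 0, f t = c0 + c1 t + c2 t^2 + o(t^2). Stated
  as a limit, it adds up termwise and is insensitive to changes of f away from 0.\<close>

definition has_quad_exp :: "(real \<Rightarrow> real) \<Rightarrow> real \<Rightarrow> real \<Rightarrow> real \<Rightarrow> bool" where
  "has_quad_exp f c0 c1 c2 \<longleftrightarrow> ((\<lambda>t. (f t - c0 - c1 * t) / t\<^sup>2) \<longlongrightarrow> c2) (at 0)"

lemma has_quad_exp_const: "has_quad_exp (\<lambda>_. c) c 0 0"
  by (simp add: has_quad_exp_def)

lemma has_quad_exp_add:
  assumes "has_quad_exp f c0 c1 c2" "has_quad_exp g d0 d1 d2"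
  shows "has_quad_exp (\<lambda>t. f t + g t) (c0 + d0) (c1 + d1) (c2 + d2)"
  using tendsto_add[OF assms[unfolded has_quad_exp_def]] unfolding has_quad_exp_def
  by (simp add: algebra_simps flip: add_divide_distrib)

lemma has_quad_exp_cmult:
  assumes "has_quad_exp f c0 c1 c2"
  shows "has_quad_exp (\<lambda>t. c * f t) (c * c0) (c * c1) (c * c2)"
  using tendsto_mult_left[OF assms[unfolded has_quad_exp_def], of c] unfolding has_quad_exp_def
  by (simp add: algebra_simps)

lemma has_quad_exp_diff:
  assumes "has_quad_exp f c0 c1 c2" "has_quad_exp g d0 d1 d2"
  shows "has_quad_exp (\<lambda>t. f t - g t) (c0 - d0) (c1 - d1) (c2 - d2)"
  using has_quad_exp_add[OF assms(1) has_quad_exp_cmult[OF assms(2), of "- 1"]] by simp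

lemma has_quad_exp_sum:
  assumes "\<And>i. i \<in> I \<Longrightarrow> has_quad_exp (f i) (c0 i) (c1 i) (c2 i)"
  shows "has_quad_exp (\<lambda>t. \<Sum>i\<in>I. f i t) (\<Sum>i\<in>I. c0 i) (\<Sum>i\<in>I. c1 i) (\<Sum>i\<in>I. c2 i)"
  using assms
proof (induction I rule: infinite_finite_induct)
  case (insert i I)
  then show ?case using has_quad_exp_add[of "f i" "c0 i" "c1 i" "c2 i"] by auto
qed (auto simp: has_quad_exp_const)

lemma has_quad_exp_cong:
  assumes "has_quad_exp f c0 c1 c2" "\<forall>\<^sub>F t in at 0. f t = g t"
  shows "has_quad_exp g c0 c1 c2"
  unfolding has_quad_exp_def
  by (rule Lim_transform_eventually[OF assms(1)[unfolded has_quad_exp_def]])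
    (use assms(2) in \<open>auto elim: eventually_mono\<close>)

lemma has_quad_exp_ln_1_plus: "has_quad_exp (\<lambda>t. ln (1 + t * s)) 0 s (- s\<^sup>2 / 2)"
proof (cases "s = 0")
  case True
  then show ?thesis using has_quad_exp_const[of 0] by simp
next
  case False
  have "((\<lambda>u::real. (ln (1 + u) - u) / u\<^sup>2) \<longlongrightarrow> - 1 / 2) (at 0)" by real_asymp
  moreover have "filterlim (\<lambda>t. t * s) (at 0) (at 0)"
    using False by (auto intro!: filterlim_atI tendsto_eq_intros simp: eventually_at_filter)
  ultimately have "((\<lambda>t. s\<^sup>2 * ((ln (1 + t * s) - t * s) / (t * s)\<^sup>2)) \<longlongrightarrow> s\<^sup>2 * (- 1 / 2)) (at 0)"
    by (intro tendsto_mult_left) (rule filterlim_compose)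
  moreover have "s\<^sup>2 * ((ln (1 + t * s) - t * s) / (t * s)\<^sup>2) = (ln (1 + t * s) - 0 - s * t) / t\<^sup>2" for t
    using False by (cases "t = 0") (auto simp: power_mult_distrib mult.commute)
  ultimately show ?thesis unfolding has_quad_exp_def by simp
qed

lemma has_quad_exp_ln_abs:
  assumes "D \<noteq> 0"
  shows "has_quad_exp (\<lambda>t. ln \<bar>D + t * e\<bar>) (ln \<bar>D\<bar>) (e / D) (- (e / D)\<^sup>2 / 2)"
proof -
  have "has_quad_exp (\<lambda>t. ln \<bar>D\<bar> + ln (1 + t * (e / D))) (ln \<bar>D\<bar> + 0) (0 + e / D) (0 + - (e / D)\<^sup>2 / 2)"
    by (intro has_quad_exp_add has_quad_exp_const has_quad_exp_ln_1_plus)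
  moreover have "\<forall>\<^sub>F t in at 0. ln \<bar>D\<bar> + ln (1 + t * (e / D)) = ln \<bar>D + t * e\<bar>"
  proof -
    have "((\<lambda>t. 1 + t * (e / D)) \<longlongrightarrow> 1) (at 0)"
      using assms by (auto intro!: tendsto_eq_intros)
    then have "\<forall>\<^sub>F t in at 0. 0 < 1 + t * (e / D)" by (rule order_tendstoD) simp
    then show ?thesis
    proof eventually_elim
      case (elim t)
      have "D + t * e = D * (1 + t * (e / D))" using assms by (simp add: field_simps)
      then have "\<bar>D + t * e\<bar> = \<bar>D\<bar> * (1 + t * (e / D))" using elim by (simp add: abs_mult)
      then show ?case using assms elim by (simp add: ln_mult_pos)
    qed
  qed
  ultimately show ?thesis using has_quad_exp_cong by fastforce
qed

lemma has_quad_exp_ln: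
  assumes "0 < D"
  shows "has_quad_exp (\<lambda>t. ln (D + t * e)) (ln D) (e / D) (- (e / D)\<^sup>2 / 2)"
proof -
  have "((\<lambda>t. D + t * e) \<longlongrightarrow> D) (at 0)" by (auto intro!: tendsto_eq_intros)
  then have "\<forall>\<^sub>F t in at 0. 0 < D + t * e" using assms by (rule order_tendstoD)
  then have "\<forall>\<^sub>F t in at 0. ln \<bar>D + t * e\<bar> = ln (D + t * e)" by eventually_elim simp
  then show ?thesis using has_quad_exp_cong[OF has_quad_exp_ln_abs[of D e]] assms by auto
qed

text \<open>The quotient (f t - c0) / t tends to c1 from both sides and has opposite signs on the
  two sides.\<close>

lemma has_quad_exp_maximum:
  assumes f: "has_quad_exp f c0 c1 c2" and max: "\<forall>\<^sub>F t in at 0. f t \<le> c0"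
  shows "c1 = 0"
proof -
  have "((\<lambda>t. t * ((f t - c0 - c1 * t) / t\<^sup>2) + c1) \<longlongrightarrow> 0 * c2 + c1) (at 0)"
    using f unfolding has_quad_exp_def by (intro tendsto_intros)
  moreover have "\<forall>\<^sub>F t in at 0. t * ((f t - c0 - c1 * t) / t\<^sup>2) + c1 = (f t - c0) / t"
    by (auto simp: eventually_at_filter field_simps power2_eq_square)
  ultimately have lim: "((\<lambda>t. (f t - c0) / t) \<longlongrightarrow> c1) (at 0)"
    using Lim_transform_eventually by fastforce
  have "c1 \<le> 0"
  proof (rule tendsto_upperbound)
    show "((\<lambda>t. (f t - c0) / t) \<longlongrightarrow> c1) (at_right 0)" using lim by (simp add: filterlim_at_split)
    have "\<forall>\<^sub>F t in at_right 0. f t \<le> c0" using max by (simp add: eventually_at_split)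
    moreover have "\<forall>\<^sub>F t::real in at_right 0. 0 < t" by (simp add: eventually_at_right_less)
    ultimately show "\<forall>\<^sub>F t in at_right 0. (f t - c0) / t \<le> 0"
      by eventually_elim (auto simp: divide_le_0_iff)
  qed simp
  moreover have "0 \<le> c1"
  proof (rule tendsto_lowerbound)
    show "((\<lambda>t. (f t - c0) / t) \<longlongrightarrow> c1) (at_left 0)" using lim by (simp add: filterlim_at_split)
    have "\<forall>\<^sub>F t in at_left 0. f t \<le> c0" using max by (simp add: eventually_at_split)
    moreover have "\<forall>\<^sub>F t::real in at_left 0. t < 0" by (simp add: eventually_at_filter)
    ultimately show "\<forall>\<^sub>F t in at_left 0. 0 \<le> (f t - c0) / t"
      by eventually_elim (auto simp: zero_le_divide_iff)
  qed simp
  ultimately show ?thesis by simp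
qed

text \<open>Every logarithm of D + t e contributes -(e / D)^2 / 2; the factor -2 of the Vandermonde
  part turns its share into a plus sign. The linear coefficient stays existential because only the
  sum over all rows is known to have none.\<close>

lemma row_energy_quad_exp:
  assumes "strict_interlace k r v"
  shows "\<exists>c1. has_quad_exp (\<lambda>t. row_energy k (\<lambda>a. r a + t * \<xi> a) (\<lambda>b. v b + t * \<eta> b))
     (row_energy k r v) c1
     (- (\<Sum>a=1..k. \<Sum>b=1..k + 1. (\<xi> a - \<eta> b)\<^sup>2 / (r a - v b)\<^sup>2) / 2 +
       (\<Sum>j=1..k + 1. \<Sum>i=1..<j. (\<eta> i - \<eta> j)\<^sup>2 / (v i - v j)\<^sup>2))"
proof -
  have v: "strict_mono_on {1..k + 1} v" using strict_interlace_imp_strict_mono[OF assms] by simp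
  have 1: "has_quad_exp (\<lambda>t. \<Sum>a=1..k. \<Sum>b=1..k + 1. ln \<bar>(r a - v b) + t * (\<xi> a - \<eta> b)\<bar>)
      (\<Sum>a=1..k. \<Sum>b=1..k + 1. ln \<bar>r a - v b\<bar>)
      (\<Sum>a=1..k. \<Sum>b=1..k + 1. (\<xi> a - \<eta> b) / (r a - v b))
      (\<Sum>a=1..k. \<Sum>b=1..k + 1. - ((\<xi> a - \<eta> b) / (r a - v b))\<^sup>2 / 2)"
    using strict_interlace_neq(1)[OF assms]
    by (intro has_quad_exp_sum has_quad_exp_ln_abs) auto
  have 2: "has_quad_exp (\<lambda>t. \<Sum>j=1..k + 1. \<Sum>i=1..<j. ln ((v j - v i) + t * (\<eta> j - \<eta> i)))
      (\<Sum>j=1..k + 1. \<Sum>i=1..<j. ln (v j - v i))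
      (\<Sum>j=1..k + 1. \<Sum>i=1..<j. (\<eta> j - \<eta> i) / (v j - v i))
      (\<Sum>j=1..k + 1. \<Sum>i=1..<j. - ((\<eta> j - \<eta> i) / (v j - v i))\<^sup>2 / 2)"
  proof (intro has_quad_exp_sum has_quad_exp_ln)
    fix j i assume "j \<in> {1..k + 1}" "i \<in> {1..<j}"
    then show "0 < v j - v i" using strict_mono_onD[OF v, of i j] by simp
  qed
  note 3 = has_quad_exp_add[OF has_quad_exp_diff[OF 1 has_quad_exp_cmult[OF 2, of 2]]
      has_quad_exp_const[of "real (k + 1) * ln (real (k + 1))"]]
  have eq: "(\<lambda>t. (\<Sum>a=1..k. \<Sum>b=1..k + 1. ln \<bar>(r a - v b) + t * (\<xi> a - \<eta> b)\<bar>) -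
       2 * (\<Sum>j=1..k + 1. \<Sum>i=1..<j. ln ((v j - v i) + t * (\<eta> j - \<eta> i))) + real (k + 1) * ln (real (k + 1)))
     = (\<lambda>t. row_energy k (\<lambda>a. r a + t * \<xi> a) (\<lambda>b. v b + t * \<eta> b))"
  proof -
    have "(r a - v b) + t * (\<xi> a - \<eta> b) = (r a + t * \<xi> a) - (v b + t * \<eta> b)"
      "(v j - v i) + t * (\<eta> j - \<eta> i) = (v j + t * \<eta> j) - (v i + t * \<eta> i)" for a b i j t
      by (simp_all add: algebra_simps)
    then show ?thesis unfolding row_energy_def by (simp only:)
  qed
  have c2: "(\<Sum>a=1..k. \<Sum>b=1..k + 1. - ((\<xi> a - \<eta> b) / (r a - v b))\<^sup>2 / 2) -
      2 * (\<Sum>j=1..k + 1. \<Sum>i=1..<j. - ((\<eta> j - \<eta> i) / (v j - v i))\<^sup>2 / 2) + 0 =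
      - (\<Sum>a=1..k. \<Sum>b=1..k + 1. (\<xi> a - \<eta> b)\<^sup>2 / (r a - v b)\<^sup>2) / 2 +
       (\<Sum>j=1..k + 1. \<Sum>i=1..<j. (\<eta> i - \<eta> j)\<^sup>2 / (v i - v j)\<^sup>2)"
  proof -
    have "- ((\<xi> a - \<eta> b) / (r a - v b))\<^sup>2 / 2 = (- 1 / 2) * ((\<xi> a - \<eta> b)\<^sup>2 / (r a - v b)\<^sup>2)"
      "- ((\<eta> j - \<eta> i) / (v j - v i))\<^sup>2 / 2 = (- 1 / 2) * ((\<eta> i - \<eta> j)\<^sup>2 / (v i - v j)\<^sup>2)" for a b i j
      by (simp_all add: power_divide power2_commute)
    then show ?thesis by (simp only: sum_distrib_left[symmetric])
  qed
  show ?thesis using 3 unfolding eq c2 row_energy_def[of k r v, symmetric] by blast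
qed

text \<open>The bookkeeping of the shift by one row. In its uses P 1 is 0 because row 1 contains no
  pairs, and P N is determined by the top row.\<close>

lemma sum_shift_telescope:
  fixes P :: "nat \<Rightarrow> real"
  assumes "1 \<le> N"
  shows "(\<Sum>k=1..<N. P (k + 1)) = (\<Sum>k=1..<N. P k) + P N - P 1"
  using assms by (induction N rule: dec_induct) auto

text \<open>With t = 1 / sqrt \<beta> this inverts the rescaling about \<open>xt\<close> for
  positive \<beta>; the top row stays fixed when \<eta> vanishes there.\<close>

definition scaled_array :: "nat \<Rightarrow> (nat \<times> nat \<Rightarrow> real) \<Rightarrow> real \<Rightarrow> (nat \<times> nat \<Rightarrow> real) \<Rightarrow> nat \<times> nat \<Rightarrow> real" where
  "scaled_array N xt t \<eta> = (\<lambda>p\<in>gt_index N. xt p + t * \<eta> p)"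

lemma row_energy_cong:
  assumes "\<And>a. a \<in> {1..k} \<Longrightarrow> r a = r' a" "\<And>b. b \<in> {1..k + 1} \<Longrightarrow> v b = v' b"
  shows "row_energy k r v = row_energy k r' v'"
proof -
  have "(\<Sum>a=1..k. \<Sum>b=1..k + 1. ln \<bar>r a - v b\<bar>) = (\<Sum>a=1..k. \<Sum>b=1..k + 1. ln \<bar>r' a - v' b\<bar>)"
    by (intro sum.cong refl) (simp add: assms)
  moreover have "(\<Sum>j=1..k + 1. \<Sum>i=1..<j. ln (v j - v i)) = (\<Sum>j=1..k + 1. \<Sum>i=1..<j. ln (v' j - v' i))"
    by (intro sum.cong refl) (simp add: assms)
  ultimately show ?thesis unfolding row_energy_def by simp
qed

lemma scaled_array_nth:
  "1 \<le> i \<Longrightarrow> i \<le> k \<Longrightarrow> k \<le> N \<Longrightarrow> scaled_array N xt t \<eta> (k, i) = xt (k, i) + t * \<eta> (k, i)"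
  by (simp add: scaled_array_def gt_index_def)

lemma eventually_strict_gt:
  assumes xt: "strict_gt N xt"
  shows "\<forall>\<^sub>F t in at 0. strict_gt N (scaled_array N xt t \<eta>)"
proof -
  have *: "\<forall>\<^sub>F t in at 0. xt p + t * \<eta> p < xt q + t * \<eta> q" if "xt p < xt q" for p q
  proof -
    have "((\<lambda>t. (xt q + t * \<eta> q) - (xt p + t * \<eta> p)) \<longlongrightarrow> xt q - xt p) (at 0)"
      by (auto intro!: tendsto_eq_intros)
    then have "\<forall>\<^sub>F t in at 0. 0 < (xt q + t * \<eta> q) - (xt p + t * \<eta> p)"
      by (rule order_tendstoD) (use that in simp)
    then show ?thesis by eventually_elim simp
  qed
  have "\<forall>\<^sub>F t in at 0. \<forall>k\<in>{1..<N}. \<forall>a\<in>{1..k}.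
      xt (k + 1, a) + t * \<eta> (k + 1, a) < xt (k, a) + t * \<eta> (k, a) \<and>
      xt (k, a) + t * \<eta> (k, a) < xt (k + 1, a + 1) + t * \<eta> (k + 1, a + 1)"
    using xt unfolding strict_gt_def strict_interlace_def
    by (intro eventually_ball_finite ballI eventually_conj * finite_atLeastAtMost finite_atLeastLessThan) auto
  then show ?thesis
    by eventually_elim (auto simp: strict_gt_def strict_interlace_def scaled_array_nth)
qed

lemma filterlim_inverse_sqrt_at_0: "filterlim (\<lambda>\<beta>. 1 / sqrt \<beta>) (at 0) at_top"
proof (rule filterlim_atI)
  show "((\<lambda>\<beta>. 1 / sqrt \<beta>) \<longlongrightarrow> 0) at_top" by real_asymp
  show "\<forall>\<^sub>F \<beta> in at_top. 1 / sqrt \<beta> \<noteq> 0"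
    using eventually_gt_at_top[of 0] by eventually_elim simp
qed

text \<open>With t = 1 / sqrt \<beta> the exponent is ((\<beta> / 2 - 1) / \<beta>) times E(t) /
  t^2, which tends to c2 / 2 since the constant and linear terms of E vanish. Undoing the row shift,
  where the top row contributes 0, identifies c2 / 2 with the exponent of the weight.\<close>

lemma gt_energy_scaled_tendsto:
  assumes N: "1 \<le> N"
    and xt: "\<And>k. k \<in> {1..<N} \<Longrightarrow> crit k (gt_row xt k) (gt_row xt (k + 1))"
    and top: "\<And>i. i \<in> {1..N} \<Longrightarrow> \<eta> (N, i) = 0"
  shows "((\<lambda>\<beta>. exp ((\<beta> / 2 - 1) * gt_energy N (scaled_array N xt (1 / sqrt \<beta>) \<eta>)))
     \<longlongrightarrow> infty_corners_weight N xt \<eta>) at_top"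
proof -
  let ?C = "\<lambda>k. \<Sum>a=1..k. \<Sum>b=1..k + 1. (\<eta> (k, a) - \<eta> (k + 1, b))\<^sup>2 / (xt (k, a) - xt (k + 1, b))\<^sup>2"
  let ?P = "\<lambda>k. \<Sum>j=1..k. \<Sum>i=1..<j. (\<eta> (k, i) - \<eta> (k, j))\<^sup>2 / (xt (k, i) - xt (k, j))\<^sup>2"
  let ?E = "\<lambda>t. gt_energy N (scaled_array N xt t \<eta>)"
  have il: "strict_interlace k (gt_row xt k) (gt_row xt (k + 1))" if "k \<in> {1..<N}" for k
    using xt[OF that] by (simp add: crit_def)
  have "\<exists>c1. has_quad_exp (\<lambda>t. row_energy k (gt_row (scaled_array N xt t \<eta>) k) (gt_row (scaled_array N xt t \<eta>) (k + 1)))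
      0 c1 (- ?C k / 2 + ?P (k + 1))" if k: "k \<in> {1..<N}" for k
  proof -
    have "(\<lambda>t. row_energy k (gt_row (scaled_array N xt t \<eta>) k) (gt_row (scaled_array N xt t \<eta>) (k + 1))) =
       (\<lambda>t. row_energy k (\<lambda>a. gt_row xt k a + t * gt_row \<eta> k a) (\<lambda>b. gt_row xt (k + 1) b + t * gt_row \<eta> (k + 1) b))"
      using k by (intro ext row_energy_cong) (auto simp: scaled_array_nth)
    then show ?thesis
      using row_energy_quad_exp[OF il[OF k], of "gt_row \<eta> k" "gt_row \<eta> (k + 1)"]
      unfolding row_energy_crit[OF xt[OF k]] by (simp only:)
  qed
  then have "\<exists>c1. \<forall>k\<in>{1..<N}.
      has_quad_exp (\<lambda>t. row_energy k (gt_row (scaled_array N xt t \<eta>) k) (gt_row (scaled_array N xt t \<eta>) (k + 1)))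
      0 (c1 k) (- ?C k / 2 + ?P (k + 1))" by (intro bchoice ballI)
  then obtain c1 where "\<forall>k\<in>{1..<N}.
      has_quad_exp (\<lambda>t. row_energy k (gt_row (scaled_array N xt t \<eta>) k) (gt_row (scaled_array N xt t \<eta>) (k + 1)))
      0 (c1 k) (- ?C k / 2 + ?P (k + 1))" by (rule exE)
  note c1 = bspec[OF this]
  define c2 where "c2 = (\<Sum>k=1..<N. - ?C k / 2 + ?P (k + 1))"
  have "has_quad_exp ?E (\<Sum>k=1..<N. 0) (\<Sum>k=1..<N. c1 k) c2"
    unfolding gt_energy_def c2_def by (rule has_quad_exp_sum) (rule c1)
  then have exp: "has_quad_exp ?E 0 (\<Sum>k=1..<N. c1 k) c2" by (simp only: sum.neutral_const)
  have "\<forall>\<^sub>F t in at 0. ?E t \<le> 0"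
  proof -
    obtain c where c: "0 < c"
      "\<And>x. strict_gt N x \<Longrightarrow> (\<And>i. i \<in> {1..N} \<Longrightarrow> x (N, i) = xt (N, i)) \<Longrightarrow>
       gt_energy N x \<le> - c * (\<Sum>p\<in>gt_index (N - 1). (x p - xt p)\<^sup>2)"
      using gt_energy_le[OF N xt] by metis
    have "strict_gt N xt" using il by (simp add: strict_gt_def)
    from eventually_strict_gt[OF this, of \<eta>] show ?thesis
    proof eventually_elim
      case (elim t)
      then have "?E t \<le> - c * (\<Sum>p\<in>gt_index (N - 1). (scaled_array N xt t \<eta> p - xt p)\<^sup>2)"
        using top by (intro c(2)) (auto simp: scaled_array_nth)
      also have "\<dots> \<le> 0" using c(1) by (simp add: sum_nonneg)
      finally show ?case .
    qed
  qed
  (* the linear terms need not be computed: they cancel at a maximum *)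
  then have "(\<Sum>k=1..<N. c1 k) = 0" using has_quad_exp_maximum[OF exp] by simp
  then have "((\<lambda>t. ?E t / t\<^sup>2) \<longlongrightarrow> c2) (at 0)" using exp by (simp add: has_quad_exp_def)
  moreover note filterlim_inverse_sqrt_at_0
  ultimately have "((\<lambda>\<beta>. ?E (1 / sqrt \<beta>) / (1 / sqrt \<beta>)\<^sup>2) \<longlongrightarrow> c2) at_top"
    by (rule filterlim_compose)
  moreover have "((\<lambda>\<beta>::real. (\<beta> / 2 - 1) / \<beta>) \<longlongrightarrow> 1 / 2) at_top" by real_asymp
  ultimately have "((\<lambda>\<beta>. exp ((\<beta> / 2 - 1) / \<beta> * (?E (1 / sqrt \<beta>) / (1 / sqrt \<beta>)\<^sup>2))) \<longlongrightarrow> exp (1 / 2 * c2)) at_top"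
    by (intro tendsto_exp tendsto_mult)
  moreover have "\<forall>\<^sub>F \<beta> in at_top. exp ((\<beta> / 2 - 1) / \<beta> * (?E (1 / sqrt \<beta>) / (1 / sqrt \<beta>)\<^sup>2)) =
      exp ((\<beta> / 2 - 1) * ?E (1 / sqrt \<beta>))"
    using eventually_gt_at_top[of 0] by eventually_elim (simp add: power_divide)
  ultimately have lim: "((\<lambda>\<beta>. exp ((\<beta> / 2 - 1) * ?E (1 / sqrt \<beta>))) \<longlongrightarrow> exp (1 / 2 * c2)) at_top"
    by (rule Lim_transform_eventually)
  have "?P N = 0" using top by (intro sum.neutral ballI) auto
  then have shift: "(\<Sum>k=1..<N. ?P (k + 1)) = (\<Sum>k=1..<N. ?P k)"
    using sum_shift_telescope[OF N, of ?P] by simp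
  have "c2 = - (\<Sum>k=1..<N. ?C k) / 2 + (\<Sum>k=1..<N. ?P k)"
    by (simp only: c2_def sum.distrib shift sum_negf[symmetric] sum_divide_distrib)
  moreover have "(\<Sum>k=1..<N. ?P k / 2 - ?C k / 4) = (\<Sum>k=1..<N. ?P k) / 2 - (\<Sum>k=1..<N. ?C k) / 4"
    by (simp only: sum_subtractf sum_divide_distrib)
  moreover have "1 / 2 * (- u / 2 + w) = w / 2 - u / 4" for u w :: real by simp
  ultimately have "1 / 2 * c2 = (\<Sum>k=1..<N. ?P k / 2 - ?C k / 4)" by (simp only:)
  also have "\<dots> = (\<Sum>k=1..<N.
     (\<Sum>j=1..k. \<Sum>i=1..<j. (\<eta> (k, i) - \<eta> (k, j))\<^sup>2 / (2 * (xt (k, i) - xt (k, j))\<^sup>2)) -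
     (\<Sum>a=1..k. \<Sum>b=1..k+1.
        (\<eta> (k, a) - \<eta> (k + 1, b))\<^sup>2 / (4 * (xt (k, a) - xt (k + 1, b))\<^sup>2)))"
    unfolding sum_divide_distrib divide_divide_eq_left by (simp only: mult.commute)
  finally have "exp (1 / 2 * c2) = infty_corners_weight N xt \<eta>"
    unfolding infty_corners_weight_def by simp
  with lim show ?thesis by simp
qed

section \<open>Densities and Gaussian integrals\<close>

text \<open>The powers of k + 1 undo the constants added to the energy. Of the Vandermonde product
  of the top row, 1 / Z carries the power -(\<beta> - 1) and the exponential of the energy the power
  -(\<beta> - 2), so a single factor 1 / \<open>vdm N y\<close> remains outside.\<close>

definition density_const :: "nat \<Rightarrow> (nat \<Rightarrow> real) \<Rightarrow> real \<Rightarrow> real" where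
  "density_const N y \<beta> = (\<Prod>k=1..N. Gamma (real k * \<beta> / 2) / Gamma (\<beta> / 2) ^ k) *
     (\<Prod>k=1..<N. real (k + 1) powr (- real (k + 1) * (\<beta> / 2 - 1))) / vdm N y"

lemma strict_gt_imp_gt_patterns:
  assumes "x \<in> gt_index N \<rightarrow>\<^sub>E UNIV" "strict_gt N x"
  shows "x \<in> gt_patterns N"
  using assms unfolding gt_patterns_def strict_gt_def strict_interlace_def
  by (auto intro: less_imp_le)

text \<open>On degenerate patterns some factor is \<open>0 powr _ = 0\<close>.\<close>

lemma beta_corners_density_nonstrict:
  assumes "\<not> strict_gt N x"
  shows "beta_corners_density N y \<beta> x = 0"
proof (cases "x \<in> gt_patterns N")
  case True
  from assms obtain k a where k: "k \<in> {1..<N}" and a: "a \<in> {1..k}"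
    and ns: "\<not> (x (k + 1, a) < x (k, a) \<and> x (k, a) < x (k + 1, a + 1))"
    by (auto simp: strict_gt_def strict_interlace_def)
  have le: "x (k + 1, a) \<le> x (k, a)" "x (k, a) \<le> x (k + 1, a + 1)"
    using True k a by (auto simp: gt_patterns_def)
  obtain b where b: "b \<in> {1..k + 1}" "x (k, a) - x (k + 1, b) = 0"
  proof (cases "x (k + 1, a) = x (k, a)")
    case True
    then show ?thesis using that[of a] a by simp
  next
    case False
    then show ?thesis using that[of "a + 1"] a ns le by auto
  qed
  let ?f = "\<lambda>k a b. \<bar>x (k, a) - x (k + 1, b)\<bar> powr (\<beta> / 2 - 1)"
  have "?f k a b = 0" using b by simp
  then have "(\<Prod>b=1..k+1. ?f k a b) = 0" by (rule prod_zero[OF finite_atLeastAtMost bexI[OF _ b(1)]])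
  then have "(\<Prod>a=1..k. \<Prod>b=1..k+1. ?f k a b) = 0" by (rule prod_zero[OF finite_atLeastAtMost bexI[OF _ a]])
  then have "(\<Prod>j=1..k. \<Prod>i=1..<j. (x (k, j) - x (k, i)) powr (2 - \<beta>)) *
        (\<Prod>a=1..k. \<Prod>b=1..k+1. ?f k a b) = 0" by (simp only: mult_zero_right)
  then have "(\<Prod>k=1..<N. (\<Prod>j=1..k. \<Prod>i=1..<j. (x (k, j) - x (k, i)) powr (2 - \<beta>)) *
        (\<Prod>a=1..k. \<Prod>b=1..k+1. ?f k a b)) = 0"
    by (rule prod_zero[OF finite_atLeastLessThan bexI[OF _ k]])
  then show ?thesis unfolding beta_corners_density_def by simp
qed (simp add: beta_corners_density_def)

lemma prod_powr_eq_exp: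
  fixes f :: "'a \<Rightarrow> real"
  assumes "\<And>i. i \<in> I \<Longrightarrow> 0 < f i"
  shows "(\<Prod>i\<in>I. f i powr c) = exp (c * (\<Sum>i\<in>I. ln (f i)))"
proof (cases "finite I")
  case True
  have "(\<Prod>i\<in>I. f i powr c) = (\<Prod>i\<in>I. exp (c * ln (f i)))"
  proof (intro prod.cong refl)
    fix i assume "i \<in> I"
    from assms[OF this] show "f i powr c = exp (c * ln (f i))" by (simp add: powr_def)
  qed
  then show ?thesis using True by (simp add: exp_sum sum_distrib_left)
qed simp

lemma prod_prod_powr_eq_exp:
  fixes f :: "'a \<Rightarrow> 'b \<Rightarrow> real"
  assumes "\<And>i j. i \<in> I \<Longrightarrow> j \<in> J i \<Longrightarrow> 0 < f i j" "finite I"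
  shows "(\<Prod>i\<in>I. \<Prod>j\<in>J i. f i j powr c) = exp (c * (\<Sum>i\<in>I. \<Sum>j\<in>J i. ln (f i j)))"
proof -
  have "(\<Prod>i\<in>I. \<Prod>j\<in>J i. f i j powr c) = (\<Prod>i\<in>I. exp (c * (\<Sum>j\<in>J i. ln (f i j))))"
    using assms by (intro prod.cong refl prod_powr_eq_exp) auto
  then show ?thesis using assms(2) by (simp add: exp_sum sum_distrib_left)
qed

lemma vdm_powr_prod:
  assumes v: "strict_mono_on {1..n} v"
  shows "(\<Prod>j=1..n. \<Prod>i=1..<j. (v j - v i) powr c) = exp (c * ln (vdm n v))"
  unfolding ln_vdm[OF v]
proof (rule prod_prod_powr_eq_exp)
  fix j i assume "j \<in> {1..n}" "i \<in> {1..<j}"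
  then show "0 < v j - v i" using strict_mono_onD[OF v, of i j] by simp
qed simp

lemma beta_corners_density_strict:
  assumes N: "1 \<le> N" and y: "strict_mono_on {1..N} y"
    and x: "x \<in> gt_index N \<rightarrow>\<^sub>E UNIV" and top: "\<And>i. i \<in> {1..N} \<Longrightarrow> x (N, i) = y i"
    and strict: "strict_gt N x"
  shows "beta_corners_density N y \<beta> x = density_const N y \<beta> * exp ((\<beta> / 2 - 1) * gt_energy N x)"
proof -
  let ?V = "\<lambda>k. ln (vdm k (gt_row x k))"
  let ?R = "\<lambda>k. \<Sum>a=1..k. \<Sum>b=1..k + 1. ln \<bar>x (k, a) - x (k + 1, b)\<bar>"
  let ?c = "\<lambda>k. real (k + 1) * ln (real (k + 1))"
  define \<theta> where "\<theta> = \<beta> / 2"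
  have il: "strict_interlace k (gt_row x k) (gt_row x (k + 1))" if "k \<in> {1..<N}" for k
    using strict that by (auto simp: strict_gt_def)
  have mono: "strict_mono_on {1..k} (gt_row x k)" if "k \<in> {1..<N}" for k
    using strict_interlace_imp_strict_mono(2)[OF il[OF that]] .
  have vN: "vdm N (gt_row x N) = vdm N y" unfolding vdm_def using top by (intro prod.cong refl) auto
  have V1: "?V 1 = 0" by (simp add: vdm_def)
  have row: "(\<Prod>j=1..k. \<Prod>i=1..<j. (x (k, j) - x (k, i)) powr (2 - \<beta>)) *
        (\<Prod>a=1..k. \<Prod>b=1..k+1. \<bar>x (k, a) - x (k + 1, b)\<bar> powr (\<beta> / 2 - 1)) =
      exp ((\<theta> - 1) * (?R k - 2 * ?V k))" if k: "k \<in> {1..<N}" for k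
  proof -
    have "(\<Prod>a=1..k. \<Prod>b=1..k+1. \<bar>x (k, a) - x (k + 1, b)\<bar> powr (\<beta> / 2 - 1)) = exp ((\<beta> / 2 - 1) * ?R k)"
      using strict_interlace_neq(1)[OF il[OF k]] by (intro prod_prod_powr_eq_exp) auto
    moreover have "(2 - \<beta>) * ?V k + (\<beta> / 2 - 1) * ?R k = (\<theta> - 1) * (?R k - 2 * ?V k)"
      unfolding \<theta>_def by (simp add: field_simps del: sum.cl_ivl_Suc)
    ultimately show ?thesis
      unfolding vdm_powr_prod[OF mono[OF k]] by (simp only: exp_add[symmetric])
  qed
  \<comment> \<open>\<open>row_energy\<close> subtracts the Vandermonde term of row k + 1, the
    density carries that of row k. Telescoping exchanges them at the cost of the two ends, 0 for row
    1 and \<open>ln (vdm N y)\<close> for the top row.\<close>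
  have energy: "gt_energy N x = (\<Sum>k=1..<N. ?R k - 2 * ?V k) - 2 * ln (vdm N y) + (\<Sum>k=1..<N. ?c k)"
  proof -
    have "gt_energy N x = (\<Sum>k=1..<N. ?R k - 2 * ?V (k + 1) + ?c k)"
      unfolding gt_energy_def row_energy_def
    proof (intro sum.cong refl)
      fix k assume "k \<in> {1..<N}"
      from strict_interlace_imp_strict_mono(1)[OF il[OF this]]
      show "?R k - 2 * (\<Sum>j=1..k + 1. \<Sum>i=1..<j. ln (x (k + 1, j) - x (k + 1, i))) + ?c k =
          ?R k - 2 * ?V (k + 1) + ?c k" by (simp only: ln_vdm)
    qed
    also have "\<dots> = (\<Sum>k=1..<N. ?R k) - 2 * (\<Sum>k=1..<N. ?V (k + 1)) + (\<Sum>k=1..<N. ?c k)"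
      by (simp only: sum.distrib sum_subtractf sum_distrib_left)
    also have "(\<Sum>k=1..<N. ?V (k + 1)) = (\<Sum>k=1..<N. ?V k) + ln (vdm N y)"
      using sum_shift_telescope[OF N, of ?V] V1 vN by simp
    also have "(\<Sum>k=1..<N. ?R k) - 2 * ((\<Sum>k=1..<N. ?V k) + ln (vdm N y)) + (\<Sum>k=1..<N. ?c k) =
       (\<Sum>k=1..<N. ?R k - 2 * ?V k) - 2 * ln (vdm N y) + (\<Sum>k=1..<N. ?c k)"
      by (simp only: sum_subtractf sum_distrib_left[symmetric]) simp
    finally show ?thesis .
  qed
  have cprod: "(\<Prod>k=1..<N. real (k + 1) powr (- real (k + 1) * (\<beta> / 2 - 1))) = exp (- (\<theta> - 1) * (\<Sum>k=1..<N. ?c k))"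
  proof -
    have "(\<Prod>k=1..<N. real (k + 1) powr (- real (k + 1) * (\<beta> / 2 - 1))) = (\<Prod>k=1..<N. exp (- (\<theta> - 1) * ?c k))"
      unfolding \<theta>_def by (intro prod.cong refl) (simp add: powr_def algebra_simps add_divide_distrib[symmetric])
    then show ?thesis by (simp add: exp_sum[symmetric] sum_distrib_left)
  qed
  define G where "G = (\<Prod>k=1..N. Gamma (real k * \<beta> / 2) / Gamma (\<beta> / 2) ^ k)"
  define E where "E = (\<Sum>k=1..<N. ?R k - 2 * ?V k)"
  define C where "C = (\<Sum>k=1..<N. ?c k)"
  have Vpos: "0 < vdm N y" using vdm_pos[OF y] .
  have Z: "1 / beta_corners_Z N y \<beta> = G * exp (- (\<beta> - 1) * ln (vdm N y))"
  proof -
    have "(\<Prod>k=1..N. Gamma (\<beta> / 2) ^ k / Gamma (real k * \<beta> / 2)) = inverse G"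
      unfolding G_def prod_inversef[symmetric] by simp
    moreover have "1 / (inverse G * exp ((\<beta> - 1) * u)) = G * exp (- (\<beta> - 1) * u)" for u
    proof -
      have "exp (- (\<beta> - 1) * u) = inverse (exp ((\<beta> - 1) * u))" by (simp only: mult_minus_left exp_minus)
      then show ?thesis by (simp add: divide_inverse del: mult_minus_left)
    qed
    ultimately show ?thesis unfolding beta_corners_Z_def vdm_powr_prod[OF y] by (simp only:)
  qed
  have rows: "(\<Prod>k=1..<N. (\<Prod>j=1..k. \<Prod>i=1..<j. (x (k, j) - x (k, i)) powr (2 - \<beta>)) *
        (\<Prod>a=1..k. \<Prod>b=1..k+1. \<bar>x (k, a) - x (k + 1, b)\<bar> powr (\<beta> / 2 - 1))) =
      (\<Prod>k=1..<N. exp ((\<theta> - 1) * (?R k - 2 * ?V k)))"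
    by (intro prod.cong refl row)
  have "beta_corners_density N y \<beta> x = 1 / beta_corners_Z N y \<beta> * (\<Prod>k=1..<N. exp ((\<theta> - 1) * (?R k - 2 * ?V k)))"
    unfolding beta_corners_density_def rows
    by (simp only: indicator_simps(1)[OF strict_gt_imp_gt_patterns[OF x strict]])
  also have "\<dots> = G * exp (- (\<beta> - 1) * ln (vdm N y)) * exp ((\<theta> - 1) * E)"
    unfolding Z E_def by (simp only: exp_sum[symmetric] finite_atLeastLessThan sum_distrib_left)
  also have "\<dots> = G * exp (- (\<theta> - 1) * C) / vdm N y * exp ((\<theta> - 1) * (E - 2 * ln (vdm N y) + C))"
  proof -
    have "exp (- (\<beta> - 1) * ln (vdm N y)) * exp ((\<theta> - 1) * E) =
       exp (- (\<theta> - 1) * C + - ln (vdm N y) + (\<theta> - 1) * (E - 2 * ln (vdm N y) + C))"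
      unfolding exp_add[symmetric] \<theta>_def by (simp add: field_simps)
    also have "\<dots> = exp (- (\<theta> - 1) * C) / vdm N y * exp ((\<theta> - 1) * (E - 2 * ln (vdm N y) + C))"
      unfolding exp_add using Vpos by (simp add: exp_minus divide_inverse)
    finally show ?thesis by (simp only: mult.assoc times_divide_eq_right times_divide_eq_left)
  qed
  finally show ?thesis
    unfolding density_const_def cprod energy E_def C_def G_def \<theta>_def by simp
qed

text \<open>The limit of the rescaled prefactor. It is also the reciprocal of the Gaussian mass, by
  \<open>infty_corners_weight_nn_integral\<close>, hence the normalizing constant of the limit
  law.\<close>

definition limit_const :: "nat \<Rightarrow> (nat \<Rightarrow> real) \<Rightarrow> real" where
  "limit_const N y = (\<Prod>k=1..<N. (4 * pi) powr (- real k / 2) * real (k + 1) powr (real k + 1 / 2)) / vdm N y"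

lemma card_gt_index: "real (card (gt_index n)) = (\<Sum>k=1..n. real k)"
  using sum_gt_index[of "\<lambda>_. 1 :: real" n] by simp

text \<open>Row k has k entries, so the Jacobian splits into factors of exponent -k / 2, each
  matched with the Gamma quotient of index k + 1. The Gamma quotient of index 1 is 1 and drops
  out.\<close>

lemma density_const_tendsto:
  assumes N: "1 \<le> N"
  shows "((\<lambda>\<beta>. \<beta> powr (- real (card (gt_index (N - 1))) / 2) * density_const N y \<beta>)
      \<longlongrightarrow> limit_const N y) at_top"
proof -
  let ?g = "\<lambda>k \<beta>. Gamma (real (k + 1) * (\<beta> / 2)) / Gamma (\<beta> / 2) ^ (k + 1) *
      real (k + 1) powr (- real (k + 1) * (\<beta> / 2 - 1)) * (2 * (\<beta> / 2)) powr (- (real (k + 1) - 1) / 2)"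
  have half: "filterlim (\<lambda>\<beta>::real. \<beta> / 2) at_top at_top" by real_asymp
  have "((\<lambda>\<beta>. (\<Prod>k=1..<N. ?g k \<beta>) / vdm N y) \<longlongrightarrow>
      (\<Prod>k=1..<N. (4 * pi) powr (- (real (k + 1) - 1) / 2) * real (k + 1) powr (real (k + 1) - 1 / 2)) / vdm N y) at_top"
  proof -
    have "((\<lambda>\<beta>. ?g k \<beta>) \<longlongrightarrow> (4 * pi) powr (- (real (k + 1) - 1) / 2) * real (k + 1) powr (real (k + 1) - 1 / 2)) at_top" for k
      by (rule filterlim_compose[OF multinomial_Gamma_tendsto half]) simp
    then show ?thesis unfolding divide_inverse by (intro tendsto_mult[OF _ tendsto_const] tendsto_prod)
  qed
  moreover have "(\<Prod>k=1..<N. (4 * pi) powr (- (real (k + 1) - 1) / 2) * real (k + 1) powr (real (k + 1) - 1 / 2)) / vdm N y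
      = limit_const N y"
    unfolding limit_const_def by (intro arg_cong2[where f="(/)"] prod.cong refl) (simp add: field_simps)
  moreover have "\<forall>\<^sub>F \<beta> in at_top. (\<Prod>k=1..<N. ?g k \<beta>) / vdm N y =
      \<beta> powr (- real (card (gt_index (N - 1))) / 2) * density_const N y \<beta>"
    using eventually_gt_at_top[of 0]
  proof eventually_elim
    case (elim \<beta>)
    have "{1..<N} = {1..N - 1}" using N by auto
    then have pw: "\<beta> powr (- real (card (gt_index (N - 1))) / 2) = (\<Prod>k=1..<N. \<beta> powr (- real k / 2))"
      unfolding card_gt_index using elim by (simp add: powr_sum[symmetric] sum_negf sum_divide_distrib)
    have gam: "(\<Prod>k=1..N. Gamma (real k * \<beta> / 2) / Gamma (\<beta> / 2) ^ k) =
        (\<Prod>k=1..<N. Gamma (real (k + 1) * (\<beta> / 2)) / Gamma (\<beta> / 2) ^ (k + 1))"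
    proof -
      have shift: "(\<Prod>k=1..N. f k) = (\<Prod>k=1..<N. f (k + 1))" if "f 1 = 1" for f :: "nat \<Rightarrow> real"
        using N by (induction N rule: dec_induct) (simp_all add: that[simplified])
      have "Gamma (\<beta> / 2) \<noteq> 0"
        by (rule Gamma_real_pos[THEN less_imp_neq, symmetric]) (use elim in simp)
      then show ?thesis
        by (subst shift) simp_all
    qed
    have C: "(2 * (\<beta> / 2)) powr (- (real (k + 1) - 1) / 2) = \<beta> powr (- real k / 2)" for k by simp
    show ?case unfolding density_const_def pw gam C prod.distrib by simp
  qed
  ultimately show ?thesis using Lim_transform_eventually by fastforce
qed

section \<open>Row-by-row Gaussian structure of the limiting weight\<close>

definition cond_precision :: "(nat \<times> nat \<Rightarrow> real) \<Rightarrow> nat \<times> nat \<Rightarrow> real" where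
  "cond_precision xt = (\<lambda>(k, a). (\<Sum>b=1..k + 1. 1 / (xt (k, a) - xt (k + 1, b))\<^sup>2) / 4)"

text \<open>Weights of the conditional mean of an entry given the row above in the Gaussian field.
  The matching \<open>cond_precision\<close> multiplies the square without a factor 1/2, so the
  conditional variance is 1 / (2 \<open>cond_precision\<close>).\<close>

definition cond_coeff :: "(nat \<times> nat \<Rightarrow> real) \<Rightarrow> nat \<times> nat \<Rightarrow> nat \<Rightarrow> real" where
  "cond_coeff xt = (\<lambda>(k, a) b. 1 / (xt (k, a) - xt (k + 1, b))\<^sup>2 / (\<Sum>b=1..k + 1. 1 / (xt (k, a) - xt (k + 1, b))\<^sup>2))"

text \<open>The variance left by completing squares in row k equals the positive pair term of row k
  + 1 and cancels it; at the top both vanish since \<eta> is 0 there. Only negative squares remain,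
  each centred at a linear function of the row above.\<close>

lemma infty_corners_weight_eq:
  assumes N: "1 \<le> N"
    and xt: "\<And>k. k \<in> {1..<N} \<Longrightarrow> crit k (gt_row xt k) (gt_row xt (k + 1))"
    and top: "\<And>i. i \<in> {1..N} \<Longrightarrow> \<eta> (N, i) = 0"
  shows "infty_corners_weight N xt \<eta> = exp (- (\<Sum>k=1..<N. \<Sum>a=1..k.
     cond_precision xt (k, a) * (\<eta> (k, a) - (\<Sum>b=1..k + 1. cond_coeff xt (k, a) b * \<eta> (k + 1, b)))\<^sup>2))"
proof -
  let ?C = "\<lambda>k. \<Sum>a=1..k. \<Sum>b=1..k + 1. (\<eta> (k, a) - \<eta> (k + 1, b))\<^sup>2 / (xt (k, a) - xt (k + 1, b))\<^sup>2"
  let ?P = "\<lambda>k. \<Sum>j=1..k. \<Sum>i=1..<j. (\<eta> (k, i) - \<eta> (k, j))\<^sup>2 / (xt (k, i) - xt (k, j))\<^sup>2"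
  let ?Q = "\<lambda>k. \<Sum>a=1..k. cond_precision xt (k, a) *
      (\<eta> (k, a) - (\<Sum>b=1..k + 1. cond_coeff xt (k, a) b * \<eta> (k + 1, b)))\<^sup>2"
  have C: "?C k / 4 = ?Q k + ?P (k + 1) / 2" if k: "k \<in> {1..<N}" for k
  proof -
    let ?S = "\<lambda>a. \<Sum>b=1..k + 1. 1 / (xt (k, a) - xt (k + 1, b))\<^sup>2"
    have "?C k = (\<Sum>a=1..k. ?S a * (\<eta> (k, a) - (\<Sum>b=1..k + 1. \<eta> (k + 1, b) / (xt (k, a) - xt (k + 1, b))\<^sup>2) / ?S a)\<^sup>2) +
        2 * ?P (k + 1)"
      using crit_quadratic_identity[OF xt[OF k], of "gt_row \<eta> k" "gt_row \<eta> (k + 1)"] .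
    moreover have "(\<Sum>a=1..k. ?S a * (\<eta> (k, a) - (\<Sum>b=1..k + 1. \<eta> (k + 1, b) / (xt (k, a) - xt (k + 1, b))\<^sup>2) / ?S a)\<^sup>2)
       = 4 * ?Q k"
      unfolding sum_distrib_left
    proof (intro sum.cong refl)
      fix a
      have "(\<Sum>b=1..k + 1. \<eta> (k + 1, b) / (xt (k, a) - xt (k + 1, b))\<^sup>2) / ?S a =
          (\<Sum>b=1..k + 1. cond_coeff xt (k, a) b * \<eta> (k + 1, b))"
        unfolding sum_divide_distrib cond_coeff_def by (intro sum.cong refl) simp
      then show "?S a * (\<eta> (k, a) - (\<Sum>b=1..k + 1. \<eta> (k + 1, b) / (xt (k, a) - xt (k + 1, b))\<^sup>2) / ?S a)\<^sup>2 =
        4 * (cond_precision xt (k, a) * (\<eta> (k, a) - (\<Sum>b=1..k + 1. cond_coeff xt (k, a) b * \<eta> (k + 1, b)))\<^sup>2)"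
        by (simp add: cond_precision_def del: sum.cl_ivl_Suc)
    qed
    ultimately show ?thesis by (simp del: sum.cl_ivl_Suc)
  qed
  have PN: "?P N = 0" using top by (intro sum.neutral ballI) auto
  have shift: "(\<Sum>k=1..<N. ?P (k + 1)) = (\<Sum>k=1..<N. ?P k)"
    using sum_shift_telescope[OF N, of ?P] PN by simp
  have "(\<Sum>k=1..<N.
     (\<Sum>j=1..k. \<Sum>i=1..<j. (\<eta> (k, i) - \<eta> (k, j))\<^sup>2 / (2 * (xt (k, i) - xt (k, j))\<^sup>2)) -
     (\<Sum>a=1..k. \<Sum>b=1..k+1.
        (\<eta> (k, a) - \<eta> (k + 1, b))\<^sup>2 / (4 * (xt (k, a) - xt (k + 1, b))\<^sup>2))) =
     (\<Sum>k=1..<N. ?P k / 2 - ?C k / 4)"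
    unfolding sum_divide_distrib divide_divide_eq_left by (simp only: mult.commute)
  also have "\<dots> = (\<Sum>k=1..<N. ?P k / 2 - (?Q k + ?P (k + 1) / 2))"
    by (intro sum.cong refl arg_cong2[where f="(-)"] C)
  also have "\<dots> = (\<Sum>k=1..<N. ?P k) / 2 - (\<Sum>k=1..<N. ?Q k) - (\<Sum>k=1..<N. ?P (k + 1)) / 2"
    by (simp only: sum_subtractf sum_divide_distrib sum.distrib diff_diff_eq)
  also have "\<dots> = - (\<Sum>k=1..<N. ?Q k)" unfolding shift by simp
  finally show ?thesis unfolding infty_corners_weight_def by (simp only:)
qed

lemma nn_integral_gaussian:
  assumes "0 < A"
  shows "(\<integral>\<^sup>+ x. ennreal (exp (- A * (x - \<mu>)\<^sup>2)) \<partial>lborel) = ennreal (sqrt (pi / A))"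
proof -
  define \<sigma> where "\<sigma> = 1 / sqrt (2 * A)"
  have \<sigma>: "0 < \<sigma>" "2 * \<sigma>\<^sup>2 = 1 / A" using assms by (auto simp: \<sigma>_def power_divide)
  have eq: "exp (- A * (x - \<mu>)\<^sup>2) = sqrt (pi / A) * normal_density \<mu> \<sigma> x" for x
  proof -
    have "2 * pi * \<sigma>\<^sup>2 = pi / A" using arg_cong[OF \<sigma>(2), of "\<lambda>t. pi * t"] by simp
    moreover have "- (x - \<mu>)\<^sup>2 / (2 * \<sigma>\<^sup>2) = - A * (x - \<mu>)\<^sup>2" unfolding \<sigma>(2) by simp
    ultimately show ?thesis using assms unfolding normal_density_def by simp
  qed
  have "(\<integral>\<^sup>+ x. ennreal (normal_density \<mu> \<sigma> x) \<partial>lborel) = 1"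
    using \<sigma>(1) by (subst nn_integral_eq_integral) auto
  moreover have "(\<integral>\<^sup>+ x. ennreal (exp (- A * (x - \<mu>)\<^sup>2)) \<partial>lborel) =
     ennreal (sqrt (pi / A)) * (\<integral>\<^sup>+ x. ennreal (normal_density \<mu> \<sigma> x) \<partial>lborel)"
    unfolding eq using assms by (subst nn_integral_cmult[symmetric]) (auto simp: ennreal_mult)
  ultimately show ?thesis by simp
qed

text \<open>Rows up to \<open>m\<close> are integration variables, higher rows are frozen
  parameters. In an induction on \<open>m\<close> this lets row m + 1 pass from variable to
  parameter.\<close>

definition override_rows :: "nat \<Rightarrow> (nat \<times> nat \<Rightarrow> real) \<Rightarrow> (nat \<times> nat \<Rightarrow> real) \<Rightarrow> nat \<times> nat \<Rightarrow> real" where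
  "override_rows m \<zeta> z = (\<lambda>(k, i). if k \<le> m then z (k, i) else \<zeta> (k, i))"

lemma measurable_override_rows [measurable]:
  assumes "1 \<le> i" "i \<le> k"
  shows "(\<lambda>z. override_rows m \<zeta> z (k, i)) \<in> borel_measurable (array_lborel m)"
proof (cases "k \<le> m")
  case True
  then have "(k, i) \<in> gt_index m" using assms by (simp add: gt_index_def)
  then have "(\<lambda>z. z (k, i)) \<in> measurable (array_lborel m) lborel" by (rule measurable_component_singleton)
  then show ?thesis using True by (simp add: override_rows_def)
qed (simp add: override_rows_def)

text \<open>The higher rows enter only through the centres of the squares, so the integral over the
  rows below is the same for all their values. The induction hypothesis, for arbitrary frozen
  \<zeta>, evaluates the inner integral over rows 1 to m; the outer one over row m + 1 is a product
  of one-dimensional Gaussians.\<close>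

lemma nn_integral_triangular_gaussian:
  assumes A: "\<And>p. p \<in> gt_index m \<Longrightarrow> 0 < A p"
  shows "(\<integral>\<^sup>+ z. ennreal (exp (- (\<Sum>k=1..m. \<Sum>a=1..k. A (k, a) *
      (override_rows m \<zeta> z (k, a) - (\<Sum>b=1..k + 1. c (k, a) b * override_rows m \<zeta> z (k + 1, b)))\<^sup>2)))
      \<partial>array_lborel m) = ennreal (\<Prod>k=1..m. \<Prod>a=1..k. sqrt (pi / A (k, a)))"
proof -
  interpret product_sigma_finite "\<lambda>_::nat \<times> nat. lborel :: real measure"
    by (simp add: product_sigma_finite_def sigma_finite_lborel)
  show ?thesis using A
  proof (induction m arbitrary: \<zeta>)
    case 0
    have "gt_index 0 = {}" by (auto simp: gt_index_def)
    then show ?case by (simp add: nn_integral_empty del: nn_integral_const)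
  next
    case (Suc m)
    define q where "q z k = (\<Sum>a=1..k. A (k, a) * (z (k, a) - (\<Sum>b=1..k + 1. c (k, a) b * z (k + 1, b)))\<^sup>2)"
      for z :: "nat \<times> nat \<Rightarrow> real" and k
    let ?I = "{Suc m} \<times> {1..Suc m}" and ?J = "gt_index m"
    define \<mu> where "\<mu> p = (\<Sum>b=1..Suc m + 1. c p b * \<zeta> (Suc m + 1, b))" for p
    have qmeas: "(\<lambda>z. q (override_rows m' \<zeta>' z) k) \<in> borel_measurable (array_lborel m')" for m' \<zeta>' k
      unfolding q_def
      by (intro borel_measurable_sum borel_measurable_times borel_measurable_const borel_measurable_power
          borel_measurable_diff measurable_override_rows) auto
    have IJ: "?I \<inter> ?J = {}" "gt_index (Suc m) = ?I \<union> ?J" by (auto simp: gt_index_def)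
    have qcong: "q z k = q z' k"
      if "\<And>i. i \<in> {1..k} \<Longrightarrow> z (k, i) = z' (k, i)" "\<And>i. i \<in> {1..k + 1} \<Longrightarrow> z (k + 1, i) = z' (k + 1, i)" for z z' k
    proof -
      have "(\<Sum>b=1..k + 1. c (k, a) b * z (k + 1, b)) = (\<Sum>b=1..k + 1. c (k, a) b * z' (k + 1, b))" for a
        using that(2) by (intro sum.cong refl) simp
      then show ?thesis unfolding q_def using that(1) by (intro sum.cong refl) (simp del: sum.cl_ivl_Suc)
    qed
    \<comment> \<open>The new row \<open>x\<close> occurs in the first factor only as a frozen
      parameter, and \<mu> depends on \<zeta> alone.\<close>
    have split: "exp (- (\<Sum>k=1..Suc m. q (override_rows (Suc m) \<zeta> (merge ?I ?J (x, z))) k)) =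
        exp (- (\<Sum>k=1..m. q (override_rows m (\<lambda>(k, i). if k = Suc m then x (k, i) else \<zeta> (k, i)) z) k)) *
        (\<Prod>p\<in>?I. exp (- A p * (x p - \<mu> p)\<^sup>2))" for x z
    proof -
      have 1: "q (override_rows (Suc m) \<zeta> (merge ?I ?J (x, z))) k =
          q (override_rows m (\<lambda>(k, i). if k = Suc m then x (k, i) else \<zeta> (k, i)) z) k" if "k \<in> {1..m}" for k
        using that by (intro qcong) (auto simp: override_rows_def merge_def gt_index_def)
      have 2: "q (override_rows (Suc m) \<zeta> (merge ?I ?J (x, z))) (Suc m) = (\<Sum>p\<in>?I. A p * (x p - \<mu> p)\<^sup>2)"
      proof -
        have "(\<Sum>p\<in>?I. A p * (x p - \<mu> p)\<^sup>2) = (\<Sum>a=1..Suc m. A (Suc m, a) * (x (Suc m, a) - \<mu> (Suc m, a))\<^sup>2)"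
          by (subst sum.cartesian_product[symmetric, of "\<lambda>k a. A (k, a) * (x (k, a) - \<mu> (k, a))\<^sup>2", simplified case_prod_unfold prod.collapse]) simp
        also have "\<dots> = q (override_rows (Suc m) \<zeta> (merge ?I ?J (x, z))) (Suc m)"
          unfolding q_def \<mu>_def by (intro sum.cong refl) (auto simp: override_rows_def merge_def simp del: sum.cl_ivl_Suc)
        finally show ?thesis by simp
      qed
      have "(\<Sum>k=1..Suc m. q (override_rows (Suc m) \<zeta> (merge ?I ?J (x, z))) k) =
        (\<Sum>k=1..m. q (override_rows m (\<lambda>(k, i). if k = Suc m then x (k, i) else \<zeta> (k, i)) z) k) +
        (\<Sum>p\<in>?I. A p * (x p - \<mu> p)\<^sup>2)"
      proof -
        have "(\<Sum>k=1..m. q (override_rows (Suc m) \<zeta> (merge ?I ?J (x, z))) k) =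
          (\<Sum>k=1..m. q (override_rows m (\<lambda>(k, i). if k = Suc m then x (k, i) else \<zeta> (k, i)) z) k)"
          by (intro sum.cong refl 1)
        then show ?thesis by (simp only: sum.cl_ivl_Suc 2) simp
      qed
      then show ?thesis by (simp add: exp_add[symmetric] exp_sum[symmetric] sum_negf)
    qed
    have IH: "(\<integral>\<^sup>+ z. ennreal (exp (- (\<Sum>k=1..m. q (override_rows m \<zeta>' z) k))) \<partial>array_lborel m) =
        ennreal (\<Prod>k=1..m. \<Prod>a=1..k. sqrt (pi / A (k, a)))" for \<zeta>'
      unfolding q_def using Suc.prems by (intro Suc.IH) (auto simp: gt_index_def)
    have gmeas: "(\<lambda>x. \<Prod>p\<in>?I. ennreal (exp (- A p * (x p - \<mu> p)\<^sup>2))) \<in> borel_measurable (Pi\<^sub>M ?I (\<lambda>_. lborel))"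
    proof (rule borel_measurable_prod_ennreal)
      fix p assume "p \<in> ?I"
      then have "(\<lambda>x. x p) \<in> measurable (Pi\<^sub>M ?I (\<lambda>_. lborel)) lborel" by (rule measurable_component_singleton)
      then have [measurable]: "(\<lambda>x. x p) \<in> borel_measurable (Pi\<^sub>M ?I (\<lambda>_. lborel))" by simp
      show "(\<lambda>x. ennreal (exp (- A p * (x p - \<mu> p)\<^sup>2))) \<in> borel_measurable (Pi\<^sub>M ?I (\<lambda>_. lborel))"
        by measurable
    qed
    have Apos: "0 < A p" if "p \<in> ?I" for p using that Suc.prems IJ by auto
    have "(\<integral>\<^sup>+ z. ennreal (exp (- (\<Sum>k=1..Suc m. q (override_rows (Suc m) \<zeta> z) k))) \<partial>array_lborel (Suc m)) =
      (\<integral>\<^sup>+ x. \<integral>\<^sup>+ z. ennreal (exp (- (\<Sum>k=1..Suc m. q (override_rows (Suc m) \<zeta> (merge ?I ?J (x, z))) k)))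
         \<partial>array_lborel m \<partial>Pi\<^sub>M ?I (\<lambda>_. lborel))"
      unfolding IJ(2)
      by (rule product_nn_integral_fold[OF IJ(1)])
        (use qmeas[of "Suc m"] in \<open>auto simp: IJ(2) intro!: measurable_compose[OF _ measurable_ennreal]\<close>)
    also have "\<dots> = (\<integral>\<^sup>+ x. ennreal (\<Prod>k=1..m. \<Prod>a=1..k. sqrt (pi / A (k, a))) *
        (\<Prod>p\<in>?I. ennreal (exp (- A p * (x p - \<mu> p)\<^sup>2))) \<partial>Pi\<^sub>M ?I (\<lambda>_. lborel))"
    proof (intro nn_integral_cong)
      fix x
      have "(\<integral>\<^sup>+ z. ennreal (exp (- (\<Sum>k=1..Suc m. q (override_rows (Suc m) \<zeta> (merge ?I ?J (x, z))) k))) \<partial>array_lborel m) =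
        (\<integral>\<^sup>+ z. ennreal (exp (- (\<Sum>k=1..m. q (override_rows m (\<lambda>(k, i). if k = Suc m then x (k, i) else \<zeta> (k, i)) z) k))) *
          (\<Prod>p\<in>?I. ennreal (exp (- A p * (x p - \<mu> p)\<^sup>2))) \<partial>array_lborel m)"
        unfolding split by (simp add: ennreal_mult prod_nonneg prod_ennreal)
      also have "\<dots> = ennreal (\<Prod>k=1..m. \<Prod>a=1..k. sqrt (pi / A (k, a))) *
        (\<Prod>p\<in>?I. ennreal (exp (- A p * (x p - \<mu> p)\<^sup>2)))"
      proof (subst nn_integral_multc)
        have [measurable]: "(\<lambda>z. q (override_rows m \<zeta>' z) k) \<in> borel_measurable (array_lborel m)" for \<zeta>' k
          by (rule qmeas)
        show "(\<lambda>z. ennreal (exp (- (\<Sum>k=1..m. q (override_rows m (\<lambda>(k, i). if k = Suc m then x (k, i) else \<zeta> (k, i)) z) k))))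
            \<in> borel_measurable (array_lborel m)" by measurable
      qed (simp only: IH)
      finally show "(\<integral>\<^sup>+ z. ennreal (exp (- (\<Sum>k=1..Suc m. q (override_rows (Suc m) \<zeta> (merge ?I ?J (x, z))) k))) \<partial>array_lborel m) =
        ennreal (\<Prod>k=1..m. \<Prod>a=1..k. sqrt (pi / A (k, a))) *
        (\<Prod>p\<in>?I. ennreal (exp (- A p * (x p - \<mu> p)\<^sup>2)))" .
    qed
    also have "\<dots> = ennreal (\<Prod>k=1..m. \<Prod>a=1..k. sqrt (pi / A (k, a))) *
        (\<integral>\<^sup>+ x. (\<Prod>p\<in>?I. ennreal (exp (- A p * (x p - \<mu> p)\<^sup>2))) \<partial>Pi\<^sub>M ?I (\<lambda>_. lborel))"
      by (rule nn_integral_cmult[OF gmeas])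
    also have "(\<integral>\<^sup>+ x. (\<Prod>p\<in>?I. ennreal (exp (- A p * (x p - \<mu> p)\<^sup>2))) \<partial>Pi\<^sub>M ?I (\<lambda>_. lborel)) =
        (\<Prod>p\<in>?I. \<integral>\<^sup>+ t. ennreal (exp (- A p * (t - \<mu> p)\<^sup>2)) \<partial>lborel)"
      by (rule product_nn_integral_prod[of ?I "\<lambda>p t. ennreal (exp (- A p * (t - \<mu> p)\<^sup>2))"]) auto
    also have "\<dots> = (\<Prod>p\<in>?I. ennreal (sqrt (pi / A p)))"
      by (intro prod.cong refl nn_integral_gaussian Apos)
    also have "\<dots> = ennreal (\<Prod>p\<in>?I. sqrt (pi / A p))"
      using Apos by (intro prod_ennreal) (auto simp: less_imp_le)
    also have "(\<Prod>p\<in>?I. sqrt (pi / A p)) = (\<Prod>a=1..Suc m. sqrt (pi / A (Suc m, a)))"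
      by (subst prod.cartesian_product[symmetric, of "\<lambda>k a. sqrt (pi / A (k, a))", simplified case_prod_unfold prod.collapse]) simp
    also have "ennreal (\<Prod>k=1..m. \<Prod>a=1..k. sqrt (pi / A (k, a))) * ennreal (\<Prod>a=1..Suc m. sqrt (pi / A (Suc m, a))) =
        ennreal (\<Prod>k=1..Suc m. \<Prod>a=1..k. sqrt (pi / A (k, a)))"
    proof -
      have "0 \<le> sqrt (pi / A (k, a))" if "1 \<le> a" "a \<le> k" "k \<le> Suc m" for k a
        using Suc.prems[of "(k, a)"] that by (simp add: gt_index_def less_imp_le)
      then have "0 \<le> (\<Prod>k=1..m. \<Prod>a=1..k. sqrt (pi / A (k, a)))" "0 \<le> (\<Prod>a=1..Suc m. sqrt (pi / A (Suc m, a)))"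
        by (auto intro!: prod_nonneg simp del: prod.cl_ivl_Suc real_sqrt_ge_0_iff)
      then show ?thesis by (simp only: ennreal_mult[symmetric] prod.cl_ivl_Suc[of _ 1 m]) simp
    qed
    finally show ?case unfolding q_def .
  qed
qed

lemma limit_const_pos:
  assumes "strict_mono_on {1..N} y"
  shows "0 < limit_const N y"
  unfolding limit_const_def using vdm_pos[OF assms] by (intro divide_pos_pos prod_pos) auto

section \<open>Measurability and affine changes of variables\<close>

lemma measurable_with_top [measurable]: "with_top N y \<in> measurable (array_lborel (N - 1)) (array_borel N)"
  unfolding with_top_def
proof (rule measurable_restrict)
  fix p assume p: "p \<in> gt_index N"
  obtain k i where ki: "p = (k, i)" by (cases p)
  show "(\<lambda>z. (\<lambda>(k, i). if k = N then y i else z (k, i)) p) \<in> borel_measurable (array_lborel (N - 1))"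
  proof (cases "k = N")
    case False
    then have "(k, i) \<in> gt_index (N - 1)" using p ki by (auto simp: gt_index_def)
    then have "(\<lambda>z. z (k, i)) \<in> measurable (array_lborel (N - 1)) lborel" by (rule measurable_component_singleton)
    then show ?thesis using False ki by simp
  qed (simp add: ki)
qed

lemma measurable_array_component:
  assumes "1 \<le> i" "i \<le> k" "k \<le> N"
  shows "(\<lambda>x. x (k, i)) \<in> borel_measurable (array_borel N)"
  using assms by (intro measurable_component_singleton) (simp add: gt_index_def)

lemma sets_gt_patterns [measurable]: "gt_patterns N \<in> sets (array_borel N)"
proof -
  let ?P = "\<lambda>p x. case p of (k, i) \<Rightarrow> x (k + 1, i) \<le> x (k, i) \<and> x (k, i) \<le> x (k + 1, i + 1)"
  have "gt_patterns N = {x \<in> space (array_borel N). \<forall>p\<in>gt_index (N - 1). ?P p x}"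
    by (auto simp: gt_patterns_def space_PiM gt_index_def)
  moreover have "{x \<in> space (array_borel N). ?P p x} \<in> sets (array_borel N)" if "p \<in> gt_index (N - 1)" for p
  proof -
    obtain k i where ki: "p = (k, i)" by (cases p)
    have "(\<lambda>x. x (k, i)) \<in> borel_measurable (array_borel N)"
      "(\<lambda>x. x (k + 1, i)) \<in> borel_measurable (array_borel N)"
      "(\<lambda>x. x (k + 1, i + 1)) \<in> borel_measurable (array_borel N)"
      using that ki by (auto intro!: measurable_array_component simp: gt_index_def)
    then show ?thesis
      unfolding ki prod.case by (intro sets.sets_Collect_conj borel_measurable_le)
  qed
  then have "{x \<in> space (array_borel N). \<forall>p\<in>gt_index (N - 1). ?P p x} \<in> sets (array_borel N)"
    by (intro sets.sets_Collect_finite_All) auto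
  ultimately show ?thesis by simp
qed

lemma measurable_beta_corners_density [measurable]:
  "beta_corners_density N y \<beta> \<in> borel_measurable (array_borel N)"
proof -
  have 1: "(\<lambda>x. (x (k, j) - x (k, i)) powr (2 - \<beta>)) \<in> borel_measurable (array_borel N)"
    if "k \<in> {1..<N}" "j \<in> {1..k}" "i \<in> {1..<j}" for k j i
  proof -
    have [measurable]: "(\<lambda>x. x (k, j)) \<in> borel_measurable (array_borel N)" "(\<lambda>x. x (k, i)) \<in> borel_measurable (array_borel N)"
      using that by (auto intro!: measurable_array_component)
    show ?thesis by measurable
  qed
  have 2: "(\<lambda>x. \<bar>x (k, a) - x (k + 1, b)\<bar> powr (\<beta> / 2 - 1)) \<in> borel_measurable (array_borel N)"
    if "k \<in> {1..<N}" "a \<in> {1..k}" "b \<in> {1..k + 1}" for k a b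
  proof -
    have [measurable]: "(\<lambda>x. x (k, a)) \<in> borel_measurable (array_borel N)" "(\<lambda>x. x (k + 1, b)) \<in> borel_measurable (array_borel N)"
      using that by (auto intro!: measurable_array_component)
    show ?thesis by measurable
  qed
  have "(\<lambda>x. \<Prod>k=1..<N.
        (\<Prod>j=1..k. \<Prod>i=1..<j. (x (k, j) - x (k, i)) powr (2 - \<beta>)) *
        (\<Prod>a=1..k. \<Prod>b=1..k+1. \<bar>x (k, a) - x (k + 1, b)\<bar> powr (\<beta> / 2 - 1))) \<in> borel_measurable (array_borel N)"
    by (intro borel_measurable_prod borel_measurable_times 1 2)
  then show ?thesis
    unfolding beta_corners_density_def[abs_def]
    by (intro borel_measurable_times borel_measurable_divide borel_measurable_const borel_measurable_indicator
        sets_gt_patterns)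
qed

lemma beta_corners_density_nonneg:
  assumes "0 < \<beta>"
  shows "0 \<le> beta_corners_density N y \<beta> x"
proof -
  have "0 < Gamma (\<beta> / 2)" using assms by (intro Gamma_real_pos) simp
  moreover have "0 < Gamma (real k * \<beta> / 2)" if "k \<in> {1..N}" for k
    using assms that by (intro Gamma_real_pos) simp
  ultimately have "0 \<le> beta_corners_Z N y \<beta>"
    unfolding beta_corners_Z_def
    by (intro mult_nonneg_nonneg prod_nonneg divide_nonneg_nonneg) (auto intro: less_imp_le)
  then show ?thesis
    unfolding beta_corners_density_def
    by (intro mult_nonneg_nonneg divide_nonneg_nonneg prod_nonneg ballI) auto
qed

text \<open>Both measures are compared on boxes, where the claim factors into the one-dimensional
  \<open>lborel_real_affine\<close>; each coordinate contributes one factor |c|.\<close>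

lemma PiM_lborel_affine:
  fixes t :: "'i \<Rightarrow> real"
  assumes I: "finite I" and c: "c \<noteq> 0"
  shows "Pi\<^sub>M I (\<lambda>_. lborel) =
    density (distr (Pi\<^sub>M I (\<lambda>_. lborel)) (Pi\<^sub>M I (\<lambda>_. lborel)) (\<lambda>x. \<lambda>i\<in>I. t i + c * x i)) (\<lambda>_. ennreal (\<bar>c\<bar> ^ card I))"
proof -
  interpret product_sigma_finite "\<lambda>_::'i. lborel :: real measure"
    by (simp add: product_sigma_finite_def sigma_finite_lborel)
  let ?T = "\<lambda>x. \<lambda>i\<in>I. t i + c * x i"
  have comp [measurable]: "(\<lambda>x. x i) \<in> borel_measurable (Pi\<^sub>M I (\<lambda>_. lborel))" if "i \<in> I" for i
    using measurable_component_singleton[OF that, of "\<lambda>_. lborel"] by simp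
  have T: "?T \<in> measurable (Pi\<^sub>M I (\<lambda>_. lborel)) (Pi\<^sub>M I (\<lambda>_. lborel))"
    by (intro measurable_restrict) (use comp in auto)
  show ?thesis
  proof (rule PiM_eqI[OF I, symmetric])
    fix A :: "'i \<Rightarrow> real set" assume A: "\<And>i. i \<in> I \<Longrightarrow> A i \<in> sets lborel"
    have PA: "Pi\<^sub>E I A \<in> sets (Pi\<^sub>M I (\<lambda>_. lborel))" using A I by (intro sets_PiM_I_finite) auto
    have vim: "(\<lambda>x. t i + c * x) -` A i \<in> sets lborel" if "i \<in> I" for i
      using measurable_sets[of "\<lambda>x. t i + c * x" borel borel "A i"] A[OF that] by simp
    have "emeasure (density (distr (Pi\<^sub>M I (\<lambda>_. lborel)) (Pi\<^sub>M I (\<lambda>_. lborel)) ?T) (\<lambda>_. ennreal (\<bar>c\<bar> ^ card I))) (Pi\<^sub>E I A)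
      = ennreal (\<bar>c\<bar> ^ card I) * emeasure (distr (Pi\<^sub>M I (\<lambda>_. lborel)) (Pi\<^sub>M I (\<lambda>_. lborel)) ?T) (Pi\<^sub>E I A)"
      using PA by (subst emeasure_density_const) auto
    also have "emeasure (distr (Pi\<^sub>M I (\<lambda>_. lborel)) (Pi\<^sub>M I (\<lambda>_. lborel)) ?T) (Pi\<^sub>E I A) =
        emeasure (Pi\<^sub>M I (\<lambda>_. lborel)) (Pi\<^sub>E I (\<lambda>i. (\<lambda>x. t i + c * x) -` A i))"
      by (subst emeasure_distr[OF T PA]) (auto intro!: arg_cong2[where f=emeasure] simp: space_PiM PiE_def Pi_def extensional_def)
    also have "\<dots> = (\<Prod>i\<in>I. emeasure lborel ((\<lambda>x. t i + c * x) -` A i))"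
      using vim I by (intro emeasure_PiM) auto
    also have "ennreal (\<bar>c\<bar> ^ card I) * \<dots> = (\<Prod>i\<in>I. ennreal \<bar>c\<bar> * emeasure lborel ((\<lambda>x. t i + c * x) -` A i))"
      by (simp add: prod.distrib ennreal_power)
    also have "\<dots> = (\<Prod>i\<in>I. emeasure lborel (A i))"
    proof (rule prod.cong[OF refl])
      fix i assume i: "i \<in> I"
      have "emeasure lborel (A i) = emeasure (density (distr lborel borel (\<lambda>x. t i + c * x)) (\<lambda>_. ennreal \<bar>c\<bar>)) (A i)"
        using lborel_real_affine[OF c, of "t i"] by simp
      also have "\<dots> = ennreal \<bar>c\<bar> * emeasure (distr lborel borel (\<lambda>x. t i + c * x)) (A i)"
        using A[OF i] by (subst emeasure_density_const) auto
      also have "\<dots> = ennreal \<bar>c\<bar> * emeasure lborel ((\<lambda>x. t i + c * x) -` A i)"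
        using A[OF i] by (subst emeasure_distr) auto
      finally show "ennreal \<bar>c\<bar> * emeasure lborel ((\<lambda>x. t i + c * x) -` A i) = emeasure lborel (A i)" by simp
    qed
    finally show "emeasure (density (distr (Pi\<^sub>M I (\<lambda>_. lborel)) (Pi\<^sub>M I (\<lambda>_. lborel)) ?T) (\<lambda>_. ennreal (\<bar>c\<bar> ^ card I))) (Pi\<^sub>E I A)
      = (\<Prod>i\<in>I. emeasure lborel (A i))" .
  qed simp
qed

lemma integral_PiM_lborel_affine:
  fixes f :: "('i \<Rightarrow> real) \<Rightarrow> real" and t :: "'i \<Rightarrow> real"
  assumes I: "finite I" and c: "c \<noteq> 0" and f: "f \<in> borel_measurable (Pi\<^sub>M I (\<lambda>_. lborel))"
  shows "(\<integral>x. f x \<partial>Pi\<^sub>M I (\<lambda>_. lborel)) = (\<integral>x. \<bar>c\<bar> ^ card I * f (\<lambda>i\<in>I. t i + c * x i) \<partial>Pi\<^sub>M I (\<lambda>_. lborel))"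
proof -
  let ?L = "Pi\<^sub>M I (\<lambda>_. lborel :: real measure)"
  let ?T = "\<lambda>x. \<lambda>i\<in>I. t i + c * x i"
  have comp: "(\<lambda>x. x i) \<in> borel_measurable ?L" if "i \<in> I" for i
    using measurable_component_singleton[OF that, of "\<lambda>_. lborel"] by simp
  have T: "?T \<in> measurable ?L ?L"
    by (intro measurable_restrict) (use comp in auto)
  have "(\<integral>x. f x \<partial>?L) = (\<integral>x. f x \<partial>density (distr ?L ?L ?T) (\<lambda>_. ennreal (\<bar>c\<bar> ^ card I)))"
    by (subst PiM_lborel_affine[OF I c, of t]) simp
  also have "\<dots> = (\<integral>x. \<bar>c\<bar> ^ card I * f x \<partial>distr ?L ?L ?T)"
    using f by (subst integral_density) auto
  also have "\<dots> = (\<integral>x. \<bar>c\<bar> ^ card I * f (?T x) \<partial>?L)"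
    using f by (intro integral_distr[OF T]) auto
  finally show ?thesis .
qed

lemma with_top_top: "i \<in> {1..N} \<Longrightarrow> with_top N y z (N, i) = y i"
  by (simp add: with_top_def gt_index_def)

lemma with_top_below: "p \<in> gt_index (N - 1) \<Longrightarrow> 1 \<le> N \<Longrightarrow> with_top N y z p = z p"
  by (auto simp: with_top_def gt_index_def)

lemma with_top_affine:
  assumes "1 \<le> N" "\<And>i. i \<in> {1..N} \<Longrightarrow> xt (N, i) = y i"
  shows "with_top N y (\<lambda>p\<in>gt_index (N - 1). xt p + c * \<xi> p) = scaled_array N xt c (with_top N (\<lambda>_. 0) \<xi>)"
proof (rule ext)
  fix p :: "nat \<times> nat"
  obtain k i where ki: "p = (k, i)" by (cases p)
  show "with_top N y (\<lambda>p\<in>gt_index (N - 1). xt p + c * \<xi> p) p = scaled_array N xt c (with_top N (\<lambda>_. 0) \<xi>) p"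
    using assms unfolding ki with_top_def scaled_array_def by (auto simp: gt_index_def)
qed

text \<open>The triangular form gives a product of sqrt (pi / A) over all entries. By
  \<open>crit_prod_sum_squares\<close> each row contributes a constant times the Vandermonde
  quotient of rows k + 1 and k, and the quotients telescope to \<open>vdm N y\<close>. The constants
  are those from Stirling's formula.\<close>

lemma infty_corners_weight_nn_integral:
  assumes N: "1 \<le> N"
    and y: "strict_mono_on {1..N} y" and top: "\<And>i. i \<in> {1..N} \<Longrightarrow> xt (N, i) = y i"
    and xt: "\<And>k. k \<in> {1..<N} \<Longrightarrow> crit k (gt_row xt k) (gt_row xt (k + 1))"
  shows "(\<integral>\<^sup>+ z. ennreal (infty_corners_weight N xt (with_top N (\<lambda>_. 0) z)) \<partial>array_lborel (N - 1)) =
    ennreal (1 / limit_const N y)"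
proof -
  let ?S = "\<lambda>k a. \<Sum>b=1..k + 1. 1 / (xt (k, a) - xt (k + 1, b))\<^sup>2"
  have il: "strict_interlace k (gt_row xt k) (gt_row xt (k + 1))" if "k \<in> {1..<N}" for k
    using xt[OF that] by (simp add: crit_def)
  have Spos: "0 < ?S k a" if "k \<in> {1..<N}" "a \<in> {1..k}" for k a
    using strict_interlace_neq(1)[OF il[OF that(1)] that(2)] by (intro sum_pos) auto
  have N': "{1..<N} = {1..N - 1}" using N by auto
  have "(\<integral>\<^sup>+ z. ennreal (infty_corners_weight N xt (with_top N (\<lambda>_. 0) z)) \<partial>array_lborel (N - 1)) =
    (\<integral>\<^sup>+ z. ennreal (exp (- (\<Sum>k=1..N - 1. \<Sum>a=1..k. cond_precision xt (k, a) *
      (override_rows (N - 1) (\<lambda>_. 0) z (k, a) -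
       (\<Sum>b=1..k + 1. cond_coeff xt (k, a) b * override_rows (N - 1) (\<lambda>_. 0) z (k + 1, b)))\<^sup>2))) \<partial>array_lborel (N - 1))"
  proof (rule nn_integral_cong)
    fix z :: "nat \<times> nat \<Rightarrow> real"
    have eq: "with_top N (\<lambda>_. 0) z (k, i) = override_rows (N - 1) (\<lambda>_. 0) z (k, i)" if "1 \<le> i" "i \<le> k" "k \<le> N" for k i
      using that N by (auto simp: with_top_def override_rows_def gt_index_def)
    have "(\<Sum>b=1..k + 1. cond_coeff xt (k, a) b * with_top N (\<lambda>_. 0) z (k + 1, b)) =
      (\<Sum>b=1..k + 1. cond_coeff xt (k, a) b * override_rows (N - 1) (\<lambda>_. 0) z (k + 1, b))" if "k \<in> {1..N - 1}" for k a
      using that N by (intro sum.cong refl arg_cong2[where f=times] eq) auto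
    then have "(\<Sum>k=1..<N. \<Sum>a=1..k. cond_precision xt (k, a) * (with_top N (\<lambda>_. 0) z (k, a) -
       (\<Sum>b=1..k + 1. cond_coeff xt (k, a) b * with_top N (\<lambda>_. 0) z (k + 1, b)))\<^sup>2) =
      (\<Sum>k=1..N - 1. \<Sum>a=1..k. cond_precision xt (k, a) *
      (override_rows (N - 1) (\<lambda>_. 0) z (k, a) -
       (\<Sum>b=1..k + 1. cond_coeff xt (k, a) b * override_rows (N - 1) (\<lambda>_. 0) z (k + 1, b)))\<^sup>2)"
      unfolding N' using N by (intro sum.cong refl) (simp add: eq del: sum.cl_ivl_Suc)
    then show "ennreal (infty_corners_weight N xt (with_top N (\<lambda>_. 0) z)) =
      ennreal (exp (- (\<Sum>k=1..N - 1. \<Sum>a=1..k. cond_precision xt (k, a) *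
      (override_rows (N - 1) (\<lambda>_. 0) z (k, a) -
       (\<Sum>b=1..k + 1. cond_coeff xt (k, a) b * override_rows (N - 1) (\<lambda>_. 0) z (k + 1, b)))\<^sup>2)))"
      using infty_corners_weight_eq[OF N xt, of "with_top N (\<lambda>_. 0) z"] with_top_top[of _ N "\<lambda>_. 0" z]
      by (simp only:)
  qed
  also have "\<dots> = ennreal (\<Prod>k=1..N - 1. \<Prod>a=1..k. sqrt (pi / cond_precision xt (k, a)))"
    using Spos by (intro nn_integral_triangular_gaussian) (auto simp: gt_index_def cond_precision_def simp del: sum.cl_ivl_Suc)
  also have "(\<Prod>k=1..N - 1. \<Prod>a=1..k. sqrt (pi / cond_precision xt (k, a))) = 1 / limit_const N y"
  proof -
    let ?V = "\<lambda>k. vdm k (gt_row xt k)"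
    have Vpos: "0 < ?V k" if "k \<in> {1..N}" for k
    proof (cases "k = N")
      case True
      have "vdm N (gt_row xt N) = vdm N y" unfolding vdm_def using top by (intro prod.cong refl) auto
      then show ?thesis using vdm_pos[OF y] True by simp
    next
      case False
      then show ?thesis using that strict_interlace_imp_strict_mono(2)[OF il[of k]] vdm_pos by auto
    qed
    have row: "(\<Prod>a=1..k. sqrt (pi / cond_precision xt (k, a))) =
        ?V (k + 1) / ?V k / ((4 * pi) powr (- real k / 2) * real (k + 1) powr (real k + 1 / 2))"
      if k: "k \<in> {1..<N}" for k
    proof -
      \<comment> \<open>The precision is \<open>?S k a\<close> / 4, so the row integral is sqrt (4
        pi)^k / sqrt Q; this is the source of the 4 pi in \<open>limit_const\<close>.\<close>
      define Q where "Q = (\<Prod>a=1..k. ?S k a)"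
      have Q: "Q * (?V (k + 1))\<^sup>2 = real (k + 1) ^ (2 * k + 1) * (?V k)\<^sup>2"
        using crit_prod_sum_squares[OF xt[OF k]] unfolding Q_def .
      have V: "0 < ?V k" "0 < ?V (k + 1)" using Vpos k by auto
      have "Q = real (k + 1) ^ (2 * k + 1) * (?V k / ?V (k + 1))\<^sup>2"
        using Q V by (simp add: field_simps power_divide)
      then have "sqrt Q = sqrt (real (k + 1) ^ (2 * k + 1)) * (?V k / ?V (k + 1))"
        using V by (simp add: real_sqrt_mult real_sqrt_divide del: power_Suc of_nat_Suc)
      also have "sqrt (real (k + 1) ^ (2 * k + 1)) = real (k + 1) powr (real (2 * k + 1) / 2)"
        by (simp add: powr_half_sqrt[symmetric] powr_realpow[symmetric] powr_powr del: power_Suc of_nat_Suc)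
      also have "real (2 * k + 1) / 2 = real k + 1 / 2" by (simp add: add_divide_distrib)
      finally have sQ: "sqrt Q = real (k + 1) powr (real k + 1 / 2) * (?V k / ?V (k + 1))" .
      have "(\<Prod>a=1..k. sqrt (pi / cond_precision xt (k, a))) = (\<Prod>a=1..k. sqrt (4 * pi) / sqrt (?S k a))"
        by (intro prod.cong refl) (simp add: cond_precision_def real_sqrt_divide[symmetric] mult.commute del: sum.cl_ivl_Suc)
      also have "\<dots> = sqrt (4 * pi) ^ k / sqrt Q"
      proof -
        have "sqrt (prod f A) = (\<Prod>a\<in>A. sqrt (f a))" for f :: "nat \<Rightarrow> real" and A
          by (induction A rule: infinite_finite_induct) (auto simp: real_sqrt_mult)
        then show ?thesis unfolding Q_def prod_dividef by simp
      qed
      also have "sqrt (4 * pi) ^ k = 1 / (4 * pi) powr (- real k / 2)"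
      proof -
        have "sqrt x ^ k = 1 / x powr (- real k / 2)" if "0 < x" for x
        proof -
          have "sqrt x ^ k = (x powr (1 / 2)) powr real k"
            using that by (simp add: powr_half_sqrt powr_realpow)
          also have "\<dots> = x powr (real k / 2)" by (simp add: powr_powr)
          also have "\<dots> = 1 / x powr (- real k / 2)" by (simp add: powr_minus_divide)
          finally show ?thesis .
        qed
        then show ?thesis by simp
      qed
      finally have "(\<Prod>a=1..k. sqrt (pi / cond_precision xt (k, a))) = 1 / (4 * pi) powr (- real k / 2) / sqrt Q" .
      moreover have "1 / q / (p * (u / w)) = w / u / (q * p)" for p q u w :: real by simp
      ultimately show ?thesis unfolding sQ by (simp only:)
    qed
    have "(\<Prod>k=1..N - 1. \<Prod>a=1..k. sqrt (pi / cond_precision xt (k, a))) =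
       (\<Prod>k=1..<N. ?V (k + 1) / ?V k / ((4 * pi) powr (- real k / 2) * real (k + 1) powr (real k + 1 / 2)))"
      unfolding N'[symmetric] by (intro prod.cong refl row)
    also have "\<dots> = (\<Prod>k=1..<N. ?V (k + 1) / ?V k) /
        (\<Prod>k=1..<N. (4 * pi) powr (- real k / 2) * real (k + 1) powr (real k + 1 / 2))"
      by (rule prod_dividef)
    also have "(\<Prod>k=1..<N. ?V (k + 1) / ?V k) = ?V N / ?V 1"
      using N Vpos
    proof (induction N rule: dec_induct)
      case base
      have "0 < ?V 1" using Vpos N by auto
      then show ?case by simp
    next
      case (step n)
      have IH: "(\<Prod>k=1..<n. ?V (k + 1) / ?V k) = ?V n / ?V 1" using step by auto
      have "0 < ?V n" using step by auto
      then show ?case using step(1) IH by simp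
    qed
    also have "?V 1 = 1" by (simp add: vdm_def)
    also have "?V N = vdm N y" unfolding vdm_def using top by (intro prod.cong refl) auto
    finally show ?thesis unfolding limit_const_def by simp
  qed
  finally show ?thesis .
qed

section \<open>Laplace's method\<close>

lemma exp_neg_sum_squares_integrable:
  assumes "0 < c"
  shows "integrable (array_lborel n) (\<lambda>\<xi>. exp (- c * (\<Sum>p\<in>gt_index n. (\<xi> p)\<^sup>2)))"
proof -
  interpret product_sigma_finite "\<lambda>_::nat \<times> nat. lborel :: real measure"
    by (simp add: product_sigma_finite_def sigma_finite_lborel)
  have "(\<integral>\<^sup>+ x. ennreal (exp (- c * (x - 0)\<^sup>2)) \<partial>lborel) < \<infinity>"
    unfolding nn_integral_gaussian[OF assms] by simp
  then have "integrable lborel (\<lambda>x. exp (- c * x\<^sup>2))"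
    by (intro integrableI_nonneg) auto
  then have "integrable (array_lborel n) (\<lambda>\<xi>. \<Prod>p\<in>gt_index n. exp (- c * (\<xi> p)\<^sup>2))"
    by (intro product_integrable_prod) auto
  then show ?thesis by (simp add: exp_sum[symmetric] sum_distrib_left sum_negf)
qed

text \<open>Substituting z = xt + \<xi> / sqrt \<beta> in the entries below the top row; the
  Jacobian is 1 / sqrt \<beta> to the number of these entries.\<close>

lemma integral_beta_corners:
  assumes N: "1 \<le> N" and \<beta>: "0 < \<beta>"
    and top: "\<And>i. i \<in> {1..N} \<Longrightarrow> xt (N, i) = y i"
    and F: "F \<in> borel_measurable (array_borel N)"
  defines "X \<equiv> \<lambda>\<xi>. scaled_array N xt (1 / sqrt \<beta>) (with_top N (\<lambda>_. 0) \<xi>)"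
  shows "(\<integral>x. F x \<partial>beta_corners N y \<beta>) =
    (\<integral>\<xi>. F (X \<xi>) * (\<beta> powr (- real (card (gt_index (N - 1))) / 2) * beta_corners_density N y \<beta> (X \<xi>))
      \<partial>array_lborel (N - 1))"
proof -
  let ?L = "array_lborel (N - 1)"
  have X_eq: "X \<xi> = with_top N y (\<lambda>p\<in>gt_index (N - 1). xt p + 1 / sqrt \<beta> * \<xi> p)" for \<xi>
    unfolding X_def by (rule with_top_affine[OF N, symmetric]) (rule top)
  have meas: "(\<lambda>z. F (with_top N y z)) \<in> borel_measurable ?L"
    using measurable_compose[OF measurable_with_top F] .
  have dmeas: "(\<lambda>z. beta_corners_density N y \<beta> (with_top N y z)) \<in> borel_measurable ?L"
    by measurable
  have "(\<integral>x. F x \<partial>beta_corners N y \<beta>) =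
     (\<integral>z. F (with_top N y z) \<partial>density ?L (\<lambda>z. ennreal (beta_corners_density N y \<beta> (with_top N y z))))"
    unfolding beta_corners_def using measurable_with_top
    by (intro integral_distr F) simp
  also have "\<dots> = (\<integral>z. beta_corners_density N y \<beta> (with_top N y z) * F (with_top N y z) \<partial>?L)"
    using meas dmeas beta_corners_density_nonneg[OF \<beta>] by (subst integral_density) auto
  also have "\<dots> = (\<integral>\<xi>. \<bar>1 / sqrt \<beta>\<bar> ^ card (gt_index (N - 1)) *
      (beta_corners_density N y \<beta> (X \<xi>) * F (X \<xi>)) \<partial>?L)"
    unfolding X_eq
    using meas dmeas \<beta> by (intro integral_PiM_lborel_affine) auto
  also have "\<bar>1 / sqrt \<beta>\<bar> ^ card (gt_index (N - 1)) = \<beta> powr (- real (card (gt_index (N - 1))) / 2)"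
  proof -
    have "\<bar>1 / sqrt \<beta>\<bar> = 1 / \<beta> powr (1 / 2)"
      using \<beta> by (subst powr_half_sqrt) auto
    also have "\<dots> = \<beta> powr (- (1 / 2))" by (rule powr_minus_divide[symmetric])
    finally have eq: "\<bar>1 / sqrt \<beta>\<bar> = \<beta> powr (- (1 / 2))" .
    have "0 < \<beta> powr (- (1 / 2))" using \<beta> by simp
    then have "\<bar>1 / sqrt \<beta>\<bar> ^ n = (\<beta> powr (- (1 / 2))) powr real n" for n
      unfolding eq by (rule powr_realpow[symmetric])
    then show ?thesis by (simp only: powr_powr) simp
  qed
  finally show ?thesis by (simp only: mult_ac)
qed

text \<open>The test function may vary with \<beta>, so one statement covers both claims: a fixed
  \<open>f\<close> for the law of large numbers and \<open>f\<close> composed with the rescaling for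
  the fluctuations. Convergence is required only along the arrays xt + \<xi> / sqrt \<beta> with
  fixed \<xi>.\<close>

lemma beta_corners_integral_tendsto:
  assumes N: "1 \<le> N" and y: "strict_mono_on {1..N} y" and arr: "infty_corners_array N y xt"
    and F: "\<And>\<beta>. F \<beta> \<in> borel_measurable (array_borel N)"
    and bound: "\<And>\<beta> x. x \<in> gt_index N \<rightarrow>\<^sub>E UNIV \<Longrightarrow> \<bar>F \<beta> x\<bar> \<le> B"
    and lim: "\<And>\<xi>. ((\<lambda>\<beta>. F \<beta> (scaled_array N xt (1 / sqrt \<beta>) (with_top N (\<lambda>_. 0) \<xi>))) \<longlongrightarrow> F0 \<xi>) at_top"
  shows "((\<lambda>\<beta>. \<integral>x. F \<beta> x \<partial>beta_corners N y \<beta>) \<longlongrightarrow>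
    (\<integral>\<xi>. F0 \<xi> * (limit_const N y * infty_corners_weight N xt (with_top N (\<lambda>_. 0) \<xi>)) \<partial>array_lborel (N - 1))) at_top"
proof -
  let ?L = "array_lborel (N - 1)"
  let ?X = "\<lambda>\<beta> \<xi>. scaled_array N xt (1 / sqrt \<beta>) (with_top N (\<lambda>_. 0) \<xi>)"
  let ?p = "\<lambda>\<beta>::real. \<beta> powr (- real (card (gt_index (N - 1))) / 2)"
  let ?g = "\<lambda>\<beta> \<xi>. ?p \<beta> * beta_corners_density N y \<beta> (?X \<beta> \<xi>)"
  let ?w = "\<lambda>\<xi>. infty_corners_weight N xt (with_top N (\<lambda>_. 0) \<xi>)"
  note top = infty_corners_array_top[OF N y arr] and crit = infty_corners_array_crit[OF arr]
  have il: "strict_gt N xt" using crit by (simp add: strict_gt_def crit_def)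
  have Xin: "?X \<beta> \<xi> \<in> gt_index N \<rightarrow>\<^sub>E UNIV" for \<beta> \<xi> by (simp add: scaled_array_def)
  have Xtop: "?X \<beta> \<xi> (N, i) = y i" if "i \<in> {1..N}" for \<beta> \<xi> i
    using that top by (simp add: scaled_array_nth with_top_top)
  have dens: "beta_corners_density N y \<beta> (?X \<beta> \<xi>) = density_const N y \<beta> * exp ((\<beta> / 2 - 1) * gt_energy N (?X \<beta> \<xi>))"
    if "strict_gt N (?X \<beta> \<xi>)" for \<beta> \<xi>
    by (rule beta_corners_density_strict[OF N y Xin _ that]) (rule Xtop)
  have Xmeas [measurable]: "?X \<beta> \<in> measurable ?L (array_borel N)" for \<beta>
  proof -
    have eq: "?X \<beta> = (\<lambda>x. \<lambda>p\<in>gt_index N. xt p + (1 / sqrt \<beta>) * x p) \<circ> with_top N (\<lambda>_. 0)"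
      by (simp add: scaled_array_def fun_eq_iff)
    show ?thesis unfolding eq
    proof (rule measurable_comp[OF measurable_with_top])
      show "(\<lambda>x. \<lambda>p\<in>gt_index N. xt p + (1 / sqrt \<beta>) * x p) \<in> measurable (array_borel N) (array_borel N)"
        by measurable
    qed
  qed
  have gmeas: "(\<lambda>\<xi>. F \<beta> (?X \<beta> \<xi>) * ?g \<beta> \<xi>) \<in> borel_measurable ?L" for \<beta>
    using measurable_compose[OF Xmeas F] measurable_compose[OF Xmeas measurable_beta_corners_density]
    by (intro borel_measurable_times borel_measurable_const)
  have glim: "((\<lambda>\<beta>. ?g \<beta> \<xi>) \<longlongrightarrow> limit_const N y * ?w \<xi>) at_top" for \<xi>
  proof (rule Lim_transform_eventually)
    show "((\<lambda>\<beta>. ?p \<beta> * density_const N y \<beta> * exp ((\<beta> / 2 - 1) * gt_energy N (?X \<beta> \<xi>)))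
        \<longlongrightarrow> limit_const N y * ?w \<xi>) at_top"
      by (intro tendsto_mult density_const_tendsto[OF N] gt_energy_scaled_tendsto[where xt=xt, OF N crit] with_top_top)
    have "\<forall>\<^sub>F \<beta> in at_top. strict_gt N (?X \<beta> \<xi>)"
      using eventually_strict_gt[OF il] filterlim_inverse_sqrt_at_0 by (rule eventually_compose_filterlim)
    then show "\<forall>\<^sub>F \<beta> in at_top. ?p \<beta> * density_const N y \<beta> * exp ((\<beta> / 2 - 1) * gt_energy N (?X \<beta> \<xi>)) = ?g \<beta> \<xi>"
    proof eventually_elim
      case (elim \<beta>)
      show ?case by (simp add: dens[OF elim])
    qed
  qed
  obtain c where c: "0 < c"
    "\<And>x. strict_gt N x \<Longrightarrow> (\<And>i. i \<in> {1..N} \<Longrightarrow> x (N, i) = xt (N, i)) \<Longrightarrow>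
       gt_energy N x \<le> - c * (\<Sum>p\<in>gt_index (N - 1). (x p - xt p)\<^sup>2)"
    using gt_energy_le[where xt=xt, OF N crit] by metis
  \<comment> \<open>For \<beta> >= 4 the ratio (\<beta> / 2 - 1) / \<beta> is at least 1/4, which
    turns the energy bound into c / 4; the prefactor is eventually below its limit plus 1.\<close>
  let ?b = "\<lambda>\<xi>. \<bar>B\<bar> * ((limit_const N y + 1) * exp (- (c / 4) * (\<Sum>p\<in>gt_index (N - 1). (\<xi> p)\<^sup>2)))"
  have bint: "integrable ?L ?b"
    using c(1) by (intro integrable_mult_right exp_neg_sum_squares_integrable) simp
  have dom: "\<forall>\<^sub>F \<beta> in at_top. AE \<xi> in ?L. norm (F \<beta> (?X \<beta> \<xi>) * ?g \<beta> \<xi>) \<le> ?b \<xi>"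
    using eventually_ge_at_top[of 4] order_tendstoD(2)[OF density_const_tendsto[OF N, of y], of "limit_const N y + 1", simplified]
  proof eventually_elim
    case (elim \<beta>)
    have "norm (F \<beta> (?X \<beta> \<xi>) * ?g \<beta> \<xi>) \<le> ?b \<xi>" for \<xi>
    proof -
      have g0: "0 \<le> ?g \<beta> \<xi>" using beta_corners_density_nonneg[of \<beta>] elim by simp
      have lc: "0 < limit_const N y" using limit_const_pos[OF y] .
      have gle: "?g \<beta> \<xi> \<le> (limit_const N y + 1) * exp (- (c / 4) * (\<Sum>p\<in>gt_index (N - 1). (\<xi> p)\<^sup>2))"
      proof (cases "strict_gt N (?X \<beta> \<xi>)")
        case False
        then show ?thesis using beta_corners_density_nonstrict[OF False] lc by simp
      next
        case True
        have "(\<Sum>p\<in>gt_index (N - 1). (?X \<beta> \<xi> p - xt p)\<^sup>2) = (\<Sum>p\<in>gt_index (N - 1). (\<xi> p)\<^sup>2) / \<beta>"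
          unfolding sum_divide_distrib
        proof (rule sum.cong[OF refl])
          fix p assume p: "p \<in> gt_index (N - 1)"
          then have "p \<in> gt_index N" by (auto simp: gt_index_def)
          then show "(?X \<beta> \<xi> p - xt p)\<^sup>2 = (\<xi> p)\<^sup>2 / \<beta>"
            using with_top_below[OF p N] elim by (simp add: scaled_array_def power_divide)
        qed
        moreover have "gt_energy N (?X \<beta> \<xi>) \<le> - c * (\<Sum>p\<in>gt_index (N - 1). (?X \<beta> \<xi> p - xt p)\<^sup>2)"
          using Xtop top by (intro c(2)[OF True]) simp
        ultimately have "(\<beta> / 2 - 1) * gt_energy N (?X \<beta> \<xi>) \<le> (\<beta> / 2 - 1) * (- c * ((\<Sum>p\<in>gt_index (N - 1). (\<xi> p)\<^sup>2) / \<beta>))"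
          using elim by (intro mult_left_mono) auto
        also have "\<dots> = - (c * (\<Sum>p\<in>gt_index (N - 1). (\<xi> p)\<^sup>2)) * ((\<beta> / 2 - 1) / \<beta>)" by simp
        also have "\<dots> \<le> - (c * (\<Sum>p\<in>gt_index (N - 1). (\<xi> p)\<^sup>2)) * (1 / 4)"
          using elim c(1) by (intro mult_left_mono_neg) (auto simp: field_simps intro!: mult_nonneg_nonneg sum_nonneg)
        finally have "exp ((\<beta> / 2 - 1) * gt_energy N (?X \<beta> \<xi>)) \<le> exp (- (c / 4) * (\<Sum>p\<in>gt_index (N - 1). (\<xi> p)\<^sup>2))"
          by simp
        then have "?p \<beta> * density_const N y \<beta> * exp ((\<beta> / 2 - 1) * gt_energy N (?X \<beta> \<xi>)) \<le>
            (limit_const N y + 1) * exp (- (c / 4) * (\<Sum>p\<in>gt_index (N - 1). (\<xi> p)\<^sup>2))"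
          using elim lc by (intro mult_mono) auto
        then show ?thesis by (simp add: dens[OF True])
      qed
      have "\<bar>F \<beta> (?X \<beta> \<xi>)\<bar> \<le> \<bar>B\<bar>" using bound[OF Xin, of \<beta> \<beta> \<xi>] by linarith
      then have "\<bar>F \<beta> (?X \<beta> \<xi>)\<bar> * ?g \<beta> \<xi> \<le> ?b \<xi>" by (rule mult_mono[OF _ gle abs_ge_zero g0])
      then show ?thesis
        by (simp only: real_norm_def abs_mult[of "F \<beta> (?X \<beta> \<xi>)" "?g \<beta> \<xi>"] abs_of_nonneg[OF g0])
    qed
    then show ?case by simp
  qed
  \<comment> \<open>\<open>F0\<close> is known only as a pointwise limit, so measurability is
    inherited along integer values of \<beta>.\<close>
  have wmeas: "(\<lambda>\<xi>. F0 \<xi> * (limit_const N y * ?w \<xi>)) \<in> borel_measurable ?L"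
  proof (rule borel_measurable_LIMSEQ_real)
    fix \<xi>
    have "((\<lambda>\<beta>. F \<beta> (?X \<beta> \<xi>) * ?g \<beta> \<xi>) \<longlongrightarrow> F0 \<xi> * (limit_const N y * ?w \<xi>)) at_top"
      by (intro tendsto_mult lim glim)
    then show "(\<lambda>n. F (real n) (?X (real n) \<xi>) * ?g (real n) \<xi>) \<longlonglongrightarrow> F0 \<xi> * (limit_const N y * ?w \<xi>)"
      by (rule filterlim_compose[OF _ filterlim_real_sequentially])
  qed (rule gmeas)
  have "((\<lambda>\<beta>. \<integral>\<xi>. F \<beta> (?X \<beta> \<xi>) * ?g \<beta> \<xi> \<partial>?L) \<longlongrightarrow> (\<integral>\<xi>. F0 \<xi> * (limit_const N y * ?w \<xi>) \<partial>?L)) at_top"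
    by (rule integral_dominated_convergence_at_top[OF wmeas gmeas bint _ dom])
      (intro AE_I2 tendsto_mult lim glim)
  moreover have "\<forall>\<^sub>F \<beta> in at_top. (\<integral>\<xi>. F \<beta> (?X \<beta> \<xi>) * ?g \<beta> \<xi> \<partial>?L) = (\<integral>x. F \<beta> x \<partial>beta_corners N y \<beta>)"
    using eventually_gt_at_top[of 0]
    by eventually_elim (rule integral_beta_corners[where xt=xt, OF N _ top F, symmetric])
  ultimately show ?thesis by (rule Lim_transform_eventually)
qed

text \<open>On the full function space over the countable type \<open>nat \<times> nat\<close>,
  Borel and product sigma-algebras agree. So \<open>f\<close> is composed with the continuous
  restriction \<open>r\<close>, then with the measurable extension by zero \<open>?e\<close>; on
  arrays \<open>r\<close> after \<open>?e\<close> is the identity.\<close>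

lemma continuous_map_array_topology_measurable:
  assumes f: "continuous_map (array_topology N) euclideanreal f"
  shows "f \<in> borel_measurable (array_borel N)"
proof -
  define r where "r x = restrict x (gt_index N)" for x :: "nat \<times> nat \<Rightarrow> real"
  have "continuous_map (product_topology (\<lambda>_. euclideanreal) UNIV) (array_topology N) r"
    unfolding continuous_map_componentwise
  proof (intro conjI ballI)
    fix p assume p: "p \<in> gt_index N"
    have "continuous_map (product_topology (\<lambda>_. euclideanreal) UNIV) euclideanreal (\<lambda>x. x p)"
      by (rule continuous_map_product_projection) simp
    then show "continuous_map (product_topology (\<lambda>_. euclideanreal) UNIV) euclideanreal (\<lambda>x. r x p)"
      using p by (simp add: r_def)
  qed (auto simp: r_def)
  then have "continuous_map euclidean euclidean (f \<circ> r)"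
    using f unfolding euclidean_product_topology by (rule continuous_map_compose)
  then have "continuous_on UNIV (f \<circ> r)" by (simp only: continuous_map_iff_continuous2)
  then have "f \<circ> r \<in> borel_measurable borel" by (rule borel_measurable_continuous_onI)
  then have fr: "f \<circ> r \<in> borel_measurable (Pi\<^sub>M UNIV (\<lambda>_. borel))"
    by (subst measurable_cong_sets[OF sets_PiM_equal_borel refl])
  let ?e = "\<lambda>x p. if p \<in> gt_index N then x p else 0"
  have "?e \<in> measurable (array_borel N) (Pi\<^sub>M UNIV (\<lambda>_. borel))"
  proof (rule measurable_PiM_single')
    fix p
    show "(\<lambda>x. ?e x p) \<in> borel_measurable (array_borel N)"
      by (cases "p \<in> gt_index N") auto
  qed auto
  from measurable_compose[OF this fr] have "(\<lambda>x. f (r (?e x))) \<in> borel_measurable (array_borel N)"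
    by simp
  moreover have "f (r (?e x)) = f x" if "x \<in> space (array_borel N)" for x
  proof -
    have "r (?e x) = x" using that by (auto simp: r_def space_PiM PiE_def extensional_def restrict_def fun_eq_iff)
    then show ?thesis by simp
  qed
  ultimately show ?thesis by (subst measurable_cong[of _ _ "\<lambda>x. f (r (?e x))"]) auto
qed

lemma measurable_infty_corners_weight [measurable]:
  "infty_corners_weight N xt \<in> borel_measurable (array_borel N)"
  unfolding infty_corners_weight_def[abs_def]
  by (intro measurable_compose[OF _ borel_measurable_exp] borel_measurable_sum borel_measurable_diff
      borel_measurable_divide borel_measurable_power borel_measurable_const measurable_array_component) auto

lemma limitin_array_topology:
  assumes "\<And>p. p \<in> gt_index N \<Longrightarrow> ((\<lambda>b. g b p) \<longlongrightarrow> l p) F" "l \<in> gt_index N \<rightarrow>\<^sub>E UNIV" "\<And>b. g b \<in> gt_index N \<rightarrow>\<^sub>E UNIV"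
  shows "limitin (array_topology N) g l F"
  using assms unfolding limitin_componentwise by (auto simp: PiE_def)

theorem theorem1p6:
  fixes N :: nat and y :: "nat \<Rightarrow> real" and xt :: "nat \<times> nat \<Rightarrow> real"
  assumes "N \<ge> 1"
    and "strict_mono_on {1..N} y"
    and "infty_corners_array N y xt"
  shows "conv_in_distribution (array_topology N)
           (\<lambda>\<beta>. beta_corners N y \<beta>) (return (array_borel N) xt) at_top \<and>
         conv_in_distribution (array_topology N)
           (\<lambda>\<beta>. distr (beta_corners N y \<beta>) (array_borel N)
                   (\<lambda>x. \<lambda>p\<in>gt_index N. sqrt \<beta> * (x p - xt p)))
           (infty_corners_field N xt) at_top"
proof -
  note N = assms(1) and y = assms(2) and arr = assms(3)
  let ?L = "array_lborel (N - 1)"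
  let ?w = "\<lambda>z. infty_corners_weight N xt (with_top N (\<lambda>_. 0) z)"
  let ?\<kappa> = "limit_const N y"
  note top = infty_corners_array_top[OF N y arr] and crit = infty_corners_array_crit[OF arr]
  have \<kappa>: "0 < ?\<kappa>" using limit_const_pos[OF y] .
  have wpos: "0 \<le> ?w z" for z by (simp add: infty_corners_weight_def)
  \<comment> \<open>Here the two constants meet: the weight has mass 1 / \<kappa> with the same
    \<kappa> that arises as the limit of the prefactor.\<close>
  have wint: "(\<integral>\<^sup>+ z. ennreal (?w z) \<partial>?L) = ennreal (1 / ?\<kappa>)"
    by (rule infty_corners_weight_nn_integral[OF N y top crit])
  have wmeas: "?w \<in> borel_measurable ?L" by measurable
  have wint': "(\<integral>z. ?w z \<partial>?L) = 1 / ?\<kappa>"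
    using wint wpos wmeas \<kappa> by (subst integral_eq_nn_integral) auto
  have xt: "xt \<in> gt_index N \<rightarrow>\<^sub>E UNIV"
    using arr by (auto simp: infty_corners_array_def gt_patterns_def)
  have Xin: "scaled_array N xt t \<eta> \<in> gt_index N \<rightarrow>\<^sub>E UNIV" for t \<eta> by (simp add: scaled_array_def)
  show ?thesis
    unfolding conv_in_distribution_def
  proof (intro conjI allI impI; elim conjE)
    fix f assume f: "continuous_map (array_topology N) euclideanreal f" and "bounded (f ` topspace (array_topology N))"
    then obtain B where B: "\<And>x. x \<in> gt_index N \<rightarrow>\<^sub>E UNIV \<Longrightarrow> \<bar>f x\<bar> \<le> B"
      unfolding bounded_iff by auto
    note fmeas = continuous_map_array_topology_measurable[OF f]
    \<comment> \<open>Under the scaling every fixed \<xi> gives arrays converging to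
      \<open>xt\<close>, so \<open>f\<close> becomes the constant \<open>f xt\<close>, and the
      remaining mass is 1.\<close>
    have "((\<lambda>\<beta>. \<integral>x. f x \<partial>beta_corners N y \<beta>) \<longlongrightarrow> (\<integral>\<xi>. f xt * (?\<kappa> * ?w \<xi>) \<partial>?L)) at_top"
    proof (rule beta_corners_integral_tendsto[OF N y arr fmeas B])
      fix \<xi> :: "nat \<times> nat \<Rightarrow> real"
      have "limitin (array_topology N) (\<lambda>\<beta>. scaled_array N xt (1 / sqrt \<beta>) (with_top N (\<lambda>_. 0) \<xi>)) xt at_top"
      proof (rule limitin_array_topology[OF _ xt Xin])
        fix p assume p: "p \<in> gt_index N"
        have "((\<lambda>\<beta>. 1 / sqrt \<beta>) \<longlongrightarrow> 0) at_top" using filterlim_inverse_sqrt_at_0 by (simp add: filterlim_at)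
        then have "((\<lambda>\<beta>. xt p + 1 / sqrt \<beta> * with_top N (\<lambda>_. 0) \<xi> p) \<longlongrightarrow> xt p + 0 * with_top N (\<lambda>_. 0) \<xi> p) at_top"
          by (intro tendsto_add tendsto_mult tendsto_const)
        then show "((\<lambda>\<beta>. scaled_array N xt (1 / sqrt \<beta>) (with_top N (\<lambda>_. 0) \<xi>) p) \<longlongrightarrow> xt p) at_top"
          using p by (simp add: scaled_array_def)
      qed
      from continuous_map_limit[OF f this]
      show "((\<lambda>\<beta>. f (scaled_array N xt (1 / sqrt \<beta>) (with_top N (\<lambda>_. 0) \<xi>))) \<longlongrightarrow> f xt) at_top"
        by (simp add: comp_def)
    qed
    also have "(\<integral>\<xi>. f xt * (?\<kappa> * ?w \<xi>) \<partial>?L) = f xt" using wint' \<kappa> by simp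
    also have "f xt = (\<integral>x. f x \<partial>return (array_borel N) xt)"
      using xt by (intro integral_return[symmetric] fmeas) (simp add: space_PiM)
    finally show "((\<lambda>\<beta>. \<integral>x. f x \<partial>beta_corners N y \<beta>) \<longlongrightarrow> (\<integral>x. f x \<partial>return (array_borel N) xt)) at_top" .
  next
    fix f assume f: "continuous_map (array_topology N) euclideanreal f" and "bounded (f ` topspace (array_topology N))"
    then obtain B where B: "\<And>x. x \<in> gt_index N \<rightarrow>\<^sub>E UNIV \<Longrightarrow> \<bar>f x\<bar> \<le> B"
      unfolding bounded_iff by auto
    note fmeas = continuous_map_array_topology_measurable[OF f]
    let ?T = "\<lambda>\<beta> x. \<lambda>p\<in>gt_index N. sqrt \<beta> * (x p - xt p)"
    have Tmeas: "?T \<beta> \<in> measurable (array_borel N) (array_borel N)" for \<beta> by measurable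
    \<comment> \<open>\<open>?T \<beta>\<close> exactly undoes the scaling for positive \<beta>, so
      along the scaled arrays the test function is eventually constant in \<beta>.\<close>
    have "((\<lambda>\<beta>. \<integral>x. f (?T \<beta> x) \<partial>beta_corners N y \<beta>) \<longlongrightarrow>
        (\<integral>\<xi>. f (with_top N (\<lambda>_. 0) \<xi>) * (?\<kappa> * ?w \<xi>) \<partial>?L)) at_top"
    proof (rule beta_corners_integral_tendsto[OF N y arr])
      show "(\<lambda>x. f (?T \<beta> x)) \<in> borel_measurable (array_borel N)" for \<beta>
        by (rule measurable_compose[OF Tmeas fmeas])
      show "\<bar>f (?T \<beta> x)\<bar> \<le> B" for \<beta> x by (rule B) simp
      fix \<xi> :: "nat \<times> nat \<Rightarrow> real"
      have "\<forall>\<^sub>F \<beta> in at_top. f (with_top N (\<lambda>_. 0) \<xi>) = f (?T \<beta> (scaled_array N xt (1 / sqrt \<beta>) (with_top N (\<lambda>_. 0) \<xi>)))"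
        using eventually_gt_at_top[of 0]
      proof eventually_elim
        case (elim \<beta>)
        have "?T \<beta> (scaled_array N xt (1 / sqrt \<beta>) (with_top N (\<lambda>_. 0) \<xi>)) = with_top N (\<lambda>_. 0) \<xi>"
          using elim by (auto simp: scaled_array_def with_top_def fun_eq_iff)
        then show ?case by simp
      qed
      then show "((\<lambda>\<beta>. f (?T \<beta> (scaled_array N xt (1 / sqrt \<beta>) (with_top N (\<lambda>_. 0) \<xi>)))) \<longlongrightarrow> f (with_top N (\<lambda>_. 0) \<xi>)) at_top"
        by (rule Lim_transform_eventually[OF tendsto_const])
    qed
    moreover have "(\<integral>x. f x \<partial>distr (beta_corners N y \<beta>) (array_borel N) (?T \<beta>)) = (\<integral>x. f (?T \<beta> x) \<partial>beta_corners N y \<beta>)" for \<beta>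
    proof (rule integral_distr[OF _ fmeas])
      have "sets (beta_corners N y \<beta>) = sets (array_borel N)" by (simp add: beta_corners_def)
      from measurable_cong_sets[OF this refl] Tmeas
      show "?T \<beta> \<in> measurable (beta_corners N y \<beta>) (array_borel N)" by blast
    qed
    moreover have "(\<integral>x. f x \<partial>infty_corners_field N xt) = (\<integral>\<xi>. f (with_top N (\<lambda>_. 0) \<xi>) * (?\<kappa> * ?w \<xi>) \<partial>?L)"
    proof -
      have dens: "ennreal (?w z) / (\<integral>\<^sup>+ u. ennreal (?w u) \<partial>?L) = ennreal (?\<kappa> * ?w z)" for z
        unfolding wint using \<kappa> wpos by (subst divide_ennreal) (auto simp: mult.commute)
      have "(\<integral>x. f x \<partial>infty_corners_field N xt) = (\<integral>\<xi>. f (with_top N (\<lambda>_. 0) \<xi>) \<partial>density ?L (\<lambda>z. ennreal (?\<kappa> * ?w z)))"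
        unfolding infty_corners_field_def Let_def dens using measurable_with_top
        by (intro integral_distr fmeas) simp
      also have "\<dots> = (\<integral>\<xi>. (?\<kappa> * ?w \<xi>) * f (with_top N (\<lambda>_. 0) \<xi>) \<partial>?L)"
        using \<kappa> wpos wmeas measurable_compose[OF measurable_with_top fmeas]
        by (subst integral_density) (auto intro!: borel_measurable_times)
      finally show ?thesis by (simp only: mult.commute)
    qed
    ultimately show "((\<lambda>\<beta>. \<integral>x. f x \<partial>distr (beta_corners N y \<beta>) (array_borel N) (?T \<beta>)) \<longlongrightarrow>
        (\<integral>x. f x \<partial>infty_corners_field N xt)) at_top" by (simp only:)
  qed
qed

end
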